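(* Let $\mathbf{C}\subseteq\mathbf{Sh}(\mathsf{Sp}_f)$ be the full subcategory of sober sheaves for the front topology, and let $\mathbf{D}\subseteq\mathbf{LNFrm}$ be the full subcategory of spatial left-handed noncommutative frames. The functors $G$ and $H$ induce a dual equivalence between $\mathbf{C}$ and $\mathbf{D}$, i.e. they restrict to mutually quasi-inverse equivalences $H:\mathbf{C}^{\mathrm{op}}\to\mathbf{D}$ and $G:\mathbf{D}\to\mathbf{C}^{\mathrm{op}}$.
   Context: **Skew lattices.** A skew lattice is a set $A$ with idempotent associative operations $\wedge,\vee$ satisfying $x\wedge(x\vee y)=x=x\vee(x\wedge y)$ and $(x\wedge y)\vee y=y=(x\vee y)\wedge y$. Natural partial order: $a\le b$ iff $a\wedge b=b\wedge a=a$. Green's relation: $a\,\mathcal{D}\,b$ iff $a\wedge b\wedge a=a$ and $b\wedge a\wedge b=b$; it is a congruence, $A/\mathcal{D}$ is a lattice (the commutative shadow of $A$), and $[a]$ denotes the class of $a$. $A$ is left-handed if $x\wedge y\wedge x=x\wedge y$ holds identically; strongly distributive if $(x\vee y)\wedge z=(x\wedge z)\vee(y\wedge z)$ and $x\wedge(y\vee z)=(x\wedge y)\vee(x\wedge z)$ hold identically. A skew lattice with $0$ has a distinguished element $0$ with $x\vee 0=x=0\vee x$ for all $x$. A commuting subset is a nonempty subset $\{x_i\}_{i\in I}$ with $x_i\wedge x_j=x_j\wedge x_i$ and $x_i\vee x_j=x_j\vee x_i$ for all $i,j$. $A$ is join complete if all commuting subsets have suprema for the natural partial order. **Noncommutative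 frames.** A noncommutative frame is a strongly distributive, join complete skew lattice $A$ with $0$ such that $(\bigvee_i x_i)\wedge y=\bigvee_i(x_i\wedge y)$ and $x\wedge(\bigvee_i y_i)=\bigvee_i(x\wedge y_i)$ for all $x,y\in A$ and all commuting subsets $\{x_i\},\{y_i\}$. It has a maximal $\mathcal{D}$-class, and $A/\mathcal{D}$ is a frame. A morphism of noncommutative frames is a map preserving $\wedge$, $\vee$, $0$, and suprema of commuting subsets, and sending elements of the maximal $\mathcal{D}$-class to elements of the maximal $\mathcal{D}$-class. $\mathbf{LNFrm}$ is the category of left-handed noncommutative frames. **The category $\mathbf{Sh}(\mathsf{Sp}_f)$.** For a topological space $Y$, $Y_f$ is the set $Y$ with the front topology, which has as basis the locally closed subsets (intersections of an open and a closed subset) of $Y$. Objects of $\mathbf{Sh}(\mathsf{Sp}_f)$ are pairs $(Y,\mathcal{E})$ with $Y$ a topological space and $\mathcal{E}$ a sheaf of sets on $Y_f$ with $\mathcal{E}(Y_f)\ne\varnothing$. Morphisms $(Y,\mathcal{E})\to(Y',\mathcal{E}')$ are pairs $(f,\lambda)$ with $f:Y\to Y'$ continuous (hence also continuous as a map $Y_f\to Y'_f$) and $\lambda:\mathcal{E}'\to f_*\mathcal{E}$ a morphism of sheaves on $Y'_f$. **The functor $H:\mathbf{Sh}(\mathsf{Sp}_f)^{\mathrm{op}}\to\mathbf{LNFrm}$.** $H(Y,\mathcal{E})$ is the set of pairs $(U,s)$ with $U\subseteq Y$ open in the original topology of $Y$ and $s\in\mathcal{E}(U)$, with $(U,s)\wedge(V,t)=(U\cap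 V,s|_{U\cap V})$ and $(U,s)\vee(V,t)=(U\cup V,\,s|_{U-V}\cup t)$, where $s|_{U-V}\cup t$ is the unique section over $U\cup V$ restricting to $s|_{U-V}$ on $U-V$ and to $t$ on $V$. It is a left-handed noncommutative frame, with $H(Y,\mathcal{E})/\mathcal{D}\cong\mathcal{O}(Y)$ via $(U,s)\mapsto U$. For $(f,\lambda):(Y,\mathcal{E})\to(Y',\mathcal{E}')$, $H(f,\lambda)$ sends $(U,s)$ to $(f^{-1}(U),\lambda(s))$. A left-handed noncommutative frame is spatial if it is isomorphic to $H(Y,\mathcal{E})$ for some $(Y,\mathcal{E})$ in $\mathbf{Sh}(\mathsf{Sp}_f)$. **The functor $G:\mathbf{LNFrm}\to\mathbf{Sh}(\mathsf{Sp}_f)^{\mathrm{op}}$.** For $A$ in $\mathbf{LNFrm}$, $G(A)=(Y_A,\mathcal{E}_A)$. Here $Y_A=\mathrm{pt}(A/\mathcal{D})$ is the set of frame homomorphisms $p:A/\mathcal{D}\to\mathbf{2}=\{0,1\}$, with open sets $U_a=\{p: p(a)=1\}$, $a\in A$ (where $p(a):=p([a])$). For $p\in Y_A$ and $a,b\in A$ with $p(a)=p(b)=1$, put $a\sim_p b$ iff there are $c,d\in A$ with $p(c)=0$, $p(d)=1$ and $(a\wedge d)\vee c=(b\wedge d)\vee c$; this is an equivalence relation. Let $E_A=\{(p,[a]_{\sim_p}): p\in Y_A, a\in A, p(a)=1\}$, $\pi_A(p,[a]_{\sim_p})=p$, and $s_a:U_a\to E_A$, $s_a(p)=(p,[a]_{\sim_p})$.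 Give $E_A$ the topology generated by the sets $s_a(Z)$ with $a\in A$ and $Z\subseteq U_a$ locally closed in $Y_A$. Then $\mathcal{E}_A$ is the sheaf on $(Y_A)_f$ of continuous sections of $\pi_A:E_A\to (Y_A)_f$. For $\varphi:A\to A'$ in $\mathbf{LNFrm}$, $G(\varphi):G(A')\to G(A)$ is $(f,\lambda)$ with $f(p)=p\circ\varphi$ and $\lambda:\mathcal{E}_A\to f_*\mathcal{E}_{A'}$ determined by $\lambda(s_a)=s_{\varphi(a)}$. **Sober sheaves.** An object $(Y,\mathcal{E})$ of $\mathbf{Sh}(\mathsf{Sp}_f)$ is called a sober sheaf for the front topology if the natural morphism $(f,\lambda):(Y,\mathcal{E})\to G(H(Y,\mathcal{E}))$ is an isomorphism, where $f:Y\to\mathrm{pt}(\mathcal{O}(Y))$ sends $p$ to $\hat p$ with $\hat p(U)=1$ iff $p\in U$, and $\lambda:\mathcal{E}_{H(Y,\mathcal{E})}\to f_*\mathcal{E}$ is determined by $s_a\mapsto s$ for $a=(U,s)\in H(Y,\mathcal{E})$. Equivalently, $(Y,\mathcal{E})\cong G(A)$ for some $A$ in $\mathbf{LNFrm}$. *)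

theory Defs
  imports "HOL-Analysis.Abstract_Topology" "HOL-Algebra.Complete_Lattice"
begin

section \<open>Skew lattices and noncommutative frames\<close>

record 'a skew_algebra = "'a partial_object" +
  cmeet :: "['a, 'a] \<Rightarrow> 'a"  (infixl "\<curlywedge>\<index>" 70)
  cjoin :: "['a, 'a] \<Rightarrow> 'a"  (infixl "\<curlyvee>\<index>" 65)
  czero :: "'a"  ("\<zero>\<index>")

definition natural_order :: "'a skew_algebra \<Rightarrow> 'a gorder" where
  "natural_order A =
     \<lparr>carrier = carrier A, eq = (=),
      le = (\<lambda>a b. a \<curlywedge>\<^bsub>A\<^esub> b = a \<and> b \<curlywedge>\<^bsub>A\<^esub> a = a)\<rparr>"

definition green_D :: "'a skew_algebra \<Rightarrow> ('a \<times> 'a) set" where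
  "green_D A = {(a, b) \<in> carrier A \<times> carrier A.
     a \<curlywedge>\<^bsub>A\<^esub> b \<curlywedge>\<^bsub>A\<^esub> a = a \<and> b \<curlywedge>\<^bsub>A\<^esub> a \<curlywedge>\<^bsub>A\<^esub> b = b}"

text \<open>
  The commutative shadow \<open>A/D\<close> is given as an ordered set; its lattice operations are those derived
  from the order in \<^theory>\<open>HOL-Algebra.Lattice\<close>. The order is the one of the quotient lattice:
  \<open>[a] \<le> [b]\<close> iff \<open>[a \<and> b] = [a]\<close>.
\<close>

definition shadow :: "'a skew_algebra \<Rightarrow> 'a set gorder" where
  "shadow A =
     \<lparr>carrier = carrier A // green_D A, eq = (=),
      le = (\<lambda>X Y. \<forall>x\<in>X. \<forall>y\<in>Y. green_D A `` {x \<curlywedge>\<^bsub>A\<^esub> y} = X)\<rparr>"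

abbreviation cls :: "'a skew_algebra \<Rightarrow> 'a \<Rightarrow> 'a set" where
  "cls A a \<equiv> green_D A `` {a}"

definition commuting_subset :: "'a skew_algebra \<Rightarrow> 'a set \<Rightarrow> bool" where
  "commuting_subset A S \<longleftrightarrow> S \<subseteq> carrier A \<and> S \<noteq> {} \<and>
     (\<forall>x\<in>S. \<forall>y\<in>S. x \<curlywedge>\<^bsub>A\<^esub> y = y \<curlywedge>\<^bsub>A\<^esub> x \<and> x \<curlyvee>\<^bsub>A\<^esub> y = y \<curlyvee>\<^bsub>A\<^esub> x)"

locale skew_lattice =
  fixes A :: "'a skew_algebra" (structure)
  assumes meet_closed: "\<lbrakk>x \<in> carrier A; y \<in> carrier A\<rbrakk> \<Longrightarrow> x \<curlywedge> y \<in> carrier A"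
    and join_closed: "\<lbrakk>x \<in> carrier A; y \<in> carrier A\<rbrakk> \<Longrightarrow> x \<curlyvee> y \<in> carrier A"
    and meet_assoc: "\<lbrakk>x \<in> carrier A; y \<in> carrier A; z \<in> carrier A\<rbrakk>
      \<Longrightarrow> (x \<curlywedge> y) \<curlywedge> z = x \<curlywedge> (y \<curlywedge> z)"
    and join_assoc: "\<lbrakk>x \<in> carrier A; y \<in> carrier A; z \<in> carrier A\<rbrakk>
      \<Longrightarrow> (x \<curlyvee> y) \<curlyvee> z = x \<curlyvee> (y \<curlyvee> z)"
    and meet_idem: "x \<in> carrier A \<Longrightarrow> x \<curlywedge> x = x"
    and join_idem: "x \<in> carrier A \<Longrightarrow> x \<curlyvee> x = x"
    and absorb1: "\<lbrakk>x \<in> carrier A; y \<in> carrier A\<rbrakk> \<Longrightarrow> x \<curlywedge> (x \<curlyvee> y) = x"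
    and absorb2: "\<lbrakk>x \<in> carrier A; y \<in> carrier A\<rbrakk> \<Longrightarrow> x \<curlyvee> (x \<curlywedge> y) = x"
    and absorb3: "\<lbrakk>x \<in> carrier A; y \<in> carrier A\<rbrakk> \<Longrightarrow> (x \<curlywedge> y) \<curlyvee> y = y"
    and absorb4: "\<lbrakk>x \<in> carrier A; y \<in> carrier A\<rbrakk> \<Longrightarrow> (x \<curlyvee> y) \<curlywedge> y = y"

locale noncommutative_frame = skew_lattice +
  assumes zero_closed: "\<zero> \<in> carrier A"
    and join_zero: "x \<in> carrier A \<Longrightarrow> x \<curlyvee> \<zero> = x"
    and zero_join: "x \<in> carrier A \<Longrightarrow> \<zero> \<curlyvee> x = x"
    and join_meet_distrib: "\<lbrakk>x \<in> carrier A; y \<in> carrier A; z \<in> carrier A\<rbrakk>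
      \<Longrightarrow> (x \<curlyvee> y) \<curlywedge> z = (x \<curlywedge> z) \<curlyvee> (y \<curlywedge> z)"
    and meet_join_distrib: "\<lbrakk>x \<in> carrier A; y \<in> carrier A; z \<in> carrier A\<rbrakk>
      \<Longrightarrow> x \<curlywedge> (y \<curlyvee> z) = (x \<curlywedge> y) \<curlyvee> (x \<curlywedge> z)"
    and join_complete: "commuting_subset A S \<Longrightarrow> \<exists>u. is_lub (natural_order A) u S"
    and Sup_meet_distrib: "\<lbrakk>commuting_subset A S; y \<in> carrier A\<rbrakk>
      \<Longrightarrow> (\<Squnion>\<^bsub>natural_order A\<^esub> S) \<curlywedge> y = \<Squnion>\<^bsub>natural_order A\<^esub> ((\<lambda>x. x \<curlywedge> y) ` S)"
    and meet_Sup_distrib: "\<lbrakk>x \<in> carrier A; commuting_subset A S\<rbrakk>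
      \<Longrightarrow> x \<curlywedge> (\<Squnion>\<^bsub>natural_order A\<^esub> S) = \<Squnion>\<^bsub>natural_order A\<^esub> ((\<lambda>y. x \<curlywedge> y) ` S)"

locale left_handed_nc_frame = noncommutative_frame +
  assumes left_handed: "\<lbrakk>x \<in> carrier A; y \<in> carrier A\<rbrakk> \<Longrightarrow> x \<curlywedge> y \<curlywedge> x = x \<curlywedge> y"

text \<open>
  Morphisms of both categories are extensional functions, so that equality of morphisms is equality
  in HOL. The maximal \<open>D\<close>-class is the top element of the shadow.
\<close>

definition ncf_hom :: "'a skew_algebra \<Rightarrow> 'b skew_algebra \<Rightarrow> ('a \<Rightarrow> 'b) set" where
  "ncf_hom A B = {\<phi> \<in> carrier A \<rightarrow>\<^sub>E carrier B.
     (\<forall>x\<in>carrier A. \<forall>y\<in>carrier A. \<phi> (x \<curlywedge>\<^bsub>A\<^esub> y) = \<phi> x \<curlywedge>\<^bsub>B\<^esub> \<phi> y) \<and>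
     (\<forall>x\<in>carrier A. \<forall>y\<in>carrier A. \<phi> (x \<curlyvee>\<^bsub>A\<^esub> y) = \<phi> x \<curlyvee>\<^bsub>B\<^esub> \<phi> y) \<and>
     \<phi> \<zero>\<^bsub>A\<^esub> = \<zero>\<^bsub>B\<^esub> \<and>
     (\<forall>S. commuting_subset A S \<longrightarrow>
        \<phi> (\<Squnion>\<^bsub>natural_order A\<^esub> S) = \<Squnion>\<^bsub>natural_order B\<^esub> (\<phi> ` S)) \<and>
     (\<forall>a\<in>\<top>\<^bsub>shadow A\<^esub>. \<phi> a \<in> \<top>\<^bsub>shadow B\<^esub>)}"

definition ncf_id :: "'a skew_algebra \<Rightarrow> 'a \<Rightarrow> 'a" where
  "ncf_id A = (\<lambda>a\<in>carrier A. a)"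

abbreviation ncf_comp :: "'a skew_algebra \<Rightarrow> ('b \<Rightarrow> 'c) \<Rightarrow> ('a \<Rightarrow> 'b) \<Rightarrow> 'a \<Rightarrow> 'c" where
  "ncf_comp A \<psi> \<phi> \<equiv> compose (carrier A) \<psi> \<phi>"

definition ncf_iso :: "'a skew_algebra \<Rightarrow> 'b skew_algebra \<Rightarrow> ('a \<Rightarrow> 'b) \<Rightarrow> bool" where
  "ncf_iso A B \<phi> \<longleftrightarrow> \<phi> \<in> ncf_hom A B \<and>
     (\<exists>\<psi>\<in>ncf_hom B A. ncf_comp A \<psi> \<phi> = ncf_id A \<and> ncf_comp B \<phi> \<psi> = ncf_id B)"


section \<open>Sheaves for the front topology\<close>

record ('y, 's) presheaf =
  sections :: "'y set \<Rightarrow> 's set"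
  restr :: "'y set \<Rightarrow> 'y set \<Rightarrow> 's \<Rightarrow> 's"

text \<open>\<open>restr F U V\<close> is the restriction map from \<open>F(U)\<close> to \<open>F(V)\<close>, for \<open>V \<subseteq> U\<close> open.\<close>

definition is_presheaf :: "'y topology \<Rightarrow> ('y, 's) presheaf \<Rightarrow> bool" where
  "is_presheaf T F \<longleftrightarrow>
     (\<forall>U V. openin T U \<and> openin T V \<and> V \<subseteq> U \<longrightarrow>
        restr F U V \<in> sections F U \<rightarrow> sections F V) \<and>
     (\<forall>U. openin T U \<longrightarrow> (\<forall>s\<in>sections F U. restr F U U s = s)) \<and>
     (\<forall>U V W. openin T U \<and> openin T V \<and> openin T W \<and> W \<subseteq> V \<and> V \<subseteq> U \<longrightarrow>
        (\<forall>s\<in>sections F U. restr F V W (restr F U V s) = restr F U W s))"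

definition is_sheaf :: "'y topology \<Rightarrow> ('y, 's) presheaf \<Rightarrow> bool" where
  "is_sheaf T F \<longleftrightarrow> is_presheaf T F \<and>
     (\<forall>\<U> s. (\<forall>U\<in>\<U>. openin T U \<and> s U \<in> sections F U) \<and>
        (\<forall>U\<in>\<U>. \<forall>V\<in>\<U>. restr F U (U \<inter> V) (s U) = restr F V (U \<inter> V) (s V)) \<longrightarrow>
        (\<exists>!t. t \<in> sections F (\<Union>\<U>) \<and> (\<forall>U\<in>\<U>. restr F (\<Union>\<U>) U t = s U)))"

definition sheaf_hom ::
  "'y topology \<Rightarrow> ('y, 's) presheaf \<Rightarrow> ('y, 't) presheaf \<Rightarrow> ('y set \<Rightarrow> 's \<Rightarrow> 't) set" where
  "sheaf_hom T F G = {l \<in> (\<Pi>\<^sub>E V\<in>{V. openin T V}. sections F V \<rightarrow>\<^sub>E sections G V).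
     \<forall>U V. openin T U \<and> openin T V \<and> V \<subseteq> U \<longrightarrow>
       (\<forall>s\<in>sections F U. restr G U V (l U s) = l V (restr F U V s))}"

abbreviation preimage :: "'y topology \<Rightarrow> ('y \<Rightarrow> 'z) \<Rightarrow> 'z set \<Rightarrow> 'y set" where
  "preimage Y f V \<equiv> {y \<in> topspace Y. f y \<in> V}"

definition direct_image ::
  "'y topology \<Rightarrow> ('y \<Rightarrow> 'z) \<Rightarrow> ('y, 's) presheaf \<Rightarrow> ('z, 's) presheaf" where
  "direct_image Y f F =
     \<lparr>sections = (\<lambda>V. sections F (preimage Y f V)),
      restr = (\<lambda>U V. restr F (preimage Y f U) (preimage Y f V))\<rparr>"

definition locally_closed :: "'y topology \<Rightarrow> 'y set \<Rightarrow> bool" where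
  "locally_closed Y Z \<longleftrightarrow> (\<exists>U C. openin Y U \<and> closedin Y C \<and> Z = U \<inter> C)"

definition front :: "'y topology \<Rightarrow> 'y topology" where
  "front Y = topology (arbitrary union_of (locally_closed Y))"

lemma openin_front: "openin (front Y) = arbitrary union_of (locally_closed Y)"
proof -
  have "locally_closed Y (S \<inter> T)" if S: "locally_closed Y S" and T: "locally_closed Y T" for S T
  proof -
    obtain U C where UC: "openin Y U" "closedin Y C" "S = U \<inter> C"
      using S unfolding locally_closed_def by (elim exE conjE)
    obtain U' C' where UC': "openin Y U'" "closedin Y C'" "T = U' \<inter> C'"
      using T unfolding locally_closed_def by (elim exE conjE)
    have "S \<inter> T = (U \<inter> U') \<inter> (C \<inter> C')"
      by (simp only: UC(3) UC'(3) Int_ac)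
    with openin_Int[OF UC(1) UC'(1)] closedin_Int[OF UC(2) UC'(2)] show ?thesis
      unfolding locally_closed_def by (intro exI conjI)
  qed
  then have "istopology (arbitrary union_of (locally_closed Y))"
    by (intro istopology_base)
  then show ?thesis
    unfolding front_def by (rule topology_inverse')
qed

type_synonym ('y, 's) sheaf_space = "'y topology \<times> ('y, 's) presheaf"

definition Sh_obj :: "('y, 's) sheaf_space \<Rightarrow> bool" where
  "Sh_obj X \<longleftrightarrow> is_sheaf (front (fst X)) (snd X) \<and> sections (snd X) (topspace (fst X)) \<noteq> {}"

text \<open>A morphism \<open>(f, l)\<close> from \<open>(Y, E)\<close> to \<open>(Y', E')\<close> has \<open>l : E' \<rightarrow> f\<^sub>* E\<close>.\<close>

type_synonym ('y, 's, 'z, 't) sheaf_space_map = "('y \<Rightarrow> 'z) \<times> ('z set \<Rightarrow> 't \<Rightarrow> 's)"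

definition Sh_hom ::
  "('y, 's) sheaf_space \<Rightarrow> ('z, 't) sheaf_space \<Rightarrow> ('y, 's, 'z, 't) sheaf_space_map set" where
  "Sh_hom X X' = {(f, l). f \<in> extensional (topspace (fst X)) \<and>
     continuous_map (fst X) (fst X') f \<and>
     l \<in> sheaf_hom (front (fst X')) (snd X') (direct_image (fst X) f (snd X))}"

definition Sh_id :: "('y, 's) sheaf_space \<Rightarrow> ('y, 's, 'y, 's) sheaf_space_map" where
  "Sh_id X = ((\<lambda>y\<in>topspace (fst X). y),
     (\<lambda>V\<in>{V. openin (front (fst X)) V}. \<lambda>s\<in>sections (snd X) V. s))"

text \<open>\<open>Sh_comp X X' X'' n m\<close> is \<open>n \<circ> m\<close> for \<open>m : X \<rightarrow> X'\<close> and \<open>n : X' \<rightarrow> X''\<close>.\<close>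

definition Sh_comp ::
  "('y, 's) sheaf_space \<Rightarrow> ('z, 't) sheaf_space \<Rightarrow> ('w, 'u) sheaf_space \<Rightarrow>
   ('z, 't, 'w, 'u) sheaf_space_map \<Rightarrow> ('y, 's, 'z, 't) sheaf_space_map \<Rightarrow>
   ('y, 's, 'w, 'u) sheaf_space_map" where
  "Sh_comp X X' X'' n m =
     (compose (topspace (fst X)) (fst n) (fst m),
      (\<lambda>V\<in>{V. openin (front (fst X'')) V}.
         compose (sections (snd X'') V) (snd m (preimage (fst X') (fst n) V)) (snd n V)))"

definition Sh_iso ::
  "('y, 's) sheaf_space \<Rightarrow> ('z, 't) sheaf_space \<Rightarrow> ('y, 's, 'z, 't) sheaf_space_map \<Rightarrow> bool" where
  "Sh_iso X X' m \<longleftrightarrow> m \<in> Sh_hom X X' \<and>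
     (\<exists>n\<in>Sh_hom X' X. Sh_comp X X' X n m = Sh_id X \<and> Sh_comp X' X X' m n = Sh_id X')"


section \<open>The functor \<open>H\<close>\<close>

definition H_obj :: "('y, 's) sheaf_space \<Rightarrow> ('y set \<times> 's) skew_algebra" where
  "H_obj X = (let Y = fst X; E = snd X in
     \<lparr>carrier = {(U, s). openin Y U \<and> s \<in> sections E U},
      cmeet = (\<lambda>(U, s) (V, t). (U \<inter> V, restr E U (U \<inter> V) s)),
      cjoin = (\<lambda>(U, s) (V, t). (U \<union> V,
        THE r. r \<in> sections E (U \<union> V) \<and>
          restr E (U \<union> V) (U - V) r = restr E U (U - V) s \<and> restr E (U \<union> V) V r = t)),
      czero = ({}, THE s. s \<in> sections E {})\<rparr>)"

text \<open>For \<open>m : X \<rightarrow> X'\<close>, \<open>H_mor X X' m\<close> goes from \<open>H_obj X'\<close> to \<open>H_obj X\<close>.\<close>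

definition H_mor ::
  "('y, 's) sheaf_space \<Rightarrow> ('z, 't) sheaf_space \<Rightarrow> ('y, 's, 'z, 't) sheaf_space_map \<Rightarrow>
   'z set \<times> 't \<Rightarrow> 'y set \<times> 's" where
  "H_mor X X' m =
     (\<lambda>(U, s)\<in>carrier (H_obj X'). (preimage (fst X) (fst m) U, snd m U s))"


section \<open>The functor \<open>G\<close>\<close>

text \<open>Frame homomorphisms from \<open>A/D\<close> to \<open>bool\<close>, seen as the two-element frame.\<close>

type_synonym 'a point = "'a set \<Rightarrow> bool"

definition points :: "'a skew_algebra \<Rightarrow> 'a point set" where
  "points A = (let L = shadow A in {p \<in> carrier L \<rightarrow>\<^sub>E UNIV.
     p \<top>\<^bsub>L\<^esub> \<and>
     (\<forall>X\<in>carrier L. \<forall>Y\<in>carrier L. p (X \<sqinter>\<^bsub>L\<^esub> Y) \<longleftrightarrow> p X \<and> p Y) \<and>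
     (\<forall>\<S>. \<S> \<subseteq> carrier L \<longrightarrow> (p (\<Squnion>\<^bsub>L\<^esub> \<S>) \<longleftrightarrow> (\<exists>X\<in>\<S>. p X)))})"

definition basic_open :: "'a skew_algebra \<Rightarrow> 'a \<Rightarrow> 'a point set" where
  "basic_open A a = {p \<in> points A. p (cls A a)}"

definition point_space :: "'a skew_algebra \<Rightarrow> 'a point topology" where
  "point_space A = topology (\<lambda>U. \<exists>a\<in>carrier A. U = basic_open A a)"

definition germ_rel :: "'a skew_algebra \<Rightarrow> 'a point \<Rightarrow> ('a \<times> 'a) set" where
  "germ_rel A p = {(a, b) \<in> carrier A \<times> carrier A. p (cls A a) \<and> p (cls A b) \<and>
     (\<exists>c\<in>carrier A. \<exists>d\<in>carrier A. \<not> p (cls A c) \<and> p (cls A d) \<and>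
        (a \<curlywedge>\<^bsub>A\<^esub> d) \<curlyvee>\<^bsub>A\<^esub> c = (b \<curlywedge>\<^bsub>A\<^esub> d) \<curlyvee>\<^bsub>A\<^esub> c)}"

definition basic_section :: "'a skew_algebra \<Rightarrow> 'a \<Rightarrow> 'a point \<Rightarrow> 'a point \<times> 'a set" where
  "basic_section A a = (\<lambda>p\<in>basic_open A a. (p, germ_rel A p `` {a}))"

text \<open>
  The underlying set of this space is \<open>E\<^sub>A\<close>, the union of the images of the maps \<open>basic_section A a\<close>;
  the projection \<open>\<pi>\<^sub>A\<close> is the restriction of \<^const>\<open>fst\<close>.
\<close>

definition germ_space :: "'a skew_algebra \<Rightarrow> ('a point \<times> 'a set) topology" where
  "germ_space A = topology_generated_by
     {basic_section A a ` Z | a Z. a \<in> carrier A \<and> Z \<subseteq> basic_open A a \<and>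
        locally_closed (point_space A) Z}"

definition sheaf_of_sections ::
  "'y topology \<Rightarrow> 'e topology \<Rightarrow> ('e \<Rightarrow> 'y) \<Rightarrow> ('y, 'y \<Rightarrow> 'e) presheaf" where
  "sheaf_of_sections T E \<pi> =
     \<lparr>sections = (\<lambda>U. {\<sigma> \<in> extensional U.
        continuous_map (subtopology T U) E \<sigma> \<and> (\<forall>y\<in>U. \<pi> (\<sigma> y) = y)}),
      restr = (\<lambda>U V \<sigma>. restrict \<sigma> V)\<rparr>"

definition G_obj :: "'a skew_algebra \<Rightarrow> ('a point, 'a point \<Rightarrow> 'a point \<times> 'a set) sheaf_space" where
  "G_obj A = (point_space A, sheaf_of_sections (front (point_space A)) (germ_space A) fst)"

text \<open>The map \<open>p \<mapsto> p \<circ> \<phi>\<close>; the class \<open>X = [a]\<close> is sent by \<open>\<phi>\<close> to \<open>[\<phi> a] = green_D A' `` (\<phi> ` X)\<close>.\<close>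

definition G_map :: "'a skew_algebra \<Rightarrow> 'b skew_algebra \<Rightarrow> ('a \<Rightarrow> 'b) \<Rightarrow> 'b point \<Rightarrow> 'a point" where
  "G_map A A' \<phi> =
     (\<lambda>p\<in>points A'. \<lambda>X\<in>carrier (shadow A). p (green_D A' `` (\<phi> ` X)))"

text \<open>For \<open>\<phi> : A \<rightarrow> A'\<close>, \<open>G_mor A A' \<phi>\<close> goes from \<open>G_obj A'\<close> to \<open>G_obj A\<close>.\<close>

definition G_mor ::
  "'a skew_algebra \<Rightarrow> 'b skew_algebra \<Rightarrow> ('a \<Rightarrow> 'b) \<Rightarrow>
   ('b point, 'b point \<Rightarrow> 'b point \<times> 'b set, 'a point, 'a point \<Rightarrow> 'a point \<times> 'a set)
     sheaf_space_map" where
  "G_mor A A' \<phi> = (G_map A A' \<phi>,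
     THE l. l \<in> sheaf_hom (front (fst (G_obj A))) (snd (G_obj A))
                 (direct_image (fst (G_obj A')) (G_map A A' \<phi>) (snd (G_obj A'))) \<and>
       (\<forall>a\<in>carrier A. l (basic_open A a) (basic_section A a) = basic_section A' (\<phi> a)))"


section \<open>Sober sheaves and spatial frames\<close>

text \<open>
  The point map of the natural morphism from \<open>X = (Y, E)\<close> to \<open>G(H(X))\<close>. All members of a class
  \<open>c\<close> of \<open>H(X)/D\<close> have the same first component \<open>U\<close>, and \<open>c \<mapsto> U\<close> identifies \<open>H(X)/D\<close> with \<open>O(Y)\<close>.
\<close>

definition hat :: "('y, 's) sheaf_space \<Rightarrow> 'y \<Rightarrow> ('y set \<times> 's) point" where
  "hat X = (\<lambda>y\<in>topspace (fst X). \<lambda>c\<in>carrier (shadow (H_obj X)). \<exists>(U, s)\<in>c. y \<in> U)"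

definition to_GH ::
  "('y, 's) sheaf_space \<Rightarrow>
   ('y, 's, ('y set \<times> 's) point,
    ('y set \<times> 's) point \<Rightarrow> ('y set \<times> 's) point \<times> ('y set \<times> 's) set) sheaf_space_map" where
  "to_GH X = (hat X,
     THE l. l \<in> sheaf_hom (front (fst (G_obj (H_obj X)))) (snd (G_obj (H_obj X)))
                 (direct_image (fst X) (hat X) (snd X)) \<and>
       (\<forall>(U, s)\<in>carrier (H_obj X).
          l (basic_open (H_obj X) (U, s)) (basic_section (H_obj X) (U, s)) = s))"

text \<open>The natural morphism from \<open>A\<close> to \<open>H(G(A))\<close>.\<close>

definition to_HG ::
  "'a skew_algebra \<Rightarrow> 'a \<Rightarrow> 'a point set \<times> ('a point \<Rightarrow> 'a point \<times> 'a set)" where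
  "to_HG A = (\<lambda>a\<in>carrier A. (basic_open A a, basic_section A a))"

definition sober_sheaf :: "('y, 's) sheaf_space \<Rightarrow> bool" where
  "sober_sheaf X \<longleftrightarrow> Sh_obj X \<and> Sh_iso X (G_obj (H_obj X)) (to_GH X)"

text \<open>
  The sheaf witnessing spatiality may live on any types; as HOL has no quantification over types,
  these are parameters. Statements that assume \<open>spatial_frame TYPE('y) TYPE('s) A\<close> with
  \<open>'y\<close> and \<open>'s\<close> free cover all witnesses.
\<close>

definition spatial_frame :: "'y itself \<Rightarrow> 's itself \<Rightarrow> 'a skew_algebra \<Rightarrow> bool" where
  "spatial_frame _ _ A \<longleftrightarrow> left_handed_nc_frame A \<and>
     (\<exists>(X :: ('y, 's) sheaf_space) \<phi>. Sh_obj X \<and> ncf_iso A (H_obj X) \<phi>)"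

end

theory Submission
  imports Defs
begin

text \<open>
  A section of a sheaf \<open>E\<close> on \<open>Y\<^sub>f\<close> over a \<open>Y\<close>-open set is determined by its germs, so \<open>H(Y, E)\<close> is an algebra
  of partial functions on \<open>Y\<close> (point \<open>\<mapsto>\<close> germ) with open domains. Its meet restricts the first function to
  the domain of the second, its join overrides the first function by the second. Overriding cuts \<open>U\<close> down
  to \<open>U - V\<close>, and the front topology is what makes this set open. The locale \<open>section_algebra\<close> records
  this picture: an injective map \<open>v\<close> from \<open>A\<close> to partial functions on \<open>Y\<close> with open domain, whose image
  contains a total function and every partial function with open domain that, locally for the front
  topology, agrees with members of the image. All \<open>H(Y, E)\<close> have it, and so have all
  spatial frames (\<open>spatial_section_algebra\<close>). It makes the structure of \<open>A\<close> visible pointwise: the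
  identities of a left-handed noncommutative frame hold pointwise, \<open>D\<close> is equality of domains, \<open>A/D\<close>
  is the frame of opens of \<open>Y\<close>, and \<open>a \<sim>\<^sub>p b\<close> says that the functions \<open>a\<close> and \<open>b\<close> agree on a difference
  \<open>D - C\<close> of opens with \<open>p(D) = 1\<close> and \<open>p(C) = 0\<close>.

  Sheaf morphisms out of \<open>E\<^sub>A\<close> are free on the sections \<open>s\<^sub>a\<close>, because every section is front-locally some
  \<open>s\<^sub>a\<close>: a morphism to \<open>f\<^sub>* F\<close> is determined by the images \<open>\<mu> a\<close> of the \<open>s\<^sub>a\<close>, and a family \<open>\<mu>\<close> is realised as
  soon as \<open>a \<sim> b\<close> at \<open>f y\<close> makes the germs of \<open>\<mu> a\<close> and \<open>\<mu> b\<close> at \<open>y\<close> equal (\<open>sheaf_hom_from_G_eqI\<close>,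
  \<open>sheaf_hom_from_G_exists\<close>). This gives both \<open>G(\<phi>)\<close> and the natural morphism \<open>X \<rightarrow> G(H(X))\<close>, and it
  reduces functoriality and naturality to a computation on the \<open>s\<^sub>a\<close> (\<open>Sh_hom_into_G_eqI\<close>).

  The map \<open>a \<mapsto> (U\<^sub>a, s\<^sub>a)\<close> from \<open>A\<close> to \<open>H(G(A))\<close> is injective because each \<open>y\<close> in \<open>Y\<close> is a point of \<open>A/D\<close> at
  which equal germs mean equal values. It is surjective (\<open>surj_to_HG\<close>): the values of a section \<open>\<sigma>\<close> over \<open>U\<^sub>b\<close> at the points
  coming from \<open>Y\<close> glue to some \<open>a\<close> in \<open>A\<close>. At any other point \<open>p\<close>, the section \<open>\<sigma>\<close> is some \<open>s\<^bsub>a'\<^esub>\<close> on a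
  neighbourhood \<open>U\<^sub>d - U\<^sub>c\<close> of \<open>p\<close>. Hence \<open>a\<close> and \<open>a'\<close> agree on the part of \<open>Y\<close> lying there, which is precisely
  \<open>a \<sim>\<^sub>p a'\<close>. So \<open>\<sigma> = s\<^sub>a\<close> also at the new points, although \<open>E\<^sub>A\<close> need not be Hausdorff. Finally, \<open>G(A)\<close> is
  sober because its natural morphism to \<open>G(H(G(A)))\<close> is inverse to \<open>G\<close> of this isomorphism (\<open>G_obj_sober\<close>).
\<close>

section \<open>The front topology\<close>

lemma openin_front_iff:
  "openin (front Y) Z \<longleftrightarrow> (\<forall>y\<in>Z. \<exists>W. locally_closed Y W \<and> y \<in> W \<and> W \<subseteq> Z)"
  by (simp add: openin_front arbitrary_union_of_alt)

lemma locally_closed_imp_openin_front: "locally_closed Y Z \<Longrightarrow> openin (front Y) Z"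
  by (auto simp: openin_front_iff)

lemma locally_closed_diff: "openin Y U \<Longrightarrow> openin Y V \<Longrightarrow> locally_closed Y (U - V)"
  unfolding locally_closed_def
  by (intro exI[of _ U] exI[of _ "topspace Y - V"]) (auto dest: openin_subset)

lemma locally_closed_iff_diff:
  "locally_closed Y Z \<longleftrightarrow> (\<exists>U V. openin Y U \<and> openin Y V \<and> Z = U - V)"
proof
  assume "locally_closed Y Z"
  then obtain U C where UC: "openin Y U" "closedin Y C" "Z = U \<inter> C"
    by (auto simp: locally_closed_def)
  then have "Z = U - (topspace Y - C)"
    using openin_subset by fastforce
  with UC show "\<exists>U V. openin Y U \<and> openin Y V \<and> Z = U - V"
    by blast
qed (auto intro: locally_closed_diff)

lemma openin_imp_openin_front: "openin Y U \<Longrightarrow> openin (front Y) U"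
  using locally_closed_diff[of Y U "{}"] by (auto intro: locally_closed_imp_openin_front)

lemma openin_front_diff: "openin Y U \<Longrightarrow> openin Y V \<Longrightarrow> openin (front Y) (U - V)"
  by (simp add: locally_closed_diff locally_closed_imp_openin_front)

lemma topspace_front [simp]: "topspace (front Y) = topspace Y"
proof
  show "topspace (front Y) \<subseteq> topspace Y"
  proof
    fix y assume "y \<in> topspace (front Y)"
    then obtain W where "locally_closed Y W" "y \<in> W"
      using openin_front_iff[of Y "topspace (front Y)"] openin_topspace by blast
    then show "y \<in> topspace Y"
      using openin_subset unfolding locally_closed_def by blast
  qed
  show "topspace Y \<subseteq> topspace (front Y)"
    by (simp add: openin_imp_openin_front openin_subset)
qed

lemma continuous_map_front:
  assumes "continuous_map Y Y' f"
  shows "continuous_map (front Y) (front Y') f"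
  unfolding continuous_map_def
proof (intro conjI allI impI)
  show "f \<in> topspace (front Y) \<rightarrow> topspace (front Y')"
    using assms by (auto simp: continuous_map_def)
  fix Z assume Z: "openin (front Y') Z"
  show "openin (front Y) {x \<in> topspace (front Y). f x \<in> Z}"
    unfolding openin_front_iff
  proof
    fix y assume "y \<in> {x \<in> topspace (front Y). f x \<in> Z}"
    then obtain U V where UV: "openin Y' U" "openin Y' V" "f y \<in> U - V" "U - V \<subseteq> Z"
      using Z unfolding openin_front_iff locally_closed_iff_diff by blast
    let ?p = "\<lambda>U. {x \<in> topspace Y. f x \<in> U}"
    have "openin Y (?p U)" "openin Y (?p V)"
      using assms UV by (auto simp: continuous_map_def)
    then have "locally_closed Y (?p U - ?p V)"
      by (rule locally_closed_diff)
    with UV \<open>y \<in> _\<close> show "\<exists>W. locally_closed Y W \<and> y \<in> W \<and> W \<subseteq> {x \<in> topspace (front Y). f x \<in> Z}"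
      by (intro exI[of _ "?p U - ?p V"]) auto
  qed
qed

lemma openin_front_preimage:
  "continuous_map Y Y' f \<Longrightarrow> openin (front Y') Z \<Longrightarrow> openin (front Y) (preimage Y f Z)"
  using continuous_map_front[of Y Y' f] by (force simp: continuous_map_def)

section \<open>Sheaves and their germs\<close>

text \<open>
  The set of all sections that agree with \<open>s\<close> near \<open>y\<close>, including sections over sets other than \<open>U\<close>. It
  is an equivalence class, so two sections have the same germ iff these sets are equal.
\<close>

definition germ :: "'y topology \<Rightarrow> ('y, 's) presheaf \<Rightarrow> 'y set \<Rightarrow> 's \<Rightarrow> 'y \<Rightarrow> ('y set \<times> 's) set" where
  "germ T F U s y = {(W, t). openin T W \<and> t \<in> sections F W \<and> y \<in> W \<and>
     (\<exists>Z. openin T Z \<and> y \<in> Z \<and> Z \<subseteq> U \<inter> W \<and> restr F U Z s = restr F W Z t)}"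

locale sheaf_on =
  fixes T :: "'y topology" and F :: "('y, 's) presheaf"
  assumes sheaf: "is_sheaf T F"
begin

lemma restr_closed:
  "openin T U \<Longrightarrow> openin T V \<Longrightarrow> V \<subseteq> U \<Longrightarrow> s \<in> sections F U \<Longrightarrow> restr F U V s \<in> sections F V"
  using sheaf by (simp add: is_sheaf_def is_presheaf_def Pi_iff)

lemma restr_self: "openin T U \<Longrightarrow> s \<in> sections F U \<Longrightarrow> restr F U U s = s"
  using sheaf by (simp add: is_sheaf_def is_presheaf_def)

lemma restr_restr:
  "openin T U \<Longrightarrow> openin T V \<Longrightarrow> openin T W \<Longrightarrow> W \<subseteq> V \<Longrightarrow> V \<subseteq> U \<Longrightarrow> s \<in> sections F U \<Longrightarrow>
   restr F V W (restr F U V s) = restr F U W s"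
  using sheaf by (simp add: is_sheaf_def is_presheaf_def)

lemma unique_gluing:
  assumes "\<And>i. i \<in> I \<Longrightarrow> openin T (U i)" "\<And>i. i \<in> I \<Longrightarrow> s i \<in> sections F (U i)"
    and compat: "\<And>i j. i \<in> I \<Longrightarrow> j \<in> I \<Longrightarrow>
      restr F (U i) (U i \<inter> U j) (s i) = restr F (U j) (U i \<inter> U j) (s j)"
  shows "\<exists>!t. t \<in> sections F (\<Union>i\<in>I. U i) \<and> (\<forall>i\<in>I. restr F (\<Union>i\<in>I. U i) (U i) t = s i)"
proof -
  \<comment> \<open>The sheaf axiom indexes the sections by the open sets themselves.\<close>
  define \<sigma> where "\<sigma> W = s (SOME i. i \<in> I \<and> U i = W)" for W
  have \<sigma>: "\<sigma> (U i) = s i" if "i \<in> I" for i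
  proof -
    define j where "j = (SOME j. j \<in> I \<and> U j = U i)"
    have "j \<in> I \<and> U j = U i"
      unfolding j_def by (rule someI[of _ i]) (simp add: that)
    then have "s j = s i"
      using compat[of j i] assms(1,2) that restr_self by (metis Int_absorb)
    then show ?thesis
      by (simp add: \<sigma>_def j_def)
  qed
  have "\<exists>!t. t \<in> sections F (\<Union>(U ` I)) \<and> (\<forall>W\<in>U ` I. restr F (\<Union>(U ` I)) W t = \<sigma> W)"
  proof -
    have "(\<forall>W\<in>U ` I. openin T W \<and> \<sigma> W \<in> sections F W) \<and>
        (\<forall>W\<in>U ` I. \<forall>V\<in>U ` I. restr F W (W \<inter> V) (\<sigma> W) = restr F V (W \<inter> V) (\<sigma> V))"
      using assms by (auto simp: \<sigma>)
    then show ?thesis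
      by (rule sheaf[unfolded is_sheaf_def, THEN conjunct2, rule_format])
  qed
  then show ?thesis
    by (simp add: \<sigma> cong: conj_cong ball_cong)
qed

text \<open>
  Separatedness, with the cover given by neighbourhoods of the points. The set \<open>U\<close> is open because these cover it.
\<close>

lemma section_eqI:
  assumes s: "s \<in> sections F U" "s' \<in> sections F U"
    and cover: "\<And>y. y \<in> U \<Longrightarrow> \<exists>Z. openin T Z \<and> y \<in> Z \<and> Z \<subseteq> U \<and> restr F U Z s = restr F U Z s'"
  shows "s = s'"
proof -
  define I where "I = {Z. openin T Z \<and> Z \<subseteq> U \<and> restr F U Z s = restr F U Z s'}"
  have U: "(\<Union>Z\<in>I. Z) = U"
    using cover unfolding I_def by blast
  have opn: "openin T U"
    unfolding U[symmetric] by (rule openin_Union) (auto simp: I_def)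
  have "\<exists>!t. t \<in> sections F (\<Union>Z\<in>I. Z) \<and> (\<forall>Z\<in>I. restr F (\<Union>Z\<in>I. Z) Z t = restr F U Z s)"
    by (rule unique_gluing) (use opn s in \<open>auto simp: I_def restr_closed restr_restr openin_Int\<close>)
  then show ?thesis
    unfolding U using s by (auto simp: I_def)
qed

lemma sections_empty: "\<exists>!s. s \<in> sections F {}"
  using unique_gluing[of "{}" "\<lambda>_. {}" "\<lambda>_. undefined"] by simp

lemma germ_eq_iff:
  assumes "openin T U" "openin T V" "s \<in> sections F U" "t \<in> sections F V" "y \<in> U" "y \<in> V"
  shows "germ T F U s y = germ T F V t y \<longleftrightarrow>
    (\<exists>Z. openin T Z \<and> y \<in> Z \<and> Z \<subseteq> U \<inter> V \<and> restr F U Z s = restr F V Z t)" (is "_ \<longleftrightarrow> ?R")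
proof
  assume eq: "germ T F U s y = germ T F V t y"
  have "(V, t) \<in> germ T F V t y"
    using assms unfolding germ_def by blast
  then have "(V, t) \<in> germ T F U s y"
    by (simp add: eq)
  then show ?R
    by (auto simp: germ_def)
next
  assume ?R
  then obtain Z where Z: "openin T Z" "y \<in> Z" "Z \<subseteq> U \<inter> V" "restr F U Z s = restr F V Z t"
    by blast
  \<comment> \<open>Agreement with a third section near \<open>y\<close> passes from one representative to the other on a
      smaller neighbourhood.\<close>
  have sub: "germ T F U1 s1 y \<subseteq> germ T F U2 s2 y"
    if U12: "openin T U1" "openin T U2" "s1 \<in> sections F U1" "s2 \<in> sections F U2"
      "Z \<subseteq> U1 \<inter> U2" and eq: "restr F U1 Z s1 = restr F U2 Z s2" for U1 U2 s1 s2
  proof (rule subrelI)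
    fix W r assume "(W, r) \<in> germ T F U1 s1 y"
    then obtain Z' where W: "openin T W" "r \<in> sections F W" "y \<in> W"
      and Z': "openin T Z'" "y \<in> Z'" "Z' \<subseteq> U1 \<inter> W" "restr F U1 Z' s1 = restr F W Z' r"
      by (auto simp: germ_def)
    have op: "openin T (Z \<inter> Z')"
      using Z Z' by blast
    have "restr F U2 (Z \<inter> Z') s2 = restr F Z (Z \<inter> Z') (restr F U2 Z s2)"
      using U12 Z(1) op by (intro restr_restr[symmetric]) auto
    also have "\<dots> = restr F U1 (Z \<inter> Z') s1"
      unfolding eq[symmetric] using U12 Z(1) op by (intro restr_restr) auto
    also have "\<dots> = restr F Z' (Z \<inter> Z') (restr F U1 Z' s1)"
      using U12 Z' op by (intro restr_restr[symmetric]) auto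
    also have "\<dots> = restr F W (Z \<inter> Z') r"
      unfolding Z'(4) using W Z' op by (intro restr_restr) auto
    finally show "(W, r) \<in> germ T F U2 s2 y"
      unfolding germ_def using W op Z Z' U12(5) by blast
  qed
  show "germ T F U s y = germ T F V t y"
    using sub[of U V s t] sub[of V U t s] assms Z by auto
qed

lemma germ_restr:
  assumes "openin T U" "openin T V" "V \<subseteq> U" "s \<in> sections F U" "y \<in> V"
  shows "germ T F V (restr F U V s) y = germ T F U s y"
proof -
  have "restr F V V (restr F U V s) = restr F U V s"
    using assms by (simp add: restr_closed restr_self)
  then show ?thesis
    using assms by (subst germ_eq_iff) (auto simp: restr_closed)
qed

lemma germ_ext:
  assumes "openin T U" "s \<in> sections F U" "s' \<in> sections F U"
    and "\<And>y. y \<in> U \<Longrightarrow> germ T F U s y = germ T F U s' y"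
  shows "s = s'"
proof (rule section_eqI)
  show "\<exists>Z. openin T Z \<and> y \<in> Z \<and> Z \<subseteq> U \<and> restr F U Z s = restr F U Z s'" if "y \<in> U" for y
    using assms(4)[OF that] germ_eq_iff[of U U s s' y] assms(1-3) that by auto
qed (use assms in auto)

lemma restr_eq_iff_germ:
  assumes "openin T U" "openin T V" "s \<in> sections F U" "t \<in> sections F V"
    "openin T Z" "Z \<subseteq> U" "Z \<subseteq> V"
  shows "restr F U Z s = restr F V Z t \<longleftrightarrow> (\<forall>y\<in>Z. germ T F U s y = germ T F V t y)"
proof
  assume eq: "restr F U Z s = restr F V Z t"
  show "\<forall>y\<in>Z. germ T F U s y = germ T F V t y"
    using germ_restr[of U Z s] germ_restr[of V Z t] assms eq by auto
next
  assume "\<forall>y\<in>Z. germ T F U s y = germ T F V t y"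
  then show "restr F U Z s = restr F V Z t"
    using assms by (intro germ_ext[of Z]) (auto simp: germ_restr restr_closed)
qed

text \<open>
  Germs reduce gluing to a pointwise statement: the compatibility of local sections that realise one
  and the same family \<open>g\<close> of germs is automatic.
\<close>

lemma glue_germs:
  assumes local: "\<And>y. y \<in> W \<Longrightarrow> \<exists>Z s. openin T Z \<and> y \<in> Z \<and> Z \<subseteq> W \<and> s \<in> sections F Z \<and>
      (\<forall>z\<in>Z. germ T F Z s z = g z)"
  shows "\<exists>t\<in>sections F W. \<forall>y\<in>W. germ T F W t y = g y"
proof -
  obtain Z s where Zs: "\<And>y. y \<in> W \<Longrightarrow> openin T (Z y) \<and> y \<in> Z y \<and> Z y \<subseteq> W \<and>
      s y \<in> sections F (Z y) \<and> (\<forall>z\<in>Z y. germ T F (Z y) (s y) z = g z)"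
    using local by metis
  have W: "(\<Union>y\<in>W. Z y) = W"
    using Zs by fast
  have opW: "openin T W"
    using openin_Union[of "Z ` W" T] Zs W by auto
  have "\<exists>!t. t \<in> sections F (\<Union>y\<in>W. Z y) \<and> (\<forall>y\<in>W. restr F (\<Union>y\<in>W. Z y) (Z y) t = s y)"
  proof (rule unique_gluing)
    show "restr F (Z x) (Z x \<inter> Z y) (s x) = restr F (Z y) (Z x \<inter> Z y) (s y)"
      if "x \<in> W" "y \<in> W" for x y
      using Zs[OF that(1)] Zs[OF that(2)] by (subst restr_eq_iff_germ) auto
  qed (use Zs in auto)
  then obtain t where t: "t \<in> sections F W" "\<And>y. y \<in> W \<Longrightarrow> restr F W (Z y) t = s y"
    unfolding W by blast
  have "germ T F W t y = g y" if "y \<in> W" for y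
    using germ_restr[of W "Z y" t y] t Zs[OF that] opW that by auto
  with t show ?thesis
    by blast
qed

end

section \<open>Algebras of partial functions\<close>

text \<open>
  The image of \<open>v\<close> is a set of partial functions with open domains. It is closed under gluing for the
  front topology, so it is an algebra of sections of a sheaf on \<open>Y\<^sub>f\<close> presented by values.
\<close>

locale section_algebra =
  fixes A :: "'a skew_algebra" (structure) and Y :: "'y topology" and v :: "'a \<Rightarrow> 'y \<rightharpoonup> 'g"
  assumes inj: "inj_on v (carrier A)"
    and meet_in: "a \<in> carrier A \<Longrightarrow> b \<in> carrier A \<Longrightarrow> a \<curlywedge> b \<in> carrier A"
    and join_in: "a \<in> carrier A \<Longrightarrow> b \<in> carrier A \<Longrightarrow> a \<curlyvee> b \<in> carrier A"
    and zero_in: "\<zero> \<in> carrier A"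
    and val_meet: "a \<in> carrier A \<Longrightarrow> b \<in> carrier A \<Longrightarrow> v (a \<curlywedge> b) = v a |` dom (v b)"
    and val_join: "a \<in> carrier A \<Longrightarrow> b \<in> carrier A \<Longrightarrow> v (a \<curlyvee> b) = v a ++ v b"
    and val_zero: "v \<zero> = Map.empty"
    and openin_dom: "a \<in> carrier A \<Longrightarrow> openin Y (dom (v a))"
    and global: "\<exists>a\<in>carrier A. dom (v a) = topspace Y"
    and glue: "openin Y (dom f) \<Longrightarrow>
      (\<And>y. y \<in> dom f \<Longrightarrow> \<exists>a\<in>carrier A. \<exists>Z. openin (front Y) Z \<and> y \<in> Z \<and> Z \<subseteq> dom f \<and>
         (\<forall>z\<in>Z. v a z = f z)) \<Longrightarrow>
      \<exists>a\<in>carrier A. v a = f"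

definition stalk_map :: "('y, 's) sheaf_space \<Rightarrow> 'y set \<times> 's \<Rightarrow> 'y \<rightharpoonup> ('y set \<times> 's) set" where
  "stalk_map X = (\<lambda>(U, s) y. if y \<in> U then Some (germ (front (fst X)) (snd X) U s y) else None)"

lemma dom_stalk_map [simp]: "dom (stalk_map X a) = fst a"
  by (auto simp: stalk_map_def split: prod.splits if_splits)

locale sheafed_space =
  fixes X :: "('y, 's) sheaf_space"
  assumes Sh_obj: "Sh_obj X"
begin

sublocale sheaf_on "front (fst X)" "snd X"
  using Sh_obj by unfold_locales (simp add: Sh_obj_def)

abbreviation "Y \<equiv> fst X"
abbreviation "E \<equiv> snd X"

lemma carrier_H: "carrier (H_obj X) = {(U, s). openin Y U \<and> s \<in> sections E U}"
  by (simp add: H_obj_def Let_def)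

lemma meet_H: "(U, s) \<curlywedge>\<^bsub>H_obj X\<^esub> (V, t) = (U \<inter> V, restr E U (U \<inter> V) s)"
  by (simp add: H_obj_def Let_def)

lemma stalk_map_inj: "inj_on (stalk_map X) (carrier (H_obj X))"
proof (rule inj_onI, clarsimp simp: carrier_H)
  fix U s V t
  assume *: "openin Y U" "s \<in> sections E U" "openin Y V" "t \<in> sections E V"
    and eq: "stalk_map X (U, s) = stalk_map X (V, t)"
  have "U = V"
    using arg_cong[OF eq, of dom] by simp
  moreover have "s = t"
  proof (rule germ_ext[of U])
    show "germ (front Y) E U s y = germ (front Y) E U t y" if "y \<in> U" for y
      using fun_cong[OF eq, of y] that \<open>U = V\<close> by (simp add: stalk_map_def)
  qed (use * \<open>U = V\<close> in \<open>auto intro: openin_imp_openin_front\<close>)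
  ultimately show "U = V \<and> s = t"
    by simp
qed

text \<open>
  The section that defines the join exists and is unique because its germs are prescribed: those of \<open>t\<close>
  on \<open>V\<close>, and those of \<open>s\<close> on \<open>U - V\<close>, which is open in the front topology.
\<close>

lemma join_H:
  assumes "a \<in> carrier (H_obj X)" "b \<in> carrier (H_obj X)"
  shows "a \<curlyvee>\<^bsub>H_obj X\<^esub> b \<in> carrier (H_obj X)"
    and "stalk_map X (a \<curlyvee>\<^bsub>H_obj X\<^esub> b) = stalk_map X a ++ stalk_map X b"
proof -
  obtain U s V t where ab: "a = (U, s)" "b = (V, t)"
    by fastforce
  have *: "openin Y U" "s \<in> sections E U" "openin Y V" "t \<in> sections E V"
    using assms by (auto simp: carrier_H ab)
  have op: "openin (front Y) U" "openin (front Y) V" "openin (front Y) (U - V)"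
    "openin (front Y) (U \<union> V)"
    using * by (auto intro: openin_imp_openin_front openin_front_diff)
  define g where "g y = (if y \<in> V then germ (front Y) E V t y else germ (front Y) E U s y)" for y
  define P where "P r \<longleftrightarrow> r \<in> sections E (U \<union> V) \<and>
      restr E (U \<union> V) (U - V) r = restr E U (U - V) s \<and> restr E (U \<union> V) V r = t" for r
  have P_iff: "P r \<longleftrightarrow> r \<in> sections E (U \<union> V) \<and> (\<forall>y\<in>U \<union> V. germ (front Y) E (U \<union> V) r y = g y)" for r
  proof (cases "r \<in> sections E (U \<union> V)")
    case True
    have "restr E (U \<union> V) V r = t \<longleftrightarrow> restr E (U \<union> V) V r = restr E V V t"
      using * op by (simp add: restr_self)
    moreover have "restr E (U \<union> V) (U - V) r = restr E U (U - V) s \<longleftrightarrow>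
        (\<forall>y\<in>U - V. germ (front Y) E (U \<union> V) r y = germ (front Y) E U s y)"
      using True * op by (intro restr_eq_iff_germ) auto
    moreover have "restr E (U \<union> V) V r = restr E V V t \<longleftrightarrow>
        (\<forall>y\<in>V. germ (front Y) E (U \<union> V) r y = germ (front Y) E V t y)"
      using True * op by (intro restr_eq_iff_germ) auto
    ultimately show ?thesis
      using True by (auto simp: P_def g_def)
  qed (simp add: P_def)
  have "\<exists>r\<in>sections E (U \<union> V). \<forall>y\<in>U \<union> V. germ (front Y) E (U \<union> V) r y = g y"
  proof (rule glue_germs)
    fix y assume y: "y \<in> U \<union> V"
    show "\<exists>Z s. openin (front Y) Z \<and> y \<in> Z \<and> Z \<subseteq> U \<union> V \<and> s \<in> sections E Z \<and>
        (\<forall>z\<in>Z. germ (front Y) E Z s z = g z)"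
    proof (cases "y \<in> V")
      case True
      with op * show ?thesis
        by (intro exI[of _ V] exI[of _ t]) (auto simp: g_def)
    next
      case False
      with y op * show ?thesis
        by (intro exI[of _ "U - V"] exI[of _ "restr E U (U - V) s"])
          (auto simp: g_def germ_restr restr_closed)
    qed
  qed
  then obtain r where r: "P r"
    by (auto simp: P_iff)
  moreover have "r' = r" if "P r'" for r'
    using that r op unfolding P_iff by (intro germ_ext[of "U \<union> V"]) auto
  ultimately have the: "(THE r. P r) = r"
    by (rule the_equality)
  have join: "a \<curlyvee>\<^bsub>H_obj X\<^esub> b = (U \<union> V, r)"
    using the by (simp add: ab H_obj_def Let_def P_def)
  show "a \<curlyvee>\<^bsub>H_obj X\<^esub> b \<in> carrier (H_obj X)"
    using r * by (auto simp: join carrier_H P_def)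
  show "stalk_map X (a \<curlyvee>\<^bsub>H_obj X\<^esub> b) = stalk_map X a ++ stalk_map X b"
    using r unfolding join P_iff by (auto simp: ab stalk_map_def g_def map_add_def fun_eq_iff)
qed

sublocale H: section_algebra "H_obj X" "fst X" "stalk_map X"
proof
  fix a b assume a: "a \<in> carrier (H_obj X)" and b: "b \<in> carrier (H_obj X)"
  obtain U s V t where ab: "a = (U, s)" "b = (V, t)"
    by fastforce
  have *: "openin Y U" "s \<in> sections E U" "openin Y V" "t \<in> sections E V"
    using a b by (auto simp: carrier_H ab)
  then have op: "openin (front Y) U" "openin (front Y) V" "openin (front Y) (U \<inter> V)"
    by (auto intro: openin_imp_openin_front)
  show "a \<curlywedge>\<^bsub>H_obj X\<^esub> b \<in> carrier (H_obj X)"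
    using * op by (auto simp: ab meet_H carrier_H restr_closed)
  show "stalk_map X (a \<curlywedge>\<^bsub>H_obj X\<^esub> b) = stalk_map X a |` dom (stalk_map X b)"
    using * op by (auto simp: ab meet_H fun_eq_iff restrict_map_def stalk_map_def germ_restr)
  show "a \<curlyvee>\<^bsub>H_obj X\<^esub> b \<in> carrier (H_obj X)"
    "stalk_map X (a \<curlyvee>\<^bsub>H_obj X\<^esub> b) = stalk_map X a ++ stalk_map X b"
    using join_H[OF a b] .
  show "openin Y (dom (stalk_map X a))"
    using * by (simp add: ab)
next
  have "(THE s. s \<in> sections E {}) \<in> sections E {}"
    by (rule theI') (rule sections_empty)
  then show "\<zero>\<^bsub>H_obj X\<^esub> \<in> carrier (H_obj X)"
    by (simp add: H_obj_def Let_def)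
  show "stalk_map X \<zero>\<^bsub>H_obj X\<^esub> = Map.empty"
    by (auto simp: H_obj_def Let_def stalk_map_def)
  obtain s where "s \<in> sections E (topspace Y)"
    using Sh_obj by (auto simp: Sh_obj_def)
  then show "\<exists>a\<in>carrier (H_obj X). dom (stalk_map X a) = topspace Y"
    by (intro bexI[of _ "(topspace Y, s)"]) (auto simp: carrier_H)
  fix f :: "'y \<rightharpoonup> ('y set \<times> 's) set"
  assume opf: "openin Y (dom f)"
    and loc: "\<And>y. y \<in> dom f \<Longrightarrow> \<exists>a\<in>carrier (H_obj X). \<exists>Z. openin (front Y) Z \<and> y \<in> Z \<and>
      Z \<subseteq> dom f \<and> (\<forall>z\<in>Z. stalk_map X a z = f z)"
  have "\<exists>t\<in>sections E (dom f). \<forall>y\<in>dom f. germ (front Y) E (dom f) t y = the (f y)"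
  proof (rule glue_germs)
    fix y assume "y \<in> dom f"
    from loc[OF this] obtain a Z where a: "a \<in> carrier (H_obj X)" and Z: "openin (front Y) Z"
      "y \<in> Z" "Z \<subseteq> dom f" "\<forall>z\<in>Z. stalk_map X a z = f z"
      by (elim bexE exE conjE)
    obtain U s where "a = (U, s)"
      by fastforce
    with a Z have *: "openin Y U" "s \<in> sections E U" "openin (front Y) Z" "y \<in> Z"
      "Z \<subseteq> dom f" "\<And>z. z \<in> Z \<Longrightarrow> stalk_map X (U, s) z = f z"
      by (auto simp: carrier_H)
    have ZU: "Z \<subseteq> U"
    proof
      fix z assume "z \<in> Z"
      then have "stalk_map X (U, s) z \<noteq> None"
        using * by (metis domD subsetD option.distinct(1))
      then show "z \<in> U"
        by (simp add: stalk_map_def split: if_splits)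
    qed
    have "germ (front Y) E Z (restr E U Z s) z = the (f z)" if "z \<in> Z" for z
    proof -
      have "f z = Some (germ (front Y) E U s z)"
        using *(6)[OF that] ZU that by (auto simp: stalk_map_def)
      then show ?thesis
        using germ_restr[of U Z s z] * ZU that by (simp add: openin_imp_openin_front)
    qed
    moreover have "restr E U Z s \<in> sections E Z"
      using * ZU by (intro restr_closed) (auto intro: openin_imp_openin_front)
    ultimately show "\<exists>Z s. openin (front Y) Z \<and> y \<in> Z \<and> Z \<subseteq> dom f \<and> s \<in> sections E Z \<and>
        (\<forall>z\<in>Z. germ (front Y) E Z s z = the (f z))"
      using *(3-5) by blast
  qed
  then obtain t where t: "t \<in> sections E (dom f)"
    "\<And>y. y \<in> dom f \<Longrightarrow> germ (front Y) E (dom f) t y = the (f y)"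
    by blast
  have "stalk_map X (dom f, t) = f"
  proof
    show "stalk_map X (dom f, t) y = f y" for y
    proof (cases "f y")
      case (Some g)
      with t(2)[of y] show ?thesis
        by (simp add: stalk_map_def domI)
    qed (simp add: stalk_map_def domIff)
  qed
  moreover have "(dom f, t) \<in> carrier (H_obj X)"
    using opf t by (simp add: carrier_H)
  ultimately show "\<exists>a\<in>carrier (H_obj X). stalk_map X a = f"
    by blast
qed (rule stalk_map_inj)

end

section \<open>The noncommutative frame of an algebra of partial functions\<close>

lemma restrict_map_eq_self_iff: "m |` D = m \<longleftrightarrow> dom m \<subseteq> D"
proof
  assume "m |` D = m"
  then have "dom m = dom m \<inter> D"
    by (metis dom_restrict)
  then show "dom m \<subseteq> D"
    by blast
next
  assume D: "dom m \<subseteq> D"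
  show "m |` D = m"
  proof
    show "(m |` D) y = m y" for y
      using D by (cases "y \<in> dom m") (auto simp: restrict_map_def domIff)
  qed
qed

lemma restrict_map_dom_eq_iff: "m |` dom n = n \<longleftrightarrow> n \<subseteq>\<^sub>m m"
proof
  assume eq: "m |` dom n = n"
  show "n \<subseteq>\<^sub>m m"
    unfolding map_le_def
  proof
    fix y assume "y \<in> dom n"
    then show "n y = m y"
      using fun_cong[OF eq, of y] by simp
  qed
next
  assume le: "n \<subseteq>\<^sub>m m"
  show "m |` dom n = n"
  proof
    show "(m |` dom n) y = n y" for y
      using le by (cases "y \<in> dom n") (auto simp: map_le_def restrict_map_def domIff)
  qed
qed

lemma restrict_map_mono:
  assumes "D \<subseteq> D'"
  shows "m |` D \<subseteq>\<^sub>m m |` D'"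
  unfolding map_le_def
proof
  fix y assume "y \<in> dom (m |` D)"
  then have "y \<in> D"
    unfolding dom_restrict by blast
  with assms show "(m |` D) y = (m |` D') y"
    by (simp add: subsetD)
qed

context section_algebra
begin

declare meet_in [simp] join_in [simp] zero_in [simp] val_meet [simp] val_join [simp] val_zero [simp]

lemma val_eqI: "a \<in> carrier A \<Longrightarrow> b \<in> carrier A \<Longrightarrow> v a = v b \<Longrightarrow> a = b"
  using inj by (rule inj_onD)

lemma val_eq_iff: "a \<in> carrier A \<Longrightarrow> b \<in> carrier A \<Longrightarrow> a = b \<longleftrightarrow> v a = v b"
  using val_eqI by blast

lemma natural_order_le:
  assumes "a \<in> carrier A" "b \<in> carrier A"
  shows "le (natural_order A) a b \<longleftrightarrow> v a \<subseteq>\<^sub>m v b"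
proof -
  have "a \<curlywedge> b = a \<longleftrightarrow> dom (v a) \<subseteq> dom (v b)"
    using assms by (simp add: val_eq_iff restrict_map_eq_self_iff)
  moreover have "b \<curlywedge> a = a \<longleftrightarrow> v a \<subseteq>\<^sub>m v b"
    using assms by (simp add: val_eq_iff restrict_map_dom_eq_iff)
  ultimately show ?thesis
    using map_le_implies_dom_le[of "v a" "v b"] by (simp add: natural_order_def) blast
qed

lemma commute_iff:
  assumes "a \<in> carrier A" "b \<in> carrier A"
  shows "a \<curlywedge> b = b \<curlywedge> a \<and> a \<curlyvee> b = b \<curlyvee> a \<longleftrightarrow> (\<forall>y\<in>dom (v a) \<inter> dom (v b). v a y = v b y)"
    (is "?comm \<longleftrightarrow> ?agree")
proof
  assume ?comm
  then have eq: "v a |` dom (v b) = v b |` dom (v a)"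
    using assms by (metis val_meet)
  show ?agree
  proof
    fix y assume "y \<in> dom (v a) \<inter> dom (v b)"
    then show "v a y = v b y"
      using fun_cong[OF eq, of y] by simp
  qed
next
  assume agree: ?agree
  have "v (a \<curlywedge> b) = v (b \<curlywedge> a)"
  proof
    show "v (a \<curlywedge> b) y = v (b \<curlywedge> a) y" for y
      using agree assms by (cases "y \<in> dom (v a)"; cases "y \<in> dom (v b)") (auto simp: restrict_map_def domIff)
  qed
  moreover have "v (a \<curlyvee> b) = v (b \<curlyvee> a)"
  proof
    show "v (a \<curlyvee> b) y = v (b \<curlyvee> a) y" for y
      using bspec[OF agree, of y] assms by (cases "v a y"; cases "v b y") (simp_all add: map_add_def domIff)
  qed
  ultimately show ?comm
    using assms by (simp add: val_eqI)
qed

lemma commuting_subset_iff: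
  "commuting_subset A S \<longleftrightarrow> S \<subseteq> carrier A \<and> S \<noteq> {} \<and>
     (\<forall>a\<in>S. \<forall>b\<in>S. \<forall>y\<in>dom (v a) \<inter> dom (v b). v a y = v b y)"
proof (cases "S \<subseteq> carrier A")
  case True
  have "(\<forall>a\<in>S. \<forall>b\<in>S. a \<curlywedge> b = b \<curlywedge> a \<and> a \<curlyvee> b = b \<curlyvee> a) \<longleftrightarrow>
      (\<forall>a\<in>S. \<forall>b\<in>S. \<forall>y\<in>dom (v a) \<inter> dom (v b). v a y = v b y)"
    by (rule ball_cong[OF refl], rule ball_cong[OF refl], rule commute_iff) (use True in blast)+
  then show ?thesis
    by (simp add: commuting_subset_def)
qed (simp add: commuting_subset_def)

text \<open>
  Commuting elements agree where both are defined, so their union is a partial function. It is locally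
  one of them, hence again in the algebra.
\<close>

lemma commuting_has_union:
  assumes S: "commuting_subset A S"
  shows "\<exists>u\<in>carrier A. dom (v u) = (\<Union>a\<in>S. dom (v a)) \<and> (\<forall>a\<in>S. v a \<subseteq>\<^sub>m v u)"
proof -
  have SA: "S \<subseteq> carrier A"
    and agree: "\<And>a b y. a \<in> S \<Longrightarrow> b \<in> S \<Longrightarrow> y \<in> dom (v a) \<Longrightarrow> y \<in> dom (v b) \<Longrightarrow> v a y = v b y"
    using S unfolding commuting_subset_iff by (simp, metis IntI)
  define f where
    "f y = (if y \<in> (\<Union>a\<in>S. dom (v a)) then v (SOME a. a \<in> S \<and> y \<in> dom (v a)) y else None)" for y
  have f: "f y = v a y" if "a \<in> S" "y \<in> dom (v a)" for a y
  proof -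
    define b where "b = (SOME a. a \<in> S \<and> y \<in> dom (v a))"
    have "b \<in> S \<and> y \<in> dom (v b)"
      unfolding b_def by (rule someI[of _ a]) (use that in simp)
    then have "v b y = v a y"
      using agree that by blast
    moreover have "f y = v b y"
      using that by (auto simp: f_def b_def)
    ultimately show ?thesis
      by simp
  qed
  have dom_f: "dom f = (\<Union>a\<in>S. dom (v a))"
  proof
    show "dom f \<subseteq> (\<Union>a\<in>S. dom (v a))"
      by (auto simp: f_def split: if_splits)
    show "(\<Union>a\<in>S. dom (v a)) \<subseteq> dom f"
    proof
      fix y assume "y \<in> (\<Union>a\<in>S. dom (v a))"
      then obtain a where "a \<in> S" "y \<in> dom (v a)"
        by blast
      with f[of a y] show "y \<in> dom f"
        by (simp add: domIff)
    qed
  qed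
  have "\<exists>u\<in>carrier A. v u = f"
  proof (rule glue)
    show "openin Y (dom f)"
      unfolding dom_f by (rule openin_Union) (use SA openin_dom in auto)
    fix y assume "y \<in> dom f"
    then obtain a where a: "a \<in> S" "y \<in> dom (v a)"
      unfolding dom_f by blast
    then have "openin (front Y) (dom (v a))"
      using SA by (auto intro: openin_imp_openin_front openin_dom)
    moreover have "dom (v a) \<subseteq> dom f"
      using a dom_f by blast
    ultimately show "\<exists>a\<in>carrier A. \<exists>Z. openin (front Y) Z \<and> y \<in> Z \<and> Z \<subseteq> dom f \<and> (\<forall>z\<in>Z. v a z = f z)"
      using a f SA by (metis subsetD)
  qed
  then show ?thesis
    using dom_f f by (metis map_le_def)
qed

text \<open>
  An upper bound whose domain is not larger than the union of the given domains is least, since its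
  values are forced.
\<close>

lemma is_lub_natural_orderI:
  assumes S: "S \<subseteq> carrier A" and u: "u \<in> carrier A" "dom (v u) = (\<Union>a\<in>S. dom (v a))" "\<And>a. a \<in> S \<Longrightarrow> v a \<subseteq>\<^sub>m v u"
  shows "is_lub (natural_order A) u S"
proof -
  have [simp]: "carrier (natural_order A) = carrier A"
    by (simp add: natural_order_def)
  have upper: "x \<in> Upper (natural_order A) S \<longleftrightarrow> x \<in> carrier A \<and> (\<forall>a\<in>S. v a \<subseteq>\<^sub>m v x)" for x
    using S by (auto simp: Upper_def natural_order_le subset_iff)
  have "v u \<subseteq>\<^sub>m v x" if x: "\<forall>a\<in>S. v a \<subseteq>\<^sub>m v x" for x
    unfolding map_le_def
  proof
    fix y assume "y \<in> dom (v u)"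
    then obtain a where a: "a \<in> S" "y \<in> dom (v a)"
      using u by blast
    then have "v a y = v u y" "v a y = v x y"
      using u(3) x by (auto simp: map_le_def)
    then show "v u y = v x y"
      by simp
  qed
  then show ?thesis
    using u upper by (auto simp: least_def natural_order_le)
qed

lemma is_lub_unique:
  assumes "is_lub (natural_order A) u S" "is_lub (natural_order A) w S"
  shows "u = w"
proof -
  have "u \<in> carrier A" "w \<in> carrier A" "le (natural_order A) u w" "le (natural_order A) w u"
    using assms by (auto simp: least_def natural_order_def)
  then show ?thesis
    by (simp add: natural_order_le map_le_antisym val_eqI)
qed

lemma Sup_eq_lub: "is_lub (natural_order A) u S \<Longrightarrow> \<Squnion>\<^bsub>natural_order A\<^esub> S = u"
  unfolding sup_def by (rule some_equality) (auto intro: is_lub_unique)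

lemma Sup_eqI:
  assumes "S \<subseteq> carrier A" "u \<in> carrier A" "dom (v u) = (\<Union>a\<in>S. dom (v a))" "\<And>a. a \<in> S \<Longrightarrow> v a \<subseteq>\<^sub>m v u"
  shows "\<Squnion>\<^bsub>natural_order A\<^esub> S = u"
  using assms by (intro Sup_eq_lub is_lub_natural_orderI)

lemma Sup_commuting:
  assumes "commuting_subset A S"
  shows "\<Squnion>\<^bsub>natural_order A\<^esub> S \<in> carrier A"
    and "dom (v (\<Squnion>\<^bsub>natural_order A\<^esub> S)) = (\<Union>a\<in>S. dom (v a))"
    and "a \<in> S \<Longrightarrow> v a \<subseteq>\<^sub>m v (\<Squnion>\<^bsub>natural_order A\<^esub> S)"
    and "is_lub (natural_order A) (\<Squnion>\<^bsub>natural_order A\<^esub> S) S"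
proof -
  have S: "S \<subseteq> carrier A"
    using assms by (simp add: commuting_subset_def)
  obtain u where u: "u \<in> carrier A" "dom (v u) = (\<Union>a\<in>S. dom (v a))" "\<And>a. a \<in> S \<Longrightarrow> v a \<subseteq>\<^sub>m v u"
    using commuting_has_union[OF assms] by metis
  have eq: "\<Squnion>\<^bsub>natural_order A\<^esub> S = u"
    by (rule Sup_eqI[OF S u])
  show "\<Squnion>\<^bsub>natural_order A\<^esub> S \<in> carrier A"
    and "dom (v (\<Squnion>\<^bsub>natural_order A\<^esub> S)) = (\<Union>a\<in>S. dom (v a))"
    and "a \<in> S \<Longrightarrow> v a \<subseteq>\<^sub>m v (\<Squnion>\<^bsub>natural_order A\<^esub> S)"
    unfolding eq by (fact u)+
  show "is_lub (natural_order A) (\<Squnion>\<^bsub>natural_order A\<^esub> S) S"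
    unfolding eq by (rule is_lub_natural_orderI[OF S u])
qed

lemma Sup_meet_distrib_val:
  assumes S: "commuting_subset A S" and b: "b \<in> carrier A"
  shows "(\<Squnion>\<^bsub>natural_order A\<^esub> S) \<curlywedge> b = \<Squnion>\<^bsub>natural_order A\<^esub> ((\<lambda>a. a \<curlywedge> b) ` S)"
proof (rule Sup_eqI[symmetric])
  have SA: "a \<in> carrier A" if "a \<in> S" for a
    using S that by (auto simp: commuting_subset_def)
  show "(\<lambda>a. a \<curlywedge> b) ` S \<subseteq> carrier A"
    using SA b by auto
  show "(\<Squnion>\<^bsub>natural_order A\<^esub> S) \<curlywedge> b \<in> carrier A"
    using Sup_commuting[OF S] b by simp
  show "dom (v ((\<Squnion>\<^bsub>natural_order A\<^esub> S) \<curlywedge> b)) = (\<Union>a\<in>(\<lambda>a. a \<curlywedge> b) ` S. dom (v a))"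
    using Sup_commuting[OF S] b SA by auto
  show "v x \<subseteq>\<^sub>m v ((\<Squnion>\<^bsub>natural_order A\<^esub> S) \<curlywedge> b)" if x: "x \<in> (\<lambda>a. a \<curlywedge> b) ` S" for x
  proof -
    obtain a where a: "a \<in> S" "x = a \<curlywedge> b"
      using x by blast
    show ?thesis
      using Sup_commuting(1)[OF S] Sup_commuting(3)[OF S a(1)] SA[OF a(1)] b
      by (auto simp: map_le_def a)
  qed
qed

lemma meet_Sup_distrib_val:
  assumes S: "commuting_subset A S" and b: "b \<in> carrier A"
  shows "b \<curlywedge> (\<Squnion>\<^bsub>natural_order A\<^esub> S) = \<Squnion>\<^bsub>natural_order A\<^esub> ((\<lambda>a. b \<curlywedge> a) ` S)"
proof (rule Sup_eqI[symmetric])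
  have SA: "a \<in> carrier A" if "a \<in> S" for a
    using S that by (auto simp: commuting_subset_def)
  show "(\<lambda>a. b \<curlywedge> a) ` S \<subseteq> carrier A"
    using SA b by auto
  show "b \<curlywedge> (\<Squnion>\<^bsub>natural_order A\<^esub> S) \<in> carrier A"
    using Sup_commuting[OF S] b by simp
  show "dom (v (b \<curlywedge> (\<Squnion>\<^bsub>natural_order A\<^esub> S))) = (\<Union>a\<in>(\<lambda>a. b \<curlywedge> a) ` S. dom (v a))"
    using Sup_commuting[OF S] b SA by auto
  show "v x \<subseteq>\<^sub>m v (b \<curlywedge> (\<Squnion>\<^bsub>natural_order A\<^esub> S))" if x: "x \<in> (\<lambda>a. b \<curlywedge> a) ` S" for x
  proof -
    obtain a where a: "a \<in> S" "x = b \<curlywedge> a"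
      using x by blast
    have "dom (v a) \<subseteq> dom (v (\<Squnion>\<^bsub>natural_order A\<^esub> S))"
      using Sup_commuting(2)[OF S] a by blast
    then show ?thesis
      using Sup_commuting(1)[OF S] SA[OF a(1)] b
      by (simp add: a restrict_map_mono)
  qed
qed

theorem left_handed_nc_frame: "left_handed_nc_frame A"
proof
  fix x y z
  assume x: "x \<in> carrier A" and y: "y \<in> carrier A"
  note ext = val_eq_iff fun_eq_iff restrict_map_def map_add_def domIff
  show "x \<curlywedge> y \<in> carrier A" "x \<curlyvee> y \<in> carrier A"
    using x y by auto
  show "x \<curlywedge> (x \<curlyvee> y) = x" "x \<curlyvee> (x \<curlywedge> y) = x" "(x \<curlywedge> y) \<curlyvee> y = y" "(x \<curlyvee> y) \<curlywedge> y = y"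
    "x \<curlywedge> y \<curlywedge> x = x \<curlywedge> y"
    using x y by (auto simp: ext split: option.splits)
  assume z: "z \<in> carrier A"
  show "x \<curlywedge> y \<curlywedge> z = x \<curlywedge> (y \<curlywedge> z)" "x \<curlyvee> y \<curlyvee> z = x \<curlyvee> (y \<curlyvee> z)"
    using x y z by (auto simp: ext split: option.splits)
  show "(x \<curlyvee> y) \<curlywedge> z = (x \<curlywedge> z) \<curlyvee> (y \<curlywedge> z)" "x \<curlywedge> (y \<curlyvee> z) = (x \<curlywedge> y) \<curlyvee> (x \<curlywedge> z)"
    using x y z by (auto simp: ext split: option.splits)
next
  fix x assume x: "x \<in> carrier A"
  show "x \<curlywedge> x = x" "x \<curlyvee> x = x" "x \<curlyvee> \<zero> = x" "\<zero> \<curlyvee> x = x"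
    using x by (auto simp: val_eq_iff fun_eq_iff restrict_map_def map_add_def domIff split: option.splits)
next
  fix S assume "commuting_subset A S"
  then show "\<exists>u. is_lub (natural_order A) u S"
    using Sup_commuting(4) by blast
qed (simp_all add: Sup_meet_distrib_val meet_Sup_distrib_val)


section \<open>The commutative shadow\<close>

lemma green_D_iff:
  "(a, b) \<in> green_D A \<longleftrightarrow> a \<in> carrier A \<and> b \<in> carrier A \<and> dom (v a) = dom (v b)"
proof (cases "a \<in> carrier A \<and> b \<in> carrier A")
  case True
  have "a \<curlywedge> b \<curlywedge> a = a \<longleftrightarrow> dom (v a) \<subseteq> dom (v b)" if "a \<in> carrier A" "b \<in> carrier A" for a b
    using that by (simp add: val_eq_iff restrict_map_eq_self_iff)
  with True show ?thesis
    unfolding green_D_def by auto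
qed (auto simp: green_D_def)

lemma mem_cls_iff: "a \<in> carrier A \<Longrightarrow> b \<in> cls A a \<longleftrightarrow> b \<in> carrier A \<and> dom (v b) = dom (v a)"
  by (auto simp: green_D_iff)

lemma cls_eq_iff:
  assumes "a \<in> carrier A" "b \<in> carrier A"
  shows "cls A a = cls A b \<longleftrightarrow> dom (v a) = dom (v b)"
proof
  assume "cls A a = cls A b"
  moreover have "a \<in> cls A a"
    unfolding mem_cls_iff[OF assms(1)] using assms(1) by simp
  ultimately have "a \<in> cls A b"
    by (simp only:)
  then show "dom (v a) = dom (v b)"
    unfolding mem_cls_iff[OF assms(2)] by simp
next
  assume "dom (v a) = dom (v b)"
  then have "x \<in> cls A a \<longleftrightarrow> x \<in> cls A b" for x
    by (simp only: mem_cls_iff[OF assms(1)] mem_cls_iff[OF assms(2)])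
  then show "cls A a = cls A b"
    by blast
qed

lemma carrier_shadow: "carrier (shadow A) = cls A ` carrier A"
  by (auto simp: shadow_def quotient_def)

lemma cls_in_shadow [simp]: "a \<in> carrier A \<Longrightarrow> cls A a \<in> carrier (shadow A)"
  by (simp add: carrier_shadow)

lemma shadow_le:
  assumes "a \<in> carrier A" "b \<in> carrier A"
  shows "le (shadow A) (cls A a) (cls A b) \<longleftrightarrow> dom (v a) \<subseteq> dom (v b)"
proof -
  have "cls A (x \<curlywedge> y) = cls A a \<longleftrightarrow> dom (v a) \<subseteq> dom (v b)"
    if "x \<in> cls A a" "y \<in> cls A b" for x y
    using that assms by (auto simp only: mem_cls_iff cls_eq_iff meet_in val_meet dom_restrict)
  moreover have "a \<in> cls A a" "b \<in> cls A b"
    using assms by (simp_all add: mem_cls_iff del: Image_singleton_iff)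
  ultimately show ?thesis
    by (auto simp: shadow_def simp del: Image_singleton_iff)
qed

lemma shadow_antisym:
  assumes "X \<in> carrier (shadow A)" "X' \<in> carrier (shadow A)"
    "le (shadow A) X X'" "le (shadow A) X' X"
  shows "X = X'"
proof -
  obtain a b where "a \<in> carrier A" "X = cls A a" "b \<in> carrier A" "X' = cls A b"
    using assms by (auto simp: carrier_shadow simp del: Image_singleton_iff)
  with assms show ?thesis
    by (simp add: shadow_le cls_eq_iff)
qed

text \<open>
  Restricting a global element to an open set shows that every open set is a domain; together with
  \<open>green_D_iff\<close> this identifies \<open>A/D\<close> with the frame of open sets.
\<close>

lemma open_is_dom:
  assumes "openin Y U"
  shows "\<exists>a\<in>carrier A. dom (v a) = U"
proof -
  obtain g where g: "g \<in> carrier A" "dom (v g) = topspace Y"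
    using global by blast
  have dom: "dom (v g |` U) = U"
    using g assms by (auto dest: openin_subset)
  have "\<exists>a\<in>carrier A. v a = v g |` U"
  proof (rule glue)
    show "\<exists>a\<in>carrier A. \<exists>Z. openin (front Y) Z \<and> y \<in> Z \<and> Z \<subseteq> dom (v g |` U) \<and>
        (\<forall>z\<in>Z. v a z = (v g |` U) z)" if "y \<in> dom (v g |` U)" for y
      using that g assms dom by (intro bexI[of _ g] exI[of _ U]) (auto intro: openin_imp_openin_front)
  qed (use assms dom in simp)
  with dom show ?thesis
    by metis
qed

lemma shadow_top:
  assumes "g \<in> carrier A" "dom (v g) = topspace Y"
  shows "\<top>\<^bsub>shadow A\<^esub> = cls A g"
  unfolding top_def
proof (rule some_equality)
  have "dom (v a) \<subseteq> topspace Y" if "a \<in> carrier A" for a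
    using openin_dom[OF that] by (rule openin_subset)
  then show gr: "greatest (shadow A) (cls A g) (carrier (shadow A))"
    using assms by (auto simp: greatest_def carrier_shadow shadow_le simp del: Image_singleton_iff)
  show "X = cls A g" if "greatest (shadow A) X (carrier (shadow A))" for X
    using that gr by (intro shadow_antisym) (auto simp: greatest_def simp del: Image_singleton_iff)
qed

lemma mem_shadow_top: "a \<in> \<top>\<^bsub>shadow A\<^esub> \<longleftrightarrow> a \<in> carrier A \<and> dom (v a) = topspace Y"
proof -
  obtain g where g: "g \<in> carrier A" "dom (v g) = topspace Y"
    using global by (elim bexE)
  then show ?thesis
    using mem_cls_iff[OF g(1), of a] by (simp only: shadow_top[OF g])
qed

lemma shadow_meet:
  assumes "a \<in> carrier A" "b \<in> carrier A"
  shows "cls A a \<sqinter>\<^bsub>shadow A\<^esub> cls A b = cls A (a \<curlywedge> b)"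
  unfolding meet_def inf_def
proof (rule some_equality)
  have lower: "X \<in> Lower (shadow A) {cls A a, cls A b} \<longleftrightarrow>
      (\<exists>c\<in>carrier A. X = cls A c \<and> dom (v c) \<subseteq> dom (v a) \<inter> dom (v b))" for X
  proof -
    have "X \<in> Lower (shadow A) {cls A a, cls A b} \<longleftrightarrow> X \<in> cls A ` carrier A \<and>
        le (shadow A) X (cls A a) \<and> le (shadow A) X (cls A b)"
      using assms cls_in_shadow by (auto simp: Lower_def carrier_shadow[symmetric] simp del: Image_singleton_iff)
    also have "\<dots> \<longleftrightarrow> (\<exists>c\<in>carrier A. X = cls A c \<and> le (shadow A) (cls A c) (cls A a) \<and>
        le (shadow A) (cls A c) (cls A b))"
      by (auto simp del: Image_singleton_iff)
    also have "\<dots> \<longleftrightarrow> (\<exists>c\<in>carrier A. X = cls A c \<and> dom (v c) \<subseteq> dom (v a) \<inter> dom (v b))"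
      using assms by (simp add: shadow_le cong: bex_cong)
    finally show ?thesis .
  qed
  show gr: "greatest (shadow A) (cls A (a \<curlywedge> b)) (Lower (shadow A) {cls A a, cls A b})"
    unfolding greatest_def
  proof (intro conjI ballI)
    show "Lower (shadow A) {cls A a, cls A b} \<subseteq> carrier (shadow A)"
      unfolding Lower_def by blast
    have "a \<curlywedge> b \<in> carrier A" "dom (v (a \<curlywedge> b)) \<subseteq> dom (v a) \<inter> dom (v b)"
      using assms by auto
    then show "cls A (a \<curlywedge> b) \<in> Lower (shadow A) {cls A a, cls A b}"
      unfolding lower by blast
    fix X assume "X \<in> Lower (shadow A) {cls A a, cls A b}"
    then obtain c where "c \<in> carrier A" "X = cls A c" "dom (v c) \<subseteq> dom (v a) \<inter> dom (v b)"
      unfolding lower by metis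
    then show "le (shadow A) X (cls A (a \<curlywedge> b))"
      using assms by (simp add: shadow_le Int_commute)
  qed
  show "X = cls A (a \<curlywedge> b)" if "greatest (shadow A) X (Lower (shadow A) {cls A a, cls A b})" for X
    using that gr
    by (intro shadow_antisym) (auto simp: greatest_def Lower_def simp del: Image_singleton_iff)
qed

lemma shadow_Sup:
  assumes S: "S \<subseteq> carrier A" and u: "u \<in> carrier A" "dom (v u) = (\<Union>a\<in>S. dom (v a))"
  shows "\<Squnion>\<^bsub>shadow A\<^esub> (cls A ` S) = cls A u"
  unfolding sup_def
proof (rule some_equality)
  have upper: "X \<in> Upper (shadow A) (cls A ` S) \<longleftrightarrow>
      (\<exists>c\<in>carrier A. X = cls A c \<and> (\<forall>a\<in>S. dom (v a) \<subseteq> dom (v c)))" for X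
  proof -
    have "X \<in> Upper (shadow A) (cls A ` S) \<longleftrightarrow>
        X \<in> cls A ` carrier A \<and> (\<forall>a\<in>S. le (shadow A) (cls A a) X)"
      using S cls_in_shadow by (auto simp: Upper_def carrier_shadow[symmetric] simp del: Image_singleton_iff)
    also have "\<dots> \<longleftrightarrow> (\<exists>c\<in>carrier A. X = cls A c \<and> (\<forall>a\<in>S. le (shadow A) (cls A a) (cls A c)))"
      by (auto simp del: Image_singleton_iff)
    also have "\<dots> \<longleftrightarrow> (\<exists>c\<in>carrier A. X = cls A c \<and> (\<forall>a\<in>S. dom (v a) \<subseteq> dom (v c)))"
      using S shadow_le by (metis subsetD)
    finally show ?thesis .
  qed
  show ls: "is_lub (shadow A) (cls A u) (cls A ` S)"
    unfolding least_def
  proof (intro conjI ballI)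
    show "Upper (shadow A) (cls A ` S) \<subseteq> carrier (shadow A)"
      unfolding Upper_def by blast
    have "\<forall>a\<in>S. dom (v a) \<subseteq> dom (v u)"
      unfolding u(2) by blast
    then show "cls A u \<in> Upper (shadow A) (cls A ` S)"
      unfolding upper using u(1) by blast
    fix X assume "X \<in> Upper (shadow A) (cls A ` S)"
    then obtain c where c: "c \<in> carrier A" "X = cls A c" "\<forall>a\<in>S. dom (v a) \<subseteq> dom (v c)"
      unfolding upper by metis
    then show "le (shadow A) (cls A u) X"
      using u by (simp only: shadow_le UN_least)
  qed
  show "X = cls A u" if "is_lub (shadow A) X (cls A ` S)" for X
    using that ls
    by (intro shadow_antisym) (auto simp: least_def Upper_def simp del: Image_singleton_iff)
qed


text \<open>
  A point can be described on \<open>A\<close> itself, by the operations of the noncommutative frame and suprema of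
  commuting subsets only. In this form it is evident that morphisms pull points back. That suprema of
  commuting subsets suffice is due to the fact that every family of classes has commuting
  representatives.
\<close>

lemma points_iff:
  "p \<in> points A \<longleftrightarrow> p \<in> carrier (shadow A) \<rightarrow>\<^sub>E UNIV \<and> (\<exists>a\<in>carrier A. p (cls A a)) \<and>
     (\<forall>a\<in>carrier A. \<forall>b\<in>carrier A. p (cls A (a \<curlywedge> b)) \<longleftrightarrow> p (cls A a) \<and> p (cls A b)) \<and>
     \<not> p (cls A \<zero>) \<and>
     (\<forall>S. commuting_subset A S \<longrightarrow>
        (p (cls A (\<Squnion>\<^bsub>natural_order A\<^esub> S)) \<longleftrightarrow> (\<exists>a\<in>S. p (cls A a))))"
  (is "_ \<longleftrightarrow> ?ext \<and> ?ne \<and> ?meet \<and> ?zero \<and> ?Sup")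
proof -
  obtain g where g: "g \<in> carrier A" "dom (v g) = topspace Y"
    using global by blast
  have sub: "dom (v a) \<subseteq> topspace Y" if "a \<in> carrier A" for a
    using openin_dom[OF that] by (rule openin_subset)
  have meet: "(\<forall>X\<in>carrier (shadow A). \<forall>Y\<in>carrier (shadow A). p (X \<sqinter>\<^bsub>shadow A\<^esub> Y) \<longleftrightarrow> p X \<and> p Y)
      \<longleftrightarrow> ?meet"
    by (auto simp: carrier_shadow shadow_meet simp del: Image_singleton_iff)
  have zero: "\<Squnion>\<^bsub>shadow A\<^esub> {} = cls A \<zero>"
    using shadow_Sup[of "{}" \<zero>] by simp
  have Sups: "(\<forall>\<S>. \<S> \<subseteq> carrier (shadow A) \<longrightarrow> (p (\<Squnion>\<^bsub>shadow A\<^esub> \<S>) \<longleftrightarrow> (\<exists>X\<in>\<S>. p X)))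
      \<longleftrightarrow> ?zero \<and> ?Sup" (is "?L \<longleftrightarrow> _")
  proof
    assume L: ?L
    have ?zero
      using L[rule_format, of "{}"] zero by simp
    moreover have ?Sup
    proof (intro allI impI)
      fix S assume S: "commuting_subset A S"
      then have SA: "S \<subseteq> carrier A"
        by (simp add: commuting_subset_def)
      have "\<Squnion>\<^bsub>shadow A\<^esub> (cls A ` S) = cls A (\<Squnion>\<^bsub>natural_order A\<^esub> S)"
        using SA Sup_commuting[OF S] by (intro shadow_Sup) auto
      then show "p (cls A (\<Squnion>\<^bsub>natural_order A\<^esub> S)) \<longleftrightarrow> (\<exists>a\<in>S. p (cls A a))"
        using L[rule_format, of "cls A ` S"] SA carrier_shadow by auto
    qed
    ultimately show "?zero \<and> ?Sup"
      by blast
  next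
    assume R: "?zero \<and> ?Sup"
    show ?L
    proof (intro allI impI)
      fix \<S> assume "\<S> \<subseteq> carrier (shadow A)"
      then obtain S where S: "S \<subseteq> carrier A" "\<S> = cls A ` S"
        by (auto simp: carrier_shadow subset_image_iff)
      show "p (\<Squnion>\<^bsub>shadow A\<^esub> \<S>) \<longleftrightarrow> (\<exists>X\<in>\<S>. p X)"
      proof (cases "S = {}")
        case True
        with R zero S show ?thesis
          by simp
      next
        case False
        \<comment> \<open>Restrictions of one global element commute, and they reach all classes.\<close>
        define S' where "S' = (\<lambda>a. g \<curlywedge> a) ` S"
        have dom: "dom (v (g \<curlywedge> a)) = dom (v a)" if "a \<in> S" for a
          using subsetD[OF S(1) that] g sub[of a] by (simp add: inf.absorb2)
        have cls: "cls A (g \<curlywedge> a) = cls A a" if "a \<in> S" for a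
          using dom[OF that] that S g by (subst cls_eq_iff) auto
        have S'A: "S' \<subseteq> carrier A"
          using S g by (auto simp: S'_def)
        have S': "commuting_subset A S'"
          unfolding commuting_subset_iff
        proof (intro conjI ballI)
          fix x z y assume "x \<in> S'" "z \<in> S'" and y: "y \<in> dom (v x) \<inter> dom (v z)"
          then obtain a b where "a \<in> S" "b \<in> S" "x = g \<curlywedge> a" "z = g \<curlywedge> b"
            by (auto simp: S'_def)
          then show "v x y = v z y"
            using y S g by (auto simp: subset_iff)
        qed (use False S'A in \<open>auto simp: S'_def\<close>)
        have "cls A ` S' = \<S>"
          using cls by (auto simp: S'_def S image_image simp del: Image_singleton_iff)
        moreover have "\<Squnion>\<^bsub>shadow A\<^esub> (cls A ` S') = cls A (\<Squnion>\<^bsub>natural_order A\<^esub> S')"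
          using S'A Sup_commuting[OF S'] by (intro shadow_Sup) auto
        ultimately show ?thesis
          using R S' by auto
      qed
    qed
  qed
  have top: "?meet \<Longrightarrow> p \<top>\<^bsub>shadow A\<^esub> \<longleftrightarrow> ?ne"
  proof
    assume m: ?meet and ?ne
    then obtain a where a: "a \<in> carrier A" "p (cls A a)"
      by blast
    have "cls A (g \<curlywedge> a) = cls A a"
      using a g sub[of a] by (subst cls_eq_iff) auto
    then show "p \<top>\<^bsub>shadow A\<^esub>"
      using m a g by (metis shadow_top)
  qed (use g shadow_top in auto)
  show ?thesis
    unfolding points_def Let_def mem_Collect_eq meet Sups using top by blast
qed

end

section \<open>The space of points\<close>

text \<open>
  The point \<open>y\<close> of \<open>Y\<close>, seen as a point of \<open>A/D\<close>.
\<close>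

definition eval_point :: "'a skew_algebra \<Rightarrow> ('a \<Rightarrow> 'y \<rightharpoonup> 'g) \<Rightarrow> 'y \<Rightarrow> 'a point" where
  "eval_point A v y = (\<lambda>c\<in>carrier (shadow A). \<exists>a\<in>c. y \<in> dom (v a))"

context section_algebra
begin

declare Image_singleton_iff [simp del] domIff [iff del]

lemma point_meet:
  "p \<in> points A \<Longrightarrow> a \<in> carrier A \<Longrightarrow> b \<in> carrier A \<Longrightarrow>
   p (cls A (a \<curlywedge> b)) \<longleftrightarrow> p (cls A a) \<and> p (cls A b)"
  by (simp add: points_iff)

lemma point_zero: "p \<in> points A \<Longrightarrow> \<not> p (cls A \<zero>)"
  by (simp add: points_iff)

lemma point_mono:
  assumes "p \<in> points A" "a \<in> carrier A" "b \<in> carrier A" "dom (v a) \<subseteq> dom (v b)" "p (cls A a)"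
  shows "p (cls A b)"
proof -
  have "cls A (a \<curlywedge> b) = cls A a"
    using assms by (subst cls_eq_iff) (auto simp: inf.absorb2)
  then show ?thesis
    using point_meet[of p a b] assms by simp
qed

lemma point_Union:
  assumes p: "p \<in> points A" and S: "S \<subseteq> carrier A"
    and u: "u \<in> carrier A" "dom (v u) = (\<Union>a\<in>S. dom (v a))"
  shows "p (cls A u) \<longleftrightarrow> (\<exists>a\<in>S. p (cls A a))"
proof -
  have "cls A ` S \<subseteq> carrier (shadow A)"
    using S by (auto simp: carrier_shadow)
  then have "p (\<Squnion>\<^bsub>shadow A\<^esub> (cls A ` S)) \<longleftrightarrow> (\<exists>X\<in>cls A ` S. p X)"
    using p unfolding points_def Let_def by blast
  then show ?thesis
    by (simp add: shadow_Sup[OF S u])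
qed

lemma point_join:
  assumes "p \<in> points A" "a \<in> carrier A" "b \<in> carrier A"
  shows "p (cls A (a \<curlyvee> b)) \<longleftrightarrow> p (cls A a) \<or> p (cls A b)"
  using assms point_Union[of p "{a, b}" "a \<curlyvee> b"] by auto

lemma point_top:
  assumes "p \<in> points A" "g \<in> carrier A" "dom (v g) = topspace Y"
  shows "p (cls A g)"
proof -
  obtain a where a: "a \<in> carrier A" "p (cls A a)"
    using assms(1)[unfolded points_iff] by metis
  moreover have "dom (v a) \<subseteq> dom (v g)"
    unfolding assms(3) using openin_dom[OF a(1)] by (rule openin_subset)
  ultimately show ?thesis
    using assms point_mono by blast
qed

lemma point_eqI:
  assumes "p \<in> points A" "q \<in> points A" "\<And>a. a \<in> carrier A \<Longrightarrow> p (cls A a) = q (cls A a)"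
  shows "p = q"
proof (rule extensionalityI)
  show "p \<in> extensional (carrier (shadow A))" "q \<in> extensional (carrier (shadow A))"
    using assms by (auto simp: points_iff PiE_def)
qed (use assms in \<open>auto simp: carrier_shadow\<close>)

lemma eval_point_cls:
  assumes "a \<in> carrier A"
  shows "eval_point A v y (cls A a) \<longleftrightarrow> y \<in> dom (v a)"
proof -
  have "(\<exists>b\<in>cls A a. y \<in> dom (v b)) \<longleftrightarrow> y \<in> dom (v a)"
    using mem_cls_iff[OF assms] assms by auto
  then show ?thesis
    using assms by (simp add: eval_point_def)
qed

lemma eval_point_in_points:
  assumes "y \<in> topspace Y"
  shows "eval_point A v y \<in> points A"
  unfolding points_iff
proof (intro conjI ballI allI impI)
  show "eval_point A v y \<in> carrier (shadow A) \<rightarrow>\<^sub>E UNIV"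
    by (simp add: eval_point_def)
  obtain g where "g \<in> carrier A" "dom (v g) = topspace Y"
    using global by (elim bexE)
  then show "\<exists>a\<in>carrier A. eval_point A v y (cls A a)"
    using assms by (intro bexI[of _ g]) (simp_all add: eval_point_cls)
  fix S assume S: "commuting_subset A S"
  then have "S \<subseteq> carrier A"
    by (simp add: commuting_subset_def)
  then show "eval_point A v y (cls A (\<Squnion>\<^bsub>natural_order A\<^esub> S)) \<longleftrightarrow> (\<exists>a\<in>S. eval_point A v y (cls A a))"
    using Sup_commuting(1,2)[OF S] by (auto simp: eval_point_cls subset_iff)
qed (simp_all add: eval_point_cls domIff)

lemma basic_open_meet:
  "a \<in> carrier A \<Longrightarrow> b \<in> carrier A \<Longrightarrow> basic_open A (a \<curlywedge> b) = basic_open A a \<inter> basic_open A b"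
  by (auto simp: basic_open_def point_meet)

lemma basic_open_join:
  "a \<in> carrier A \<Longrightarrow> b \<in> carrier A \<Longrightarrow> basic_open A (a \<curlyvee> b) = basic_open A a \<union> basic_open A b"
  by (auto simp: basic_open_def point_join)

lemma basic_open_global:
  "g \<in> carrier A \<Longrightarrow> dom (v g) = topspace Y \<Longrightarrow> basic_open A g = points A"
  by (auto simp: basic_open_def point_top)

lemma openin_point_space: "openin (point_space A) V \<longleftrightarrow> (\<exists>a\<in>carrier A. V = basic_open A a)"
proof -
  have "istopology (\<lambda>V. \<exists>a\<in>carrier A. V = basic_open A a)"
    unfolding istopology_def
  proof (intro conjI allI impI)
    fix V W assume "\<exists>a\<in>carrier A. V = basic_open A a" "\<exists>a\<in>carrier A. W = basic_open A a"
    then show "\<exists>a\<in>carrier A. V \<inter> W = basic_open A a"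
      using basic_open_meet meet_in by metis
  next
    fix \<K> assume "\<forall>V\<in>\<K>. \<exists>a\<in>carrier A. V = basic_open A a"
    then obtain c where c: "\<And>V. V \<in> \<K> \<Longrightarrow> c V \<in> carrier A \<and> V = basic_open A (c V)"
      by metis
    have "openin Y (\<Union>a\<in>c ` \<K>. dom (v a))"
      using c openin_dom by blast
    then obtain u where u: "u \<in> carrier A" "dom (v u) = (\<Union>a\<in>c ` \<K>. dom (v a))"
      using open_is_dom by metis
    have "c ` \<K> \<subseteq> carrier A"
      using c by blast
    then have "basic_open A u = (\<Union>a\<in>c ` \<K>. basic_open A a)"
      using point_Union[OF _ _ u] by (auto simp: basic_open_def)
    also have "\<dots> = \<Union>\<K>"
      using c by auto
    finally show "\<exists>a\<in>carrier A. \<Union>\<K> = basic_open A a"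
      using u by blast
  qed
  then show ?thesis
    unfolding point_space_def by (simp add: topology_inverse')
qed

lemma openin_basic_open: "a \<in> carrier A \<Longrightarrow> openin (point_space A) (basic_open A a)"
  by (auto simp: openin_point_space)

lemma openin_front_basic_open: "a \<in> carrier A \<Longrightarrow> openin (front (point_space A)) (basic_open A a)"
  by (simp add: openin_basic_open openin_imp_openin_front)

lemma topspace_point_space [simp]: "topspace (point_space A) = points A"
proof
  show "topspace (point_space A) \<subseteq> points A"
    unfolding topspace_def by (auto simp: openin_point_space basic_open_def)
  obtain g where "g \<in> carrier A" "dom (v g) = topspace Y"
    using global by (elim bexE)
  then show "points A \<subseteq> topspace (point_space A)"
    using openin_basic_open[of g] basic_open_global[of g] openin_subset by metis
qed

abbreviation "point_front \<equiv> front (point_space A)"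

text \<open>
  Differences \<open>U\<^sub>d - U\<^sub>c\<close> form a basis of the front topology; these are the pairs \<open>c\<close>, \<open>d\<close> that occur in the
  definition of the germ relation.
\<close>

lemma front_point_nbhd:
  assumes "openin point_front Z" "p \<in> Z"
  obtains c d where "c \<in> carrier A" "d \<in> carrier A" "\<not> p (cls A c)" "p (cls A d)"
    "basic_open A d - basic_open A c \<subseteq> Z"
proof -
  obtain W where "locally_closed (point_space A) W" "p \<in> W" "W \<subseteq> Z"
    using assms unfolding openin_front_iff by blast
  then obtain c d where "c \<in> carrier A" "d \<in> carrier A" "W = basic_open A d - basic_open A c"
    unfolding locally_closed_iff_diff openin_point_space by blast
  with \<open>p \<in> W\<close> \<open>W \<subseteq> Z\<close> that show ?thesis
    by (auto simp: basic_open_def)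
qed

lemma eval_point_basic_open:
  "a \<in> carrier A \<Longrightarrow> y \<in> topspace Y \<Longrightarrow> eval_point A v y \<in> basic_open A a \<longleftrightarrow> y \<in> dom (v a)"
  by (simp add: basic_open_def eval_point_cls eval_point_in_points)

lemma preimage_eval_point:
  assumes "a \<in> carrier A"
  shows "preimage Y (eval_point A v) (basic_open A a) = dom (v a)"
  using eval_point_basic_open[OF assms] openin_subset[OF openin_dom[OF assms]] by blast

lemma continuous_eval_point: "continuous_map Y (point_space A) (eval_point A v)"
  unfolding continuous_map_def
  by (auto simp: openin_point_space preimage_eval_point openin_dom eval_point_in_points)


section \<open>Germs of elements at a point\<close>

text \<open>
  Meeting with \<open>d\<close> discards the values outside the domain of \<open>d\<close>, and joining with \<open>c\<close> overwrites those on the domain of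
  \<open>c\<close>. What is left of \<open>a\<close> is its restriction to the difference.
\<close>

lemma germ_rel_iff:
  "(a, b) \<in> germ_rel A p \<longleftrightarrow> a \<in> carrier A \<and> b \<in> carrier A \<and> p (cls A a) \<and> p (cls A b) \<and>
     (\<exists>c\<in>carrier A. \<exists>d\<in>carrier A. \<not> p (cls A c) \<and> p (cls A d) \<and>
        (\<forall>y\<in>dom (v d) - dom (v c). v a y = v b y))"
proof -
  have "(a \<curlywedge> d) \<curlyvee> c = (b \<curlywedge> d) \<curlyvee> c \<longleftrightarrow> (\<forall>y\<in>dom (v d) - dom (v c). v a y = v b y)" (is "?L \<longleftrightarrow> ?R")
    if abcd: "a \<in> carrier A" "b \<in> carrier A" "c \<in> carrier A" "d \<in> carrier A" for c d
  proof -
    have "?L \<longleftrightarrow> (v a |` dom (v d)) ++ v c = (v b |` dom (v d)) ++ v c"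
      using abcd by (simp add: val_eq_iff)
    also have "\<dots> \<longleftrightarrow> ?R"
    proof
      assume eq: "(v a |` dom (v d)) ++ v c = (v b |` dom (v d)) ++ v c"
      show ?R
      proof
        fix y assume "y \<in> dom (v d) - dom (v c)"
        then show "v a y = v b y"
          using fun_cong[OF eq, of y] by (simp add: map_add_dom_app_simps)
      qed
    next
      assume R: ?R
      show "(v a |` dom (v d)) ++ v c = (v b |` dom (v d)) ++ v c"
      proof
        fix y
        show "((v a |` dom (v d)) ++ v c) y = ((v b |` dom (v d)) ++ v c) y"
          using R by (cases "y \<in> dom (v c)"; cases "y \<in> dom (v d)") (auto simp: map_add_dom_app_simps)
      qed
    qed
    finally show ?thesis .
  qed
  then show ?thesis
    unfolding germ_rel_def by blast
qed

lemma equiv_germ_rel: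
  assumes p: "p \<in> points A"
  shows "equiv {a \<in> carrier A. p (cls A a)} (germ_rel A p)"
proof (rule equivI)
  show "germ_rel A p \<subseteq> {a \<in> carrier A. p (cls A a)} \<times> {a \<in> carrier A. p (cls A a)}"
    by (auto simp: germ_rel_iff)
  show "refl_on {a \<in> carrier A. p (cls A a)} (germ_rel A p)"
    using point_zero[OF p] by (auto simp: refl_on_def germ_rel_iff)
  show "sym (germ_rel A p)"
    by (rule symI) (unfold germ_rel_iff, metis)
  show "trans (germ_rel A p)"
  proof (rule transI)
    fix x y z assume "(x, y) \<in> germ_rel A p" "(y, z) \<in> germ_rel A p"
    then obtain c d c' d' where xyz: "x \<in> carrier A" "z \<in> carrier A" "p (cls A x)" "p (cls A z)"
      and cd: "c \<in> carrier A" "d \<in> carrier A" "\<not> p (cls A c)" "p (cls A d)"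
        "\<forall>t\<in>dom (v d) - dom (v c). v x t = v y t"
      and cd': "c' \<in> carrier A" "d' \<in> carrier A" "\<not> p (cls A c')" "p (cls A d')"
        "\<forall>t\<in>dom (v d') - dom (v c'). v y t = v z t"
      unfolding germ_rel_iff by metis
    have "\<forall>t\<in>dom (v (d \<curlywedge> d')) - dom (v (c \<curlyvee> c')). v x t = v z t"
      using cd cd' by simp
    moreover have "\<not> p (cls A (c \<curlyvee> c'))" "p (cls A (d \<curlywedge> d'))"
      using cd cd' p by (simp_all add: point_meet point_join)
    ultimately show "(x, z) \<in> germ_rel A p"
      unfolding germ_rel_iff using xyz cd cd' join_in meet_in by metis
  qed
qed

lemma germ_class_eq_iff:
  assumes "p \<in> basic_open A a" "p \<in> basic_open A b" "a \<in> carrier A" "b \<in> carrier A"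
  shows "germ_rel A p `` {a} = germ_rel A p `` {b} \<longleftrightarrow> (a, b) \<in> germ_rel A p"
  using assms by (intro eq_equiv_class_iff[OF equiv_germ_rel]) (auto simp: basic_open_def)

lemma basic_section_apply: "p \<in> basic_open A a \<Longrightarrow> basic_section A a p = (p, germ_rel A p `` {a})"
  by (simp add: basic_section_def)

lemma basic_section_eq_iff:
  assumes "p \<in> basic_open A a" "p \<in> basic_open A b" "a \<in> carrier A" "b \<in> carrier A"
  shows "basic_section A a p = basic_section A b p \<longleftrightarrow> (a, b) \<in> germ_rel A p"
  using assms germ_class_eq_iff by (simp add: basic_section_apply)

lemma fst_basic_section: "p \<in> basic_open A a \<Longrightarrow> fst (basic_section A a p) = p"
  by (simp add: basic_section_def)

lemma germ_rel_if_agree: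
  assumes "p \<in> points A" "a \<in> carrier A" "b \<in> carrier A" "c \<in> carrier A" "d \<in> carrier A"
    "p (cls A a)" "p (cls A b)" "\<not> p (cls A c)" "p (cls A d)"
    "\<And>y. y \<in> dom (v d) \<Longrightarrow> y \<notin> dom (v c) \<Longrightarrow> v a y = v b y"
  shows "(a, b) \<in> germ_rel A p"
  using assms unfolding germ_rel_iff by blast

text \<open>
  The witnesses \<open>c\<close>, \<open>d\<close> for \<open>p\<close> serve all points of \<open>U\<^sub>d - U\<^sub>c\<close>. This is why the sections \<open>s\<^sub>a\<close> are
  continuous.
\<close>

lemma germ_rel_open:
  assumes p: "p \<in> points A" and ab: "(a, b) \<in> germ_rel A p"
  obtains Z where "openin point_front Z" "p \<in> Z" "Z \<subseteq> basic_open A a \<inter> basic_open A b"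
    "\<And>q. q \<in> Z \<Longrightarrow> (a, b) \<in> germ_rel A q"
proof -
  obtain c d where *: "a \<in> carrier A" "b \<in> carrier A" "p (cls A a)" "p (cls A b)"
      "c \<in> carrier A" "d \<in> carrier A" "\<not> p (cls A c)" "p (cls A d)"
      "\<forall>y\<in>dom (v d) - dom (v c). v a y = v b y"
    using ab unfolding germ_rel_iff by metis
  let ?Z = "(basic_open A d - basic_open A c) \<inter> basic_open A a \<inter> basic_open A b"
  show thesis
  proof (rule that)
    show "openin point_front ?Z"
      using * by (intro openin_Int openin_front_diff openin_front_basic_open openin_basic_open)
    show "(a, b) \<in> germ_rel A q" if "q \<in> ?Z" for q
      using * that by (intro germ_rel_if_agree[of q a b c d]) (auto simp: basic_open_def)
  qed (use p * in \<open>auto simp: basic_open_def\<close>)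
qed

lemma germ_rel_eval_point:
  assumes y: "y \<in> topspace Y" and ab: "(a, b) \<in> germ_rel A (eval_point A v y)"
  shows "v a y = v b y"
  using ab unfolding germ_rel_iff by (auto simp: eval_point_cls)

section \<open>The sheaf of germs\<close>

abbreviation "G_sections \<equiv> sections (snd (G_obj A))"

lemma G_restr [simp]: "restr (snd (G_obj A)) U V = (\<lambda>\<sigma>. restrict \<sigma> V)"
  by (simp add: G_obj_def sheaf_of_sections_def)

lemma fst_G_obj [simp]: "fst (G_obj A) = point_space A"
  by (simp add: G_obj_def)

definition locally_basic :: "'a point set \<Rightarrow> ('a point \<Rightarrow> 'a point \<times> 'a set) \<Rightarrow> bool" where
  "locally_basic V \<sigma> \<longleftrightarrow> (\<forall>p\<in>V. \<exists>a\<in>carrier A. \<exists>Z. openin point_front Z \<and> p \<in> Z \<and>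
     Z \<subseteq> V \<inter> basic_open A a \<and> (\<forall>q\<in>Z. \<sigma> q = basic_section A a q))"

lemma locally_basicE:
  assumes "locally_basic V \<sigma>" "p \<in> V"
  obtains a Z where "a \<in> carrier A" "openin point_front Z" "p \<in> Z" "Z \<subseteq> V"
    "Z \<subseteq> basic_open A a" "\<And>q. q \<in> Z \<Longrightarrow> \<sigma> q = basic_section A a q"
  using assms unfolding locally_basic_def by (metis le_inf_iff)

text \<open>
  A continuous section that takes the germ of \<open>a\<close> at one point is equal to \<open>s\<^sub>a\<close> on the preimage of the open
  set \<open>s\<^sub>a(U\<^sub>a)\<close>. Conversely the \<open>s\<^sub>a\<close> are continuous by \<open>germ_rel_open\<close>.
\<close>

lemma G_sections_iff:
  assumes V: "openin point_front V"
  shows "\<sigma> \<in> G_sections V \<longleftrightarrow> \<sigma> \<in> extensional V \<and> locally_basic V \<sigma>"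
proof -
  let ?T = "point_front"
  let ?gen = "{basic_section A a ` Z | a Z. a \<in> carrier A \<and> Z \<subseteq> basic_open A a \<and>
        locally_closed (point_space A) Z}"
  have top: "topspace (subtopology ?T V) = V"
    using openin_subset[OF V] by auto
  have sec: "\<sigma> \<in> G_sections V \<longleftrightarrow> \<sigma> \<in> extensional V \<and>
      continuous_map (subtopology ?T V) (germ_space A) \<sigma> \<and> (\<forall>p\<in>V. fst (\<sigma> p) = p)"
    by (simp add: G_obj_def sheaf_of_sections_def)
  have "continuous_map (subtopology ?T V) (germ_space A) \<sigma> \<and> (\<forall>p\<in>V. fst (\<sigma> p) = p) \<longleftrightarrow>
      locally_basic V \<sigma>" (is "?cont \<and> ?sect \<longleftrightarrow> _")
  proof
    assume L: "?cont \<and> ?sect"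
    have img: "\<sigma> ` V \<subseteq> \<Union>?gen"
      and pre: "\<And>B. B \<in> ?gen \<Longrightarrow> openin (subtopology ?T V) (\<sigma> -` B \<inter> V)"
      using L unfolding germ_space_def continuous_on_generated_topo_iff top by blast+
    show "locally_basic V \<sigma>"
      unfolding locally_basic_def
    proof
      fix p assume p: "p \<in> V"
      have "\<sigma> p \<in> \<Union>?gen"
        by (rule subsetD[OF img imageI[OF p]])
      then obtain B where B: "B \<in> ?gen" "\<sigma> p \<in> B"
        by (rule UnionE)
      from B(1) obtain a Z where "B = basic_section A a ` Z" "a \<in> carrier A" "Z \<subseteq> basic_open A a"
        unfolding mem_Collect_eq by (elim exE conjE)
      with B(2) have aZ: "a \<in> carrier A" "Z \<subseteq> basic_open A a" "\<sigma> p \<in> basic_section A a ` Z"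
        by simp_all
      define W where "W = \<sigma> -` (basic_section A a ` basic_open A a) \<inter> V"
      have "locally_closed (point_space A) (basic_open A a)"
        using locally_closed_diff[of "point_space A" "basic_open A a" "{}"] aZ openin_basic_open
        by simp
      then have "openin (subtopology ?T V) W"
        unfolding W_def using aZ by (intro pre) blast
      then have W: "openin ?T W"
        using V openin_open_subtopology by blast
      have "p \<in> W"
        using p aZ by (auto simp: W_def)
      have eq: "q \<in> basic_open A a \<and> \<sigma> q = basic_section A a q" if q: "q \<in> W" for q
      proof -
        have "q \<in> V"
          using q by (simp add: W_def)
        then have "fst (\<sigma> q) = q"
          using L by blast
        moreover obtain q' where q': "q' \<in> basic_open A a" "\<sigma> q = basic_section A a q'"
          using q by (auto simp: W_def)
        ultimately show ?thesis
          using fst_basic_section[OF q'(1)] by simp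
      qed
      have "W \<subseteq> V"
        unfolding W_def by (rule Int_lower2)
      then have "W \<subseteq> V \<inter> basic_open A a"
        using eq by blast
      then show "\<exists>a\<in>carrier A. \<exists>Z. openin ?T Z \<and> p \<in> Z \<and> Z \<subseteq> V \<inter> basic_open A a \<and>
          (\<forall>q\<in>Z. \<sigma> q = basic_section A a q)"
        using aZ(1) W \<open>p \<in> W\<close> eq by metis
    qed
  next
    assume loc: "locally_basic V \<sigma>"
    have ?sect
    proof
      fix p assume "p \<in> V"
      with loc obtain a Z where "p \<in> Z" "Z \<subseteq> basic_open A a" "\<And>q. q \<in> Z \<Longrightarrow> \<sigma> q = basic_section A a q"
        by (rule locally_basicE) metis
      then show "fst (\<sigma> p) = p"
        by (auto simp: fst_basic_section)
    qed
    moreover have ?cont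
      unfolding germ_space_def continuous_on_generated_topo_iff top
    proof (intro conjI allI impI)
      fix B assume "B \<in> ?gen"
      then obtain b Z' where b: "b \<in> carrier A" "Z' \<subseteq> basic_open A b"
        "locally_closed (point_space A) Z'" "B = basic_section A b ` Z'"
        unfolding mem_Collect_eq by (elim exE conjE)
      have "openin ?T (\<sigma> -` B \<inter> V)"
        unfolding openin_subopen[of ?T "\<sigma> -` B \<inter> V"]
      proof
        fix p assume p: "p \<in> \<sigma> -` B \<inter> V"
        then have "p \<in> V"
          by blast
        with loc obtain a Z where a: "a \<in> carrier A" "openin ?T Z" "p \<in> Z" "Z \<subseteq> V"
          "Z \<subseteq> basic_open A a" "\<And>q. q \<in> Z \<Longrightarrow> \<sigma> q = basic_section A a q"
          by (rule locally_basicE) metis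
        obtain q where q: "q \<in> Z'" "\<sigma> p = basic_section A b q"
          using p b by auto
        have "fst (\<sigma> p) = p"
          using \<open>?sect\<close> \<open>p \<in> V\<close> by blast
        then have "q = p"
          using q b fst_basic_section[of q b] by auto
        have "basic_section A a p = basic_section A b p"
          using a(6)[OF a(3)] q \<open>q = p\<close> by simp
        then have ab: "(a, b) \<in> germ_rel A p"
          using a b q \<open>q = p\<close> by (subst (asm) basic_section_eq_iff) auto
        have "p \<in> points A"
          using a by (auto simp: basic_open_def)
        then obtain W where W: "openin ?T W" "p \<in> W" "W \<subseteq> basic_open A a \<inter> basic_open A b"
          "\<And>q. q \<in> W \<Longrightarrow> (a, b) \<in> germ_rel A q"
          using ab by (rule germ_rel_open) metis
        have "openin ?T (Z \<inter> W \<inter> Z')"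
          using a(2) W(1) locally_closed_imp_openin_front[OF b(3)] by (intro openin_Int)
        moreover have "Z \<inter> W \<inter> Z' \<subseteq> \<sigma> -` B \<inter> V"
        proof
          fix r assume r: "r \<in> Z \<inter> W \<inter> Z'"
          then have "basic_section A a r = basic_section A b r"
            using W(3) W(4)[of r] a b by (subst basic_section_eq_iff) auto
          then show "r \<in> \<sigma> -` B \<inter> V"
            using r a b by auto
        qed
        moreover have "p \<in> Z \<inter> W \<inter> Z'"
          using a W q \<open>q = p\<close> by blast
        ultimately show "\<exists>W. openin ?T W \<and> p \<in> W \<and> W \<subseteq> \<sigma> -` B \<inter> V"
          by blast
      qed
      then show "openin (subtopology ?T V) (\<sigma> -` B \<inter> V)"
        using V by (simp add: openin_open_subtopology)
    next
      show "\<sigma> ` V \<subseteq> \<Union>?gen"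
      proof
        fix e assume "e \<in> \<sigma> ` V"
        then obtain p where p: "p \<in> V" "e = \<sigma> p"
          by blast
        from loc p(1) obtain a Z where a: "a \<in> carrier A" "p \<in> Z" "Z \<subseteq> basic_open A a"
          "\<And>q. q \<in> Z \<Longrightarrow> \<sigma> q = basic_section A a q"
          by (rule locally_basicE) metis
        have "locally_closed (point_space A) (basic_open A a)"
          using locally_closed_diff[of "point_space A" "basic_open A a" "{}"] a openin_basic_open
          by simp
        then have "basic_section A a ` basic_open A a \<in> ?gen"
          using a(1) by blast
        moreover have "e \<in> basic_section A a ` basic_open A a"
          using a(2,3) a(4)[OF a(2)] p(2) by blast
        ultimately show "e \<in> \<Union>?gen"
          by (rule UnionI)
      qed
    qed
    ultimately show "?cont \<and> ?sect"
      by blast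
  qed
  then show ?thesis
    unfolding sec by blast
qed

lemma basic_section_in_G: "a \<in> carrier A \<Longrightarrow> basic_section A a \<in> G_sections (basic_open A a)"
  using openin_front_basic_open[of a]
  by (subst G_sections_iff) (auto simp: locally_basic_def basic_section_def)

lemma locally_basic_cong:
  "(\<And>p. p \<in> V \<Longrightarrow> \<sigma> p = \<tau> p) \<Longrightarrow> locally_basic V \<sigma> = locally_basic V \<tau>"
  unfolding locally_basic_def by (intro ball_cong bex_cong refl ex_cong conj_cong) auto

lemma locally_basic_subset:
  assumes "locally_basic V \<sigma>" "openin point_front W" "W \<subseteq> V"
  shows "locally_basic W \<sigma>"
  unfolding locally_basic_def
proof
  fix p assume "p \<in> W"
  with assms have "p \<in> V"
    by blast
  with assms(1) obtain a Z where a: "a \<in> carrier A" "openin point_front Z" "p \<in> Z"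
    "Z \<subseteq> V" "Z \<subseteq> basic_open A a" "\<And>q. q \<in> Z \<Longrightarrow> \<sigma> q = basic_section A a q"
    by (rule locally_basicE) metis
  then show "\<exists>a\<in>carrier A. \<exists>Z. openin point_front Z \<and> p \<in> Z \<and> Z \<subseteq> W \<inter> basic_open A a \<and>
      (\<forall>q\<in>Z. \<sigma> q = basic_section A a q)"
    using assms(2) \<open>p \<in> W\<close> by (intro bexI[of _ a] exI[of _ "Z \<inter> W"]) auto
qed

lemma locally_basic_Union:
  assumes "\<And>V. V \<in> \<V> \<Longrightarrow> locally_basic V \<sigma>"
  shows "locally_basic (\<Union>\<V>) \<sigma>"
  unfolding locally_basic_def
proof
  fix p assume "p \<in> \<Union>\<V>"
  then obtain V where V: "V \<in> \<V>" "p \<in> V"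
    by blast
  with assms obtain a Z where a: "a \<in> carrier A" "openin point_front Z" "p \<in> Z"
    "Z \<subseteq> V" "Z \<subseteq> basic_open A a" "\<And>q. q \<in> Z \<Longrightarrow> \<sigma> q = basic_section A a q"
    by (meson locally_basicE)
  then show "\<exists>a\<in>carrier A. \<exists>Z. openin point_front Z \<and> p \<in> Z \<and>
      Z \<subseteq> \<Union>\<V> \<inter> basic_open A a \<and> (\<forall>q\<in>Z. \<sigma> q = basic_section A a q)"
    using V by (intro bexI[of _ a] exI[of _ Z]) auto
qed

lemma G_is_sheaf: "is_sheaf point_front (snd (G_obj A))"
  unfolding is_sheaf_def
proof (intro conjI allI impI)
  let ?T = "point_front"
  show "is_presheaf ?T (snd (G_obj A))"
    unfolding is_presheaf_def
  proof (intro conjI allI impI ballI)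
    fix U V assume UV: "openin ?T U \<and> openin ?T V \<and> V \<subseteq> U"
    show "restr (snd (G_obj A)) U V \<in> G_sections U \<rightarrow> G_sections V"
    proof
      fix \<sigma> assume "\<sigma> \<in> G_sections U"
      then have "locally_basic V \<sigma>"
        using UV locally_basic_subset by (metis G_sections_iff)
      then have "locally_basic V (restrict \<sigma> V)"
        by (subst locally_basic_cong[of V _ \<sigma>]) simp_all
      then show "restr (snd (G_obj A)) U V \<sigma> \<in> G_sections V"
        using UV by (simp add: G_sections_iff)
    qed
  next
    fix U \<sigma> assume "openin ?T U" "\<sigma> \<in> G_sections U"
    then show "restr (snd (G_obj A)) U U \<sigma> = \<sigma>"
      by (simp add: G_sections_iff extensional_restrict)
  next
    fix U V W \<sigma> assume "openin ?T U \<and> openin ?T V \<and> openin ?T W \<and> W \<subseteq> V \<and> V \<subseteq> U"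
    then show "restr (snd (G_obj A)) V W (restr (snd (G_obj A)) U V \<sigma>) = restr (snd (G_obj A)) U W \<sigma>"
      by (simp add: restrict_restrict Int_absorb1)
  qed
  fix \<U> s
  assume "(\<forall>U\<in>\<U>. openin ?T U \<and> s U \<in> G_sections U) \<and>
    (\<forall>U\<in>\<U>. \<forall>V\<in>\<U>. restr (snd (G_obj A)) U (U \<inter> V) (s U) = restr (snd (G_obj A)) V (U \<inter> V) (s V))"
  then have op: "\<And>U. U \<in> \<U> \<Longrightarrow> openin ?T U" and s: "\<And>U. U \<in> \<U> \<Longrightarrow> s U \<in> G_sections U"
    and compat: "\<And>U V. U \<in> \<U> \<Longrightarrow> V \<in> \<U> \<Longrightarrow> restrict (s U) (U \<inter> V) = restrict (s V) (U \<inter> V)"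
    by simp_all metis
  have opU: "openin ?T (\<Union>\<U>)"
    using op by blast
  define t where "t = (\<lambda>p\<in>\<Union>\<U>. s (SOME U. U \<in> \<U> \<and> p \<in> U) p)"
  have t: "t p = s U p" if "U \<in> \<U>" "p \<in> U" for U p
  proof -
    define V where "V = (SOME U. U \<in> \<U> \<and> p \<in> U)"
    have V: "V \<in> \<U> \<and> p \<in> V"
      unfolding V_def by (rule someI[of _ U]) (use that in simp)
    have "t p = s V p"
      using that by (auto simp: t_def V_def)
    also have "\<dots> = s U p"
      using fun_cong[OF compat[of V U], of p] V that by simp
    finally show ?thesis .
  qed
  show "\<exists>!t. t \<in> G_sections (\<Union>\<U>) \<and> (\<forall>U\<in>\<U>. restr (snd (G_obj A)) (\<Union>\<U>) U t = s U)"
  proof (rule ex1I[of _ t], intro conjI ballI)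
    have "locally_basic U t" if "U \<in> \<U>" for U
      using s[OF that] op[OF that] locally_basic_cong[of U t "s U"] t that by (simp add: G_sections_iff)
    then have "locally_basic (\<Union>\<U>) t"
      by (rule locally_basic_Union)
    then show "t \<in> G_sections (\<Union>\<U>)"
      using opU by (simp add: G_sections_iff t_def)
    fix U assume U: "U \<in> \<U>"
    then have "s U \<in> extensional U"
      using s op by (simp add: G_sections_iff)
    then show "restr (snd (G_obj A)) (\<Union>\<U>) U t = s U"
      using t[OF U] by (simp add: fun_eq_iff restrict_def extensional_def)
  next
    fix t' assume t': "t' \<in> G_sections (\<Union>\<U>) \<and> (\<forall>U\<in>\<U>. restr (snd (G_obj A)) (\<Union>\<U>) U t' = s U)"
    show "t' = t"
    proof (rule extensionalityI)
      show "t' \<in> extensional (\<Union>\<U>)" "t \<in> extensional (\<Union>\<U>)"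
        using t' opU by (simp_all add: G_sections_iff t_def)
      fix p assume "p \<in> \<Union>\<U>"
      then obtain U where U: "U \<in> \<U>" "p \<in> U"
        by blast
      then have "restrict t' U = s U"
        using t' by simp
      then have "t' p = s U p"
        using U by (metis restrict_apply')
      then show "t' p = t p"
        using t U by simp
    qed
  qed
qed

lemma Sh_obj_G: "Sh_obj (G_obj A)"
proof -
  obtain g where "g \<in> carrier A" "dom (v g) = topspace Y"
    using global by (elim bexE)
  then have "basic_section A g \<in> G_sections (points A)"
    using basic_section_in_G[of g] by (simp add: basic_open_global)
  then show ?thesis
    using G_is_sheaf by (auto simp: Sh_obj_def)
qed

end

section \<open>Sheaf morphisms out of the sheaf of germs\<close>

context section_algebra
begin

lemma sheaf_hom_from_G_restr:
  assumes l: "l \<in> sheaf_hom point_front (snd (G_obj A)) (direct_image Y' f F)"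
    and V: "openin point_front V" "\<sigma> \<in> G_sections V"
    and Z: "openin point_front Z" "Z \<subseteq> V" "Z \<subseteq> basic_open A a" "a \<in> carrier A"
    and eq: "\<And>q. q \<in> Z \<Longrightarrow> \<sigma> q = basic_section A a q"
  shows "restr F (preimage Y' f V) (preimage Y' f Z) (l V \<sigma>) =
    restr F (preimage Y' f (basic_open A a)) (preimage Y' f Z) (l (basic_open A a) (basic_section A a))"
proof -
  have nat: "restr F (preimage Y' f U) (preimage Y' f Z) (l U \<tau>) = l Z (restrict \<tau> Z)"
    if "openin point_front U" "Z \<subseteq> U" "\<tau> \<in> G_sections U" for U \<tau>
    using l that Z(1) by (simp add: sheaf_hom_def direct_image_def)
  have "restrict \<sigma> Z = restrict (basic_section A a) Z"
    using eq by (intro restrict_ext)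
  then show ?thesis
    using nat[OF V(1) Z(2) V(2)] nat[OF openin_front_basic_open Z(3) basic_section_in_G] Z(4) by simp
qed

text \<open>
  A section over \<open>V\<close> is locally a restriction of some \<open>s\<^sub>a\<close>, and morphisms commute with restriction.
\<close>

lemma sheaf_hom_from_G_eqI:
  assumes F: "is_sheaf (front Y') F" and f: "continuous_map Y' (point_space A) f"
    and l: "l \<in> sheaf_hom point_front (snd (G_obj A)) (direct_image Y' f F)"
    and l': "l' \<in> sheaf_hom point_front (snd (G_obj A)) (direct_image Y' f F)"
    and eq: "\<And>a. a \<in> carrier A \<Longrightarrow>
      l (basic_open A a) (basic_section A a) = l' (basic_open A a) (basic_section A a)"
  shows "l = l'"
proof (rule extensionalityI)
  interpret F: sheaf_on "front Y'" F
    using F by unfold_locales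
  let ?T = "point_front"
  show "l \<in> extensional {V. openin ?T V}" "l' \<in> extensional {V. openin ?T V}"
    using l l' by (simp_all add: sheaf_hom_def PiE_def)
  fix V assume "V \<in> {V. openin ?T V}"
  then have V: "openin ?T V"
    by simp
  have lV: "l V \<in> G_sections V \<rightarrow>\<^sub>E sections F (preimage Y' f V)"
    "l' V \<in> G_sections V \<rightarrow>\<^sub>E sections F (preimage Y' f V)"
    using l l' V by (auto simp: sheaf_hom_def direct_image_def)
  show "l V = l' V"
  proof (rule extensionalityI)
    show "l V \<in> extensional (G_sections V)" "l' V \<in> extensional (G_sections V)"
      using lV by (simp_all add: PiE_def)
    fix \<sigma> assume \<sigma>: "\<sigma> \<in> G_sections V"
    show "l V \<sigma> = l' V \<sigma>"
    proof (rule F.section_eqI)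
      show "l V \<sigma> \<in> sections F (preimage Y' f V)" "l' V \<sigma> \<in> sections F (preimage Y' f V)"
        using lV \<sigma> by (auto simp: PiE_iff)
      fix y assume y: "y \<in> preimage Y' f V"
      have "locally_basic V \<sigma>" "f y \<in> V"
        using \<sigma> V y by (simp_all add: G_sections_iff)
      then obtain a Z where a: "a \<in> carrier A" "openin ?T Z" "f y \<in> Z" "Z \<subseteq> V"
          "Z \<subseteq> basic_open A a" "\<And>q. q \<in> Z \<Longrightarrow> \<sigma> q = basic_section A a q"
        by (rule locally_basicE) metis
      have "restr F (preimage Y' f V) (preimage Y' f Z) (l V \<sigma>) =
          restr F (preimage Y' f V) (preimage Y' f Z) (l' V \<sigma>)"
        using sheaf_hom_from_G_restr[OF l V \<sigma> a(2,4,5,1,6)]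
          sheaf_hom_from_G_restr[OF l' V \<sigma> a(2,4,5,1,6)] eq[OF a(1)] by simp
      moreover have "openin (front Y') (preimage Y' f Z)"
        using f a(2) by (rule openin_front_preimage)
      ultimately show "\<exists>W. openin (front Y') W \<and> y \<in> W \<and> W \<subseteq> preimage Y' f V \<and>
          restr F (preimage Y' f V) W (l V \<sigma>) = restr F (preimage Y' f V) W (l' V \<sigma>)"
        using a(3,4) y by (intro exI[of _ "preimage Y' f Z"]) auto
    qed
  qed
qed

text \<open>
  The image of \<open>\<sigma>\<close> is prescribed germ by germ: at \<open>y\<close> it has the germ of \<open>\<mu> a\<close>, where \<open>a\<close> represents \<open>\<sigma>(f y)\<close>.
  Compatibility of \<open>\<mu>\<close> with the germ relation makes this independent of \<open>a\<close>, and since \<open>\<sigma>\<close> is locally some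
  \<open>s\<^sub>a\<close> the prescribed germs are locally those of a section \<open>\<mu> a\<close>.
\<close>

theorem sheaf_hom_from_G_exists:
  assumes F: "is_sheaf (front Y') F" and f: "continuous_map Y' (point_space A) f"
    and \<mu>: "\<And>a. a \<in> carrier A \<Longrightarrow> \<mu> a \<in> sections F (preimage Y' f (basic_open A a))"
    and compat: "\<And>a b y. a \<in> carrier A \<Longrightarrow> b \<in> carrier A \<Longrightarrow> y \<in> topspace Y' \<Longrightarrow>
      (a, b) \<in> germ_rel A (f y) \<Longrightarrow>
      germ (front Y') F (preimage Y' f (basic_open A a)) (\<mu> a) y =
      germ (front Y') F (preimage Y' f (basic_open A b)) (\<mu> b) y"
  shows "\<exists>l. l \<in> sheaf_hom point_front (snd (G_obj A)) (direct_image Y' f F) \<and>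
    (\<forall>a\<in>carrier A. l (basic_open A a) (basic_section A a) = \<mu> a)"
proof -
  interpret F: sheaf_on "front Y'" F
    using F by unfold_locales
  let ?T = "point_front"
  let ?pre = "preimage Y' f"
  define \<mu>germ where "\<mu>germ a y = germ (front Y') F (?pre (basic_open A a)) (\<mu> a) y" for a y
  define rep where "rep \<sigma> a y \<longleftrightarrow> a \<in> carrier A \<and> f y \<in> basic_open A a \<and> \<sigma> (f y) = basic_section A a (f y)"
    for \<sigma> a y
  \<comment> \<open>The value at \<open>\<sigma>\<close> is the section with the germ of \<open>\<mu> a\<close> wherever \<open>\<sigma>\<close> has the germ of \<open>a\<close>.\<close>
  define val where "val V \<sigma> t \<longleftrightarrow> t \<in> sections F (?pre V) \<and>
    (\<forall>y\<in>?pre V. \<forall>a. rep \<sigma> a y \<longrightarrow> germ (front Y') F (?pre V) t y = \<mu>germ a y)" for V \<sigma> t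
  have pre_open: "openin (front Y') (?pre V)" if "openin ?T V" for V
    using f that by (rule openin_front_preimage)
  have rep_unique: "\<mu>germ a y = \<mu>germ b y" if "rep \<sigma> a y" "rep \<sigma> b y" "y \<in> topspace Y'" for \<sigma> a b y
  proof -
    have "(a, b) \<in> germ_rel A (f y)"
      using that basic_section_eq_iff[of "f y" a b] by (simp add: rep_def)
    then show ?thesis
      unfolding \<mu>germ_def using that by (intro compat) (simp_all add: rep_def)
  qed
  have local: "\<exists>a Z. openin ?T Z \<and> f y \<in> Z \<and> Z \<subseteq> V \<and> Z \<subseteq> basic_open A a \<and> a \<in> carrier A \<and>
      (\<forall>z. f z \<in> Z \<longrightarrow> rep \<sigma> a z)" if "openin ?T V" "\<sigma> \<in> G_sections V" "y \<in> ?pre V" for V \<sigma> y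
  proof -
    have "locally_basic V \<sigma>" "f y \<in> V"
      using that by (simp_all add: G_sections_iff)
    then obtain a Z where "a \<in> carrier A" "openin ?T Z" "f y \<in> Z" "Z \<subseteq> V"
        "Z \<subseteq> basic_open A a" "\<And>q. q \<in> Z \<Longrightarrow> \<sigma> q = basic_section A a q"
      by (rule locally_basicE) metis
    then show ?thesis
      unfolding rep_def by (intro exI[of _ a] exI[of _ Z]) auto
  qed
  have ex_val: "\<exists>t. val V \<sigma> t" if V: "openin ?T V" and \<sigma>: "\<sigma> \<in> G_sections V" for V \<sigma>
  proof -
    have "\<exists>t\<in>sections F (?pre V). \<forall>y\<in>?pre V.
        germ (front Y') F (?pre V) t y = \<mu>germ (SOME a. rep \<sigma> a y) y"
    proof (rule F.glue_germs)
      fix y assume y: "y \<in> ?pre V"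
      from local[OF V \<sigma> y] obtain a Z where a: "openin ?T Z" "f y \<in> Z" "Z \<subseteq> V"
        "Z \<subseteq> basic_open A a" "a \<in> carrier A" "\<And>z. f z \<in> Z \<Longrightarrow> rep \<sigma> a z"
        by metis
      have sub: "?pre Z \<subseteq> ?pre (basic_open A a)"
        using a(4) by blast
      have op: "openin (front Y') (?pre Z)" "openin (front Y') (?pre (basic_open A a))"
        using a pre_open openin_front_basic_open by auto
      let ?s = "restr F (?pre (basic_open A a)) (?pre Z) (\<mu> a)"
      have "\<forall>z\<in>?pre Z. germ (front Y') F (?pre Z) ?s z = \<mu>germ (SOME a. rep \<sigma> a z) z"
      proof
        fix z assume z: "z \<in> ?pre Z"
        have "rep \<sigma> a z"
          using a(6) z by simp
        then have "\<mu>germ (SOME a. rep \<sigma> a z) z = \<mu>germ a z"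
          using z by (intro rep_unique[of \<sigma>] someI[of "\<lambda>a. rep \<sigma> a z"]) auto
        also have "\<dots> = germ (front Y') F (?pre Z) ?s z"
          unfolding \<mu>germ_def using op sub \<mu> a(5) z by (intro F.germ_restr[symmetric])
        finally show "germ (front Y') F (?pre Z) ?s z = \<mu>germ (SOME a. rep \<sigma> a z) z"
          by simp
      qed
      moreover have "?s \<in> sections F (?pre Z)"
        using op sub \<mu> a(5) by (intro F.restr_closed)
      moreover have "y \<in> ?pre Z" "?pre Z \<subseteq> ?pre V"
        using y a by auto
      ultimately show "\<exists>Z s. openin (front Y') Z \<and> y \<in> Z \<and> Z \<subseteq> ?pre V \<and> s \<in> sections F Z \<and>
          (\<forall>z\<in>Z. germ (front Y') F Z s z = \<mu>germ (SOME a. rep \<sigma> a z) z)"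
        using op(1) by (intro exI[of _ "?pre Z"] exI[of _ ?s] conjI)
    qed
    then obtain t where t: "t \<in> sections F (?pre V)"
        "\<forall>y\<in>?pre V. germ (front Y') F (?pre V) t y = \<mu>germ (SOME a. rep \<sigma> a y) y"
      by (elim bexE)
    have "germ (front Y') F (?pre V) t y = \<mu>germ a y" if y: "y \<in> ?pre V" and a: "rep \<sigma> a y" for y a
    proof -
      have "rep \<sigma> (SOME a. rep \<sigma> a y) y"
        using a by (rule someI)
      then show ?thesis
        using bspec[OF t(2) y] rep_unique[OF _ a] y by simp
    qed
    then have "val V \<sigma> t"
      unfolding val_def using t(1) by (intro conjI ballI allI impI)
    then show ?thesis
      by (rule exI)
  qed
  have val_unique: "t = t'" if V: "openin ?T V" and \<sigma>: "\<sigma> \<in> G_sections V"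
    and t: "val V \<sigma> t" and t': "val V \<sigma> t'" for V \<sigma> t t'
  proof (rule F.germ_ext)
    show "openin (front Y') (?pre V)"
      using V by (rule pre_open)
    show "t \<in> sections F (?pre V)" "t' \<in> sections F (?pre V)"
      using t t' by (simp_all add: val_def)
    fix y assume y: "y \<in> ?pre V"
    from local[OF V \<sigma> y] obtain a where "rep \<sigma> a y"
      by metis
    then show "germ (front Y') F (?pre V) t y = germ (front Y') F (?pre V) t' y"
      using t t' y by (simp add: val_def)
  qed
  define l where "l = (\<lambda>V\<in>{V. openin ?T V}. \<lambda>\<sigma>\<in>G_sections V. SOME t. val V \<sigma> t)"
  have l: "val V \<sigma> (l V \<sigma>)" if "openin ?T V" "\<sigma> \<in> G_sections V" for V \<sigma>
    using someI_ex[OF ex_val[OF that]] that by (simp add: l_def)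
  have "l \<in> sheaf_hom ?T (snd (G_obj A)) (direct_image Y' f F)"
    unfolding sheaf_hom_def mem_Collect_eq
  proof (intro conjI allI impI ballI)
    show "l \<in> (\<Pi>\<^sub>E V\<in>{V. openin ?T V}. G_sections V \<rightarrow>\<^sub>E sections (direct_image Y' f F) V)"
    proof (rule PiE_I)
      fix V assume V: "V \<in> {V. openin ?T V}"
      show "l V \<in> G_sections V \<rightarrow>\<^sub>E sections (direct_image Y' f F) V"
      proof (rule PiE_I)
        show "l V \<sigma> \<in> sections (direct_image Y' f F) V" if "\<sigma> \<in> G_sections V" for \<sigma>
          using l[of V \<sigma>] V that by (simp add: val_def direct_image_def)
      qed (use V in \<open>simp add: l_def\<close>)
    qed (simp add: l_def)
  next
    fix U V \<sigma> assume UV: "openin ?T U \<and> openin ?T V \<and> V \<subseteq> U" and \<sigma>: "\<sigma> \<in> G_sections U"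
    have sub: "?pre V \<subseteq> ?pre U" and op: "openin (front Y') (?pre U)" "openin (front Y') (?pre V)"
      using UV pre_open by auto
    have \<sigma>V: "restrict \<sigma> V \<in> G_sections V"
      using UV \<sigma> sheaf_on.restr_closed[OF sheaf_on.intro[OF G_is_sheaf], of U V \<sigma>] by simp
    have tU: "l U \<sigma> \<in> sections F (?pre U)"
      using l[of U \<sigma>] UV \<sigma> by (simp add: val_def)
    have "val V (restrict \<sigma> V) (restr F (?pre U) (?pre V) (l U \<sigma>))"
      unfolding val_def
    proof (intro conjI ballI allI impI)
      show "restr F (?pre U) (?pre V) (l U \<sigma>) \<in> sections F (?pre V)"
        using op sub tU by (intro F.restr_closed)
      fix y a assume y: "y \<in> ?pre V" and a: "rep (restrict \<sigma> V) a y"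
      have "germ (front Y') F (?pre V) (restr F (?pre U) (?pre V) (l U \<sigma>)) y =
          germ (front Y') F (?pre U) (l U \<sigma>) y"
        using op sub tU y by (intro F.germ_restr)
      also have "\<dots> = \<mu>germ a y"
        using l[of U \<sigma>] UV \<sigma> y a by (auto simp: val_def rep_def)
      finally show "germ (front Y') F (?pre V) (restr F (?pre U) (?pre V) (l U \<sigma>)) y = \<mu>germ a y" .
    qed
    then have "restr F (?pre U) (?pre V) (l U \<sigma>) = l V (restrict \<sigma> V)"
      using UV \<sigma>V l by (intro val_unique[of V "restrict \<sigma> V"]) auto
    then show "restr (direct_image Y' f F) U V (l U \<sigma>) = l V (restr (snd (G_obj A)) U V \<sigma>)"
      by (simp add: direct_image_def)
  qed
  moreover have "l (basic_open A a) (basic_section A a) = \<mu> a" if a: "a \<in> carrier A" for a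
  proof (rule val_unique[OF openin_front_basic_open[OF a] basic_section_in_G[OF a]])
    show "val (basic_open A a) (basic_section A a) (l (basic_open A a) (basic_section A a))"
      using a by (intro l openin_front_basic_open basic_section_in_G)
    show "val (basic_open A a) (basic_section A a) (\<mu> a)"
      unfolding val_def
    proof (intro conjI ballI allI impI)
      fix y b assume y: "y \<in> ?pre (basic_open A a)" and b: "rep (basic_section A a) b y"
      have "rep (basic_section A a) a y"
        using y a by (simp add: rep_def)
      then show "germ (front Y') F (?pre (basic_open A a)) (\<mu> a) y = \<mu>germ b y"
        using rep_unique[OF _ b, of a] y by (simp add: \<mu>germ_def)
    qed (rule \<mu>[OF a])
  qed
  ultimately show ?thesis
    by metis
qed

text \<open>
  Existence and uniqueness combined, in the form in which \<^const>\<open>G_mor\<close> and \<^const>\<open>to_GH\<close> are defined.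
\<close>

lemma sheaf_hom_from_G_the:
  assumes F: "is_sheaf (front Y') F" and f: "continuous_map Y' (point_space A) f"
    and \<mu>: "\<And>a. a \<in> carrier A \<Longrightarrow> \<mu> a \<in> sections F (preimage Y' f (basic_open A a))"
    and compat: "\<And>a b y. a \<in> carrier A \<Longrightarrow> b \<in> carrier A \<Longrightarrow> y \<in> topspace Y' \<Longrightarrow>
      (a, b) \<in> germ_rel A (f y) \<Longrightarrow>
      germ (front Y') F (preimage Y' f (basic_open A a)) (\<mu> a) y =
      germ (front Y') F (preimage Y' f (basic_open A b)) (\<mu> b) y"
  defines "l \<equiv> THE l. l \<in> sheaf_hom point_front (snd (G_obj A)) (direct_image Y' f F) \<and>
    (\<forall>a\<in>carrier A. l (basic_open A a) (basic_section A a) = \<mu> a)"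
  shows "l \<in> sheaf_hom point_front (snd (G_obj A)) (direct_image Y' f F)"
    and "\<And>a. a \<in> carrier A \<Longrightarrow> l (basic_open A a) (basic_section A a) = \<mu> a"
proof -
  have "\<exists>!l. l \<in> sheaf_hom point_front (snd (G_obj A)) (direct_image Y' f F) \<and>
    (\<forall>a\<in>carrier A. l (basic_open A a) (basic_section A a) = \<mu> a)"
  proof (rule ex_ex1I)
    show "\<exists>l. l \<in> sheaf_hom point_front (snd (G_obj A)) (direct_image Y' f F) \<and>
      (\<forall>a\<in>carrier A. l (basic_open A a) (basic_section A a) = \<mu> a)"
      using F f \<mu> compat by (rule sheaf_hom_from_G_exists)
  qed (rule sheaf_hom_from_G_eqI[OF F f], simp_all)
  from theI'[OF this] show "l \<in> sheaf_hom point_front (snd (G_obj A)) (direct_image Y' f F)"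
    and "\<And>a. a \<in> carrier A \<Longrightarrow> l (basic_open A a) (basic_section A a) = \<mu> a"
    unfolding l_def by simp_all
qed

end

section \<open>Recovering the algebra from its sheaf of germs\<close>

lemma (in sheafed_space) join_H_eqI:
  assumes U: "openin Y U" "s \<in> sections E U" and V: "openin Y V" "t \<in> sections E V"
    and r: "r \<in> sections E (U \<union> V)" "restr E (U \<union> V) (U - V) r = restr E U (U - V) s"
      "restr E (U \<union> V) V r = t"
  shows "(U, s) \<curlyvee>\<^bsub>H_obj X\<^esub> (V, t) = (U \<union> V, r)"
proof (rule H.val_eqI)
  have op: "openin (front Y) U" "openin (front Y) V" "openin (front Y) (U - V)"
    "openin (front Y) (U \<union> V)"
    using U V by (auto intro: openin_imp_openin_front openin_front_diff)
  have in_H: "(U, s) \<in> carrier (H_obj X)" "(V, t) \<in> carrier (H_obj X)"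
    using U V by (simp_all add: carrier_H)
  show "(U, s) \<curlyvee>\<^bsub>H_obj X\<^esub> (V, t) \<in> carrier (H_obj X)"
    using in_H by (rule H.join_in)
  show "(U \<union> V, r) \<in> carrier (H_obj X)"
    using U V r by (simp add: carrier_H openin_Un)
  have "stalk_map X (U \<union> V, r) = stalk_map X (U, s) ++ stalk_map X (V, t)"
  proof
    fix y
    consider "y \<in> V" | "y \<in> U - V" | "y \<notin> U \<union> V"
      by blast
    then show "stalk_map X (U \<union> V, r) y = (stalk_map X (U, s) ++ stalk_map X (V, t)) y"
    proof cases
      case 1
      then have "germ (front Y) E (U \<union> V) r y = germ (front Y) E V t y"
        using germ_restr[of "U \<union> V" V r y] op r by simp
      with 1 show ?thesis
        by (simp add: stalk_map_def map_add_def)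
    next
      case 2
      then have "germ (front Y) E (U \<union> V) r y = germ (front Y) E U s y"
        using germ_restr[of "U \<union> V" "U - V" r y] germ_restr[of U "U - V" s y] op r U by auto
      with 2 show ?thesis
        by (simp add: stalk_map_def map_add_def)
    qed (simp add: stalk_map_def map_add_def)
  qed
  then show "stalk_map X ((U, s) \<curlyvee>\<^bsub>H_obj X\<^esub> (V, t)) = stalk_map X (U \<union> V, r)"
    using H.val_join[OF in_H] by simp
qed

context section_algebra
begin

lemma sheafed_space_G: "sheafed_space (G_obj A)"
  by (rule sheafed_space.intro) (rule Sh_obj_G)

lemma carrier_HG: "carrier (H_obj (G_obj A)) = {(V, \<sigma>). openin (point_space A) V \<and> \<sigma> \<in> G_sections V}"
  using sheafed_space.carrier_H[OF sheafed_space_G] by simp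

lemma to_HG_apply: "a \<in> carrier A \<Longrightarrow> to_HG A a = (basic_open A a, basic_section A a)"
  by (simp add: to_HG_def)

lemma to_HG_in: "a \<in> carrier A \<Longrightarrow> to_HG A a \<in> carrier (H_obj (G_obj A))"
  by (simp add: to_HG_apply carrier_HG openin_basic_open basic_section_in_G)

lemma to_HG_meet:
  assumes a: "a \<in> carrier A" and b: "b \<in> carrier A"
  shows "to_HG A (a \<curlywedge> b) = to_HG A a \<curlywedge>\<^bsub>H_obj (G_obj A)\<^esub> to_HG A b"
proof -
  have "basic_section A (a \<curlywedge> b) = restrict (basic_section A a) (basic_open A a \<inter> basic_open A b)"
  proof (rule extensionalityI)
    show "basic_section A (a \<curlywedge> b) \<in> extensional (basic_open A a \<inter> basic_open A b)"
      using a b by (simp add: basic_section_def basic_open_meet)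
    fix p assume p: "p \<in> basic_open A a \<inter> basic_open A b"
    then have "(a \<curlywedge> b, a) \<in> germ_rel A p"
      using a b by (intro germ_rel_if_agree[of p _ _ \<zero> b])
        (auto simp: basic_open_def point_meet point_zero)
    then show "basic_section A (a \<curlywedge> b) p =
        restrict (basic_section A a) (basic_open A a \<inter> basic_open A b) p"
      using p a b by (simp add: basic_section_eq_iff basic_open_meet)
  qed simp
  then show ?thesis
    using a b by (simp add: to_HG_apply sheafed_space.meet_H[OF sheafed_space_G] basic_open_meet)
qed

text \<open>
  On \<open>U\<^sub>b\<close> the element \<open>a \<curlyvee> b\<close> has the values of \<open>b\<close>, witnessed by the pair \<open>0\<close>, \<open>b\<close>; on \<open>U\<^sub>a - U\<^sub>b\<close> it has those of
  \<open>a\<close>, witnessed by the pair \<open>b\<close>, \<open>a\<close>.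
\<close>

lemma to_HG_join:
  assumes a: "a \<in> carrier A" and b: "b \<in> carrier A"
  shows "to_HG A (a \<curlyvee> b) = to_HG A a \<curlyvee>\<^bsub>H_obj (G_obj A)\<^esub> to_HG A b"
proof -
  let ?U = "basic_open A a" and ?V = "basic_open A b"
  have eq1: "basic_section A (a \<curlyvee> b) p = basic_section A a p" if p: "p \<in> ?U - ?V" for p
  proof -
    have "(a \<curlyvee> b, a) \<in> germ_rel A p"
      using a b p by (intro germ_rel_if_agree[of p _ _ b a])
        (auto simp: basic_open_def point_join map_add_dom_app_simps)
    then show ?thesis
      using p a b by (subst basic_section_eq_iff) (auto simp: basic_open_join)
  qed
  have eq2: "basic_section A (a \<curlyvee> b) p = basic_section A b p" if p: "p \<in> ?V" for p
  proof -
    have "(a \<curlyvee> b, b) \<in> germ_rel A p"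
      using a b p by (intro germ_rel_if_agree[of p _ _ \<zero> b])
        (auto simp: basic_open_def point_join point_zero map_add_dom_app_simps)
    then show ?thesis
      using p a b by (subst basic_section_eq_iff) (auto simp: basic_open_join)
  qed
  have "restrict (basic_section A (a \<curlyvee> b)) (?U - ?V) = restrict (basic_section A a) (?U - ?V)"
    using eq1 by (intro restrict_ext)
  moreover have "restrict (basic_section A (a \<curlyvee> b)) ?V = basic_section A b"
    using eq2 by (auto simp: basic_section_def fun_eq_iff)
  moreover have "basic_section A (a \<curlyvee> b) \<in> G_sections (?U \<union> ?V)"
    using basic_section_in_G[of "a \<curlyvee> b"] a b by (simp add: basic_open_join)
  ultimately show ?thesis
    using a b sheafed_space.join_H_eqI[OF sheafed_space_G, of ?U "basic_section A a" ?V
        "basic_section A b" "basic_section A (a \<curlyvee> b)"]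
    by (simp add: to_HG_apply basic_open_join openin_basic_open basic_section_in_G)
qed

text \<open>
  The points of \<open>Y\<close> already separate the elements of \<open>A\<close>.
\<close>

lemma inj_to_HG: "inj_on (to_HG A) (carrier A)"
proof (rule inj_onI)
  fix a b assume a: "a \<in> carrier A" and b: "b \<in> carrier A" and eq: "to_HG A a = to_HG A b"
  then have bo: "basic_open A a = basic_open A b" and bs: "basic_section A a = basic_section A b"
    by (simp_all add: to_HG_apply)
  have "v a = v b"
  proof
    fix y
    have dom: "y \<in> dom (v a) \<longleftrightarrow> y \<in> dom (v b)"
      using preimage_eval_point[OF a] preimage_eval_point[OF b] bo by simp
    show "v a y = v b y"
    proof (cases "y \<in> dom (v a)")
      case True
      then have y: "y \<in> topspace Y"
        using openin_subset[OF openin_dom[OF a]] by blast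
      then have "eval_point A v y \<in> basic_open A a"
        using True a by (simp add: eval_point_basic_open)
      then have "(a, b) \<in> germ_rel A (eval_point A v y)"
        using a b bo bs by (simp flip: basic_section_eq_iff)
      then show ?thesis
        using y by (intro germ_rel_eval_point)
    qed (use dom in \<open>simp add: domIff\<close>)
  qed
  then show "a = b"
    using a b by (intro val_eqI)
qed

text \<open>
  The values of \<open>\<sigma>\<close> at the points of \<open>Y\<close> determine a partial function \<open>f\<close> on \<open>Y\<close>, which glues to an element \<open>a\<close>.
  Near an arbitrary point \<open>p\<close> the section \<open>\<sigma>\<close> is some \<open>s\<^bsub>a'\<^esub>\<close> on \<open>U\<^sub>d - U\<^sub>c\<close>. For the points of \<open>Y\<close> in this set, \<open>a\<close>
  and \<open>a'\<close> have the same values, and this is all that \<open>a \<sim>\<^sub>p a'\<close> requires.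
\<close>

lemma surj_to_HG:
  assumes V: "openin (point_space A) V" and \<sigma>: "\<sigma> \<in> G_sections V"
  shows "\<exists>a\<in>carrier A. to_HG A a = (V, \<sigma>)"
proof -
  obtain b where b: "b \<in> carrier A" "V = basic_open A b"
    using V by (auto simp: openin_point_space)
  have Vf: "openin point_front V"
    using V by (rule openin_imp_openin_front)
  have loc: "locally_basic V \<sigma>" and ext: "\<sigma> \<in> extensional V"
    using \<sigma> Vf by (simp_all add: G_sections_iff)
  let ?e = "eval_point A v"
  define rep where "rep a y \<longleftrightarrow> a \<in> carrier A \<and> ?e y \<in> basic_open A a \<and> \<sigma> (?e y) = basic_section A a (?e y)"
    for a y
  define f where "f y = (if y \<in> dom (v b) then v (SOME a. rep a y) y else None)" for y
  have dom_b: "y \<in> dom (v b) \<longleftrightarrow> y \<in> topspace Y \<and> ?e y \<in> V" for y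
    using preimage_eval_point[OF b(1)] b(2) by blast
  have f: "f y = v a y" if a: "rep a y" and y: "y \<in> dom (v b)" for a y
  proof -
    define a' where "a' = (SOME a. rep a y)"
    have "rep a' y"
      unfolding a'_def using a by (rule someI)
    then have "(a', a) \<in> germ_rel A (?e y)"
      using a basic_section_eq_iff[of "?e y" a' a] by (simp add: rep_def)
    then have "v a' y = v a y"
      using y dom_b by (intro germ_rel_eval_point) simp_all
    then show ?thesis
      using y by (simp add: f_def a'_def)
  qed
  have local: "\<exists>a Z. a \<in> carrier A \<and> openin point_front Z \<and> p \<in> Z \<and> Z \<subseteq> V \<and>
      Z \<subseteq> basic_open A a \<and> \<sigma> p = basic_section A a p \<and>
      (\<forall>y\<in>topspace Y. ?e y \<in> Z \<longrightarrow> y \<in> dom (v b) \<and> f y = v a y)" if p: "p \<in> V" for p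
  proof -
    from loc p obtain a Z where a: "a \<in> carrier A" "openin point_front Z" "p \<in> Z"
      "Z \<subseteq> V" "Z \<subseteq> basic_open A a" "\<And>q. q \<in> Z \<Longrightarrow> \<sigma> q = basic_section A a q"
      by (rule locally_basicE) metis
    have "y \<in> dom (v b) \<and> f y = v a y" if y: "y \<in> topspace Y" "?e y \<in> Z" for y
    proof -
      have "y \<in> dom (v b)" "rep a y"
        using y a dom_b by (auto simp: rep_def)
      with f show ?thesis
        by simp
    qed
    with a show ?thesis
      by metis
  qed
  have f_dom: "y \<in> dom f" if y: "y \<in> dom (v b)" for y
  proof -
    have eV: "?e y \<in> V" and yY: "y \<in> topspace Y"
      using y dom_b by simp_all
    from local[OF eV] obtain a Z where a: "a \<in> carrier A" "?e y \<in> Z" "Z \<subseteq> basic_open A a"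
        "f y = v a y"
      using yY by metis
    then have "y \<in> dom (v a)"
      using eval_point_basic_open[of a y] yY by blast
    with a show ?thesis
      by (simp add: domIff)
  qed
  have dom_f: "dom f = dom (v b)"
  proof
    show "dom f \<subseteq> dom (v b)"
    proof
      fix y assume "y \<in> dom f"
      then show "y \<in> dom (v b)"
        by (simp add: domIff f_def split: if_splits)
    qed
  qed (use f_dom in blast)
  have "\<exists>a\<in>carrier A. v a = f"
  proof (rule glue)
    show "openin Y (dom f)"
      unfolding dom_f using b(1) by (rule openin_dom)
    fix y assume "y \<in> dom f"
    then have y: "y \<in> topspace Y" "?e y \<in> V"
      unfolding dom_f dom_b by simp_all
    from local[OF y(2)] obtain a Z where a: "a \<in> carrier A" "openin point_front Z"
      "?e y \<in> Z" "\<And>z. z \<in> topspace Y \<Longrightarrow> ?e z \<in> Z \<Longrightarrow> z \<in> dom (v b) \<and> f z = v a z"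
      by metis
    have "openin (front Y) (preimage Y ?e Z)"
      using continuous_eval_point a(2) by (rule openin_front_preimage)
    moreover have "preimage Y ?e Z \<subseteq> dom f" "\<forall>z\<in>preimage Y ?e Z. v a z = f z"
      unfolding dom_f using a(4) by auto
    moreover have "y \<in> preimage Y ?e Z"
      using y a by simp
    ultimately show "\<exists>a\<in>carrier A. \<exists>Z. openin (front Y) Z \<and> y \<in> Z \<and> Z \<subseteq> dom f \<and> (\<forall>z\<in>Z. v a z = f z)"
      using a(1) by (intro bexI[of _ a] exI[of _ "preimage Y ?e Z"] conjI)
  qed
  then obtain a where a: "a \<in> carrier A" "v a = f"
    by (elim bexE)
  have "cls A a = cls A b"
    using a b dom_f by (simp add: cls_eq_iff)
  then have aV: "basic_open A a = V"
    by (simp add: b(2) basic_open_def)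
  have "basic_section A a = \<sigma>"
  proof (rule extensionalityI)
    show "basic_section A a \<in> extensional V" "\<sigma> \<in> extensional V"
      using ext aV by (auto simp: basic_section_def)
    fix p assume p: "p \<in> V"
    from local[OF p] obtain a' Z where a': "a' \<in> carrier A" "openin point_front Z"
      "p \<in> Z" "Z \<subseteq> basic_open A a'" "\<sigma> p = basic_section A a' p"
      "\<And>z. z \<in> topspace Y \<Longrightarrow> ?e z \<in> Z \<Longrightarrow> f z = v a' z"
      by metis
    obtain c d where cd: "c \<in> carrier A" "d \<in> carrier A" "\<not> p (cls A c)" "p (cls A d)"
      "basic_open A d - basic_open A c \<subseteq> Z"
      using front_point_nbhd[OF a'(2,3)] by metis
    have "(a, a') \<in> germ_rel A p"
    proof (rule germ_rel_if_agree[of p a a' c d])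
      fix y assume y: "y \<in> dom (v d)" "y \<notin> dom (v c)"
      then have yY: "y \<in> topspace Y"
        using openin_subset[OF openin_dom[OF cd(2)]] by blast
      then have "?e y \<in> Z"
        using y cd eval_point_basic_open by blast
      then show "v a y = v a' y"
        using a'(6) yY a(2) by simp
    qed (use p aV a a' cd in \<open>auto simp: basic_open_def\<close>)
    moreover have "p \<in> basic_open A a" "p \<in> basic_open A a'"
      using p aV a'(3,4) by auto
    ultimately show "basic_section A a p = \<sigma> p"
      using a(1) a'(1,5) by (simp add: basic_section_eq_iff)
  qed
  with a aV show ?thesis
    by (auto simp: to_HG_apply)
qed

lemma bij_to_HG: "bij_betw (to_HG A) (carrier A) (carrier (H_obj (G_obj A)))"
  unfolding bij_betw_def
proof
  show "to_HG A ` carrier A = carrier (H_obj (G_obj A))"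
  proof
    show "to_HG A ` carrier A \<subseteq> carrier (H_obj (G_obj A))"
      using to_HG_in by blast
    show "carrier (H_obj (G_obj A)) \<subseteq> to_HG A ` carrier A"
    proof
      fix x assume "x \<in> carrier (H_obj (G_obj A))"
      then obtain V \<sigma> where "x = (V, \<sigma>)" "openin (point_space A) V" "\<sigma> \<in> G_sections V"
        by (auto simp: carrier_HG)
      then show "x \<in> to_HG A ` carrier A"
        using surj_to_HG by (metis image_eqI)
    qed
  qed
qed (rule inj_to_HG)

end

section \<open>Morphisms of noncommutative frames\<close>

locale section_algebra_pair = A: section_algebra A Y v + B: section_algebra B Z w
  for A :: "'a skew_algebra" and Y :: "'y topology" and v :: "'a \<Rightarrow> 'y \<rightharpoonup> 'g"
    and B :: "'b skew_algebra" and Z :: "'z topology" and w :: "'b \<Rightarrow> 'z \<rightharpoonup> 'h"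
begin

declare Image_singleton_iff [simp del] domIff [iff del]

text \<open>
  If the value of \<open>\<phi> a\<close> at \<open>z\<close> depends only on the value of \<open>a\<close> at \<open>f z\<close>, then \<open>\<phi>\<close> preserves all operations,
  because these are computed pointwise by selecting one of the given values.
\<close>

lemma pointwise_ncf_hom:
  assumes ext: "\<phi> \<in> extensional (carrier A)"
    and in_B: "\<And>a. a \<in> carrier A \<Longrightarrow> \<phi> a \<in> carrier B"
    and f: "f \<in> topspace Z \<rightarrow> topspace Y"
    and dom: "\<And>a. a \<in> carrier A \<Longrightarrow> dom (w (\<phi> a)) = preimage Z f (dom (v a))"
    and loc: "\<And>a b z. a \<in> carrier A \<Longrightarrow> b \<in> carrier A \<Longrightarrow> z \<in> topspace Z \<Longrightarrow>
      f z \<in> dom (v a) \<Longrightarrow> v a (f z) = v b (f z) \<Longrightarrow> w (\<phi> a) z = w (\<phi> b) z"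
  shows "\<phi> \<in> ncf_hom A B"
  unfolding ncf_hom_def mem_Collect_eq
proof (intro conjI ballI allI impI)
  have none: "w (\<phi> a) z = None" if "a \<in> carrier A" "z \<notin> topspace Z \<or> f z \<notin> dom (v a)" for a z
    using dom[OF that(1)] that(2) by (metis (mono_tags, lifting) domIff mem_Collect_eq)
  have loc': "w (\<phi> a) z = w (\<phi> b) z"
    if "a \<in> carrier A" "b \<in> carrier A" "z \<in> topspace Z" "v a (f z) = v b (f z)" for a b z
    using loc[OF that(1-3)] that none[of a z] none[of b z] by (metis domIff)
  show "\<phi> \<in> carrier A \<rightarrow>\<^sub>E carrier B"
    using ext in_B by (simp add: PiE_def)
  {
    fix a b assume a: "a \<in> carrier A" and b: "b \<in> carrier A"
    show "\<phi> (a \<curlywedge>\<^bsub>A\<^esub> b) = \<phi> a \<curlywedge>\<^bsub>B\<^esub> \<phi> b"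
    proof (rule B.val_eqI)
      show "w (\<phi> (a \<curlywedge>\<^bsub>A\<^esub> b)) = w (\<phi> a \<curlywedge>\<^bsub>B\<^esub> \<phi> b)"
      proof
        fix z
        show "w (\<phi> (a \<curlywedge>\<^bsub>A\<^esub> b)) z = w (\<phi> a \<curlywedge>\<^bsub>B\<^esub> \<phi> b) z"
        proof (cases "z \<in> topspace Z \<and> f z \<in> dom (v b)")
          case True
          then have "w (\<phi> (a \<curlywedge>\<^bsub>A\<^esub> b)) z = w (\<phi> a) z"
            using a b by (intro loc') simp_all
          moreover have "z \<in> dom (w (\<phi> b))"
            using True b by (simp add: dom)
          ultimately show ?thesis
            using a b in_B by simp
        next
          case False
          then have "w (\<phi> (a \<curlywedge>\<^bsub>A\<^esub> b)) z = None"
            using a b by (intro none) auto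
          moreover have "z \<notin> dom (w (\<phi> b))"
            using False dom[OF b] by simp
          ultimately show ?thesis
            using a b in_B by simp
        qed
      qed
    qed (use a b in_B in simp_all)
    show "\<phi> (a \<curlyvee>\<^bsub>A\<^esub> b) = \<phi> a \<curlyvee>\<^bsub>B\<^esub> \<phi> b"
    proof (rule B.val_eqI)
      show "w (\<phi> (a \<curlyvee>\<^bsub>A\<^esub> b)) = w (\<phi> a \<curlyvee>\<^bsub>B\<^esub> \<phi> b)"
      proof
        fix z
        consider "z \<in> topspace Z" "f z \<in> dom (v b)" | "z \<in> topspace Z" "f z \<notin> dom (v b)"
          | "z \<notin> topspace Z"
          by blast
        then show "w (\<phi> (a \<curlyvee>\<^bsub>A\<^esub> b)) z = w (\<phi> a \<curlyvee>\<^bsub>B\<^esub> \<phi> b) z"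
        proof cases
          case 1
          then have "w (\<phi> (a \<curlyvee>\<^bsub>A\<^esub> b)) z = w (\<phi> b) z"
            using a b by (intro loc') (simp_all add: map_add_dom_app_simps)
          moreover have "z \<in> dom (w (\<phi> b))"
            using 1 b by (simp add: dom)
          ultimately show ?thesis
            using a b in_B by (simp add: map_add_dom_app_simps)
        next
          case 2
          then have "w (\<phi> (a \<curlyvee>\<^bsub>A\<^esub> b)) z = w (\<phi> a) z"
            using a b by (intro loc') (simp_all add: map_add_dom_app_simps)
          moreover have "z \<notin> dom (w (\<phi> b))"
            using 2 b by (simp add: dom)
          ultimately show ?thesis
            using a b in_B by (simp add: map_add_dom_app_simps)
        next
          case 3
          then show ?thesis
            using a b in_B none[of "a \<curlyvee>\<^bsub>A\<^esub> b" z] none[of a z] none[of b z] by (simp add: map_add_def)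
        qed
      qed
    qed (use a b in_B in simp_all)
  }
  show "\<phi> \<zero>\<^bsub>A\<^esub> = \<zero>\<^bsub>B\<^esub>"
  proof (rule B.val_eqI)
    show "w (\<phi> \<zero>\<^bsub>A\<^esub>) = w \<zero>\<^bsub>B\<^esub>"
      using dom[of "\<zero>\<^bsub>A\<^esub>"] by simp
  qed (simp_all add: in_B)
  {
    fix S assume S: "commuting_subset A S"
    then have SA: "a \<in> carrier A" if "a \<in> S" for a
      using that by (auto simp: commuting_subset_def)
    note Sup = A.Sup_commuting[OF S]
    show "\<phi> (\<Squnion>\<^bsub>natural_order A\<^esub> S) = \<Squnion>\<^bsub>natural_order B\<^esub> (\<phi> ` S)"
    proof (rule B.Sup_eqI[symmetric])
      show "\<phi> ` S \<subseteq> carrier B" "\<phi> (\<Squnion>\<^bsub>natural_order A\<^esub> S) \<in> carrier B"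
        using SA in_B Sup(1) by auto
      have "(\<Union>x\<in>\<phi> ` S. dom (w x)) = (\<Union>a\<in>S. preimage Z f (dom (v a)))"
        using SA dom by simp
      also have "\<dots> = preimage Z f (\<Union>a\<in>S. dom (v a))"
        by blast
      finally show "dom (w (\<phi> (\<Squnion>\<^bsub>natural_order A\<^esub> S))) = (\<Union>x\<in>\<phi> ` S. dom (w x))"
        using dom[OF Sup(1)] Sup(2) by simp
      fix x assume "x \<in> \<phi> ` S"
      then obtain a where a: "a \<in> S" "x = \<phi> a"
        by blast
      show "w x \<subseteq>\<^sub>m w (\<phi> (\<Squnion>\<^bsub>natural_order A\<^esub> S))"
        unfolding map_le_def
      proof
        fix z assume "z \<in> dom (w x)"
        then have z: "z \<in> topspace Z" "f z \<in> dom (v a)"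
          using dom[OF SA[OF a(1)]] a(2) by auto
        then have "v a (f z) = v (\<Squnion>\<^bsub>natural_order A\<^esub> S) (f z)"
          using Sup(3)[OF a(1)] by (simp add: map_le_def)
        then show "w x z = w (\<phi> (\<Squnion>\<^bsub>natural_order A\<^esub> S)) z"
          using a SA Sup(1) z by (simp add: loc)
      qed
    qed
  }
  fix a assume "a \<in> \<top>\<^bsub>shadow A\<^esub>"
  then show "\<phi> a \<in> \<top>\<^bsub>shadow B\<^esub>"
    using f in_B dom[of a] by (auto simp: A.mem_shadow_top B.mem_shadow_top)
qed

text \<open>
  The binary operations determine the rest of the structure: \<open>0\<close> is the neutral element of the join, the natural order
  and hence its suprema are defined from the meet, and \<open>a\<close> lies in the maximal class iff
  \<open>g \<curlywedge> a = g\<close> for some \<open>g\<close> in this class.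
\<close>

lemma bijective_ncf_hom:
  assumes ext: "\<phi> \<in> extensional (carrier A)"
    and bij: "bij_betw \<phi> (carrier A) (carrier B)"
    and meet: "\<And>a b. a \<in> carrier A \<Longrightarrow> b \<in> carrier A \<Longrightarrow> \<phi> (a \<curlywedge>\<^bsub>A\<^esub> b) = \<phi> a \<curlywedge>\<^bsub>B\<^esub> \<phi> b"
    and join: "\<And>a b. a \<in> carrier A \<Longrightarrow> b \<in> carrier A \<Longrightarrow> \<phi> (a \<curlyvee>\<^bsub>A\<^esub> b) = \<phi> a \<curlyvee>\<^bsub>B\<^esub> \<phi> b"
  shows "\<phi> \<in> ncf_hom A B"
  unfolding ncf_hom_def mem_Collect_eq
proof (intro conjI ballI allI impI)
  have in_B: "\<phi> a \<in> carrier B" if "a \<in> carrier A" for a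
    using bij that by (rule bij_betwE[rule_format])
  have inj: "\<phi> a = \<phi> b \<longleftrightarrow> a = b" if "a \<in> carrier A" "b \<in> carrier A" for a b
    using bij that by (metis bij_betw_imp_inj_on inj_on_eq_iff)
  have surj: "\<exists>a\<in>carrier A. \<phi> a = b" if "b \<in> carrier B" for b
    using bij that by (metis bij_betw_imp_surj_on imageE)
  show "\<phi> \<in> carrier A \<rightarrow>\<^sub>E carrier B"
    using ext in_B by (simp add: PiE_def)
  show "\<phi> \<zero>\<^bsub>A\<^esub> = \<zero>\<^bsub>B\<^esub>"
  proof (rule B.val_eqI)
    obtain a where a: "a \<in> carrier A" "\<phi> a = \<zero>\<^bsub>B\<^esub>"
      using surj[of "\<zero>\<^bsub>B\<^esub>"] by auto
    have "a \<curlyvee>\<^bsub>A\<^esub> \<zero>\<^bsub>A\<^esub> = a"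
      using a by (intro A.val_eqI) simp_all
    then have "\<zero>\<^bsub>B\<^esub> = \<zero>\<^bsub>B\<^esub> \<curlyvee>\<^bsub>B\<^esub> \<phi> \<zero>\<^bsub>A\<^esub>"
      using join[OF a(1), of "\<zero>\<^bsub>A\<^esub>"] a by simp
    then have "w \<zero>\<^bsub>B\<^esub> = w \<zero>\<^bsub>B\<^esub> ++ w (\<phi> \<zero>\<^bsub>A\<^esub>)"
      using B.val_join[of "\<zero>\<^bsub>B\<^esub>" "\<phi> \<zero>\<^bsub>A\<^esub>"] in_B[of "\<zero>\<^bsub>A\<^esub>"] by (metis A.zero_in B.zero_in)
    then show "w (\<phi> \<zero>\<^bsub>A\<^esub>) = w \<zero>\<^bsub>B\<^esub>"
      by (simp only: B.val_zero empty_map_add)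
  qed (simp_all add: in_B)
  {
    fix S assume S: "commuting_subset A S"
    then have SA: "S \<subseteq> carrier A"
      by (simp add: commuting_subset_def)
    have carrier: "carrier (natural_order A) = carrier A" "carrier (natural_order B) = carrier B"
      by (simp_all add: natural_order_def)
    have le: "le (natural_order B) (\<phi> a) (\<phi> b) \<longleftrightarrow> le (natural_order A) a b"
      if "a \<in> carrier A" "b \<in> carrier A" for a b
      using that by (simp add: natural_order_def inj flip: meet)
    have upper: "\<phi> a \<in> Upper (natural_order B) (\<phi> ` S) \<longleftrightarrow> a \<in> Upper (natural_order A) S"
      if "a \<in> carrier A" for a
      using that SA in_B le unfolding Upper_def carrier by (auto simp: subset_iff)
    have "is_lub (natural_order A) (\<Squnion>\<^bsub>natural_order A\<^esub> S) S"
      using A.Sup_commuting(4)[OF S] .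
    then have sup: "(\<Squnion>\<^bsub>natural_order A\<^esub> S) \<in> Upper (natural_order A) S"
      "\<And>x. x \<in> Upper (natural_order A) S \<Longrightarrow> le (natural_order A) (\<Squnion>\<^bsub>natural_order A\<^esub> S) x"
      by (auto simp: least_def)
    have "is_lub (natural_order B) (\<phi> (\<Squnion>\<^bsub>natural_order A\<^esub> S)) (\<phi> ` S)"
      unfolding least_def
    proof (intro conjI ballI)
      show "Upper (natural_order B) (\<phi> ` S) \<subseteq> carrier (natural_order B)"
        by (simp add: Upper_def)
      show "\<phi> (\<Squnion>\<^bsub>natural_order A\<^esub> S) \<in> Upper (natural_order B) (\<phi> ` S)"
        using sup(1) upper A.Sup_commuting(1)[OF S] by simp
      fix x assume x: "x \<in> Upper (natural_order B) (\<phi> ` S)"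
      then have "x \<in> carrier B"
        by (simp add: Upper_def carrier)
      then obtain a where a: "a \<in> carrier A" "x = \<phi> a"
        using surj by metis
      then show "le (natural_order B) (\<phi> (\<Squnion>\<^bsub>natural_order A\<^esub> S)) x"
        using x sup(2) upper le A.Sup_commuting(1)[OF S] by simp
    qed
    then show "\<phi> (\<Squnion>\<^bsub>natural_order A\<^esub> S) = \<Squnion>\<^bsub>natural_order B\<^esub> (\<phi> ` S)"
      by (rule B.Sup_eq_lub[symmetric])
  }
  fix a assume "a \<in> \<top>\<^bsub>shadow A\<^esub>"
  then have a: "a \<in> carrier A" "dom (v a) = topspace Y"
    by (simp_all add: A.mem_shadow_top)
  obtain h where h: "h \<in> carrier B" "dom (w h) = topspace Z"
    using B.global by (elim bexE)
  obtain g where g: "g \<in> carrier A" "\<phi> g = h"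
    using surj[OF h(1)] by (elim bexE)
  have "dom (v g) \<subseteq> dom (v a)"
    unfolding a(2) using A.openin_dom[OF g(1)] by (rule openin_subset)
  then have "g \<curlywedge>\<^bsub>A\<^esub> a = g"
    using a g by (intro A.val_eqI) (simp_all add: restrict_map_eq_self_iff)
  then have "h \<curlywedge>\<^bsub>B\<^esub> \<phi> a = h"
    using meet[OF g(1) a(1)] g(2) by simp
  then have "w h |` dom (w (\<phi> a)) = w h"
    using B.val_meet[OF h(1) in_B[OF a(1)]] by simp
  then have "topspace Z \<subseteq> dom (w (\<phi> a))"
    unfolding restrict_map_eq_self_iff h(2) .
  with openin_subset[OF B.openin_dom[OF in_B[OF a(1)]]] have "dom (w (\<phi> a)) = topspace Z"
    by (rule subset_antisym)
  then show "\<phi> a \<in> \<top>\<^bsub>shadow B\<^esub>"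
    unfolding B.mem_shadow_top using in_B[OF a(1)] by (intro conjI)
qed (use meet join in simp_all)

end

lemma bijective_ncf_iso:
  assumes A: "section_algebra A Y v" and B: "section_algebra B Z w"
    and ext: "\<phi> \<in> extensional (carrier A)"
    and bij: "bij_betw \<phi> (carrier A) (carrier B)"
    and meet: "\<And>a b. a \<in> carrier A \<Longrightarrow> b \<in> carrier A \<Longrightarrow> \<phi> (a \<curlywedge>\<^bsub>A\<^esub> b) = \<phi> a \<curlywedge>\<^bsub>B\<^esub> \<phi> b"
    and join: "\<And>a b. a \<in> carrier A \<Longrightarrow> b \<in> carrier A \<Longrightarrow> \<phi> (a \<curlyvee>\<^bsub>A\<^esub> b) = \<phi> a \<curlyvee>\<^bsub>B\<^esub> \<phi> b"
  shows "ncf_iso A B \<phi>"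
proof -
  interpret A: section_algebra A Y v by (rule A)
  interpret B: section_algebra B Z w by (rule B)
  define \<psi> where "\<psi> = restrict (inv_into (carrier A) \<phi>) (carrier B)"
  have \<psi>_in: "\<psi> b \<in> carrier A" and \<phi>\<psi>: "\<phi> (\<psi> b) = b" if "b \<in> carrier B" for b
    using bij that by (simp_all add: \<psi>_def bij_betw_def inv_into_into f_inv_into_f)
  have \<phi>_in: "\<phi> a \<in> carrier B" if "a \<in> carrier A" for a
    using bij that by (rule bij_betwE[rule_format])
  have \<psi>\<phi>: "\<psi> (\<phi> a) = a" if "a \<in> carrier A" for a
    using bij that \<phi>_in[OF that] by (simp add: \<psi>_def bij_betw_def)
  have "\<phi> \<in> ncf_hom A B"
    using ext bij meet join
    by (intro section_algebra_pair.bijective_ncf_hom[OF section_algebra_pair.intro[OF A B]])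
  moreover have "\<psi> \<in> ncf_hom B A"
  proof (rule section_algebra_pair.bijective_ncf_hom[OF section_algebra_pair.intro[OF B A]])
    show "\<psi> \<in> extensional (carrier B)"
      by (simp add: \<psi>_def)
    show "bij_betw \<psi> (carrier B) (carrier A)"
      using \<psi>_in \<phi>\<psi> \<phi>_in \<psi>\<phi> by (intro bij_betw_byWitness[of _ \<phi>]) auto
    fix b c assume b: "b \<in> carrier B" and c: "c \<in> carrier B"
    have "\<psi> (\<phi> (\<psi> b) \<curlywedge>\<^bsub>B\<^esub> \<phi> (\<psi> c)) = \<psi> b \<curlywedge>\<^bsub>A\<^esub> \<psi> c" "\<psi> (\<phi> (\<psi> b) \<curlyvee>\<^bsub>B\<^esub> \<phi> (\<psi> c)) = \<psi> b \<curlyvee>\<^bsub>A\<^esub> \<psi> c"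
      using b c \<psi>_in by (simp_all add: \<psi>\<phi> flip: meet join)
    then show "\<psi> (b \<curlywedge>\<^bsub>B\<^esub> c) = \<psi> b \<curlywedge>\<^bsub>A\<^esub> \<psi> c" "\<psi> (b \<curlyvee>\<^bsub>B\<^esub> c) = \<psi> b \<curlyvee>\<^bsub>A\<^esub> \<psi> c"
      using b c by (simp_all add: \<phi>\<psi>)
  qed
  moreover have "ncf_comp A \<psi> \<phi> = ncf_id A" "ncf_comp B \<phi> \<psi> = ncf_id B"
    using \<psi>\<phi> \<phi>\<psi> by (auto simp: compose_def ncf_id_def restrict_def fun_eq_iff)
  ultimately show ?thesis
    unfolding ncf_iso_def by blast
qed

lemma ncf_id_hom:
  assumes "section_algebra A Y v"
  shows "ncf_iso A A (ncf_id A)"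
proof (rule bijective_ncf_iso[OF assms assms])
  show "bij_betw (ncf_id A) (carrier A) (carrier A)"
    by (rule bij_betwI[of _ _ _ "ncf_id A"]) (auto simp: ncf_id_def)
qed (use section_algebra.meet_in[OF assms] section_algebra.join_in[OF assms] in \<open>auto simp: ncf_id_def\<close>)

lemma ncf_homD:
  assumes "\<phi> \<in> ncf_hom A B"
  shows "a \<in> carrier A \<Longrightarrow> \<phi> a \<in> carrier B"
    and "a \<in> carrier A \<Longrightarrow> b \<in> carrier A \<Longrightarrow> \<phi> (a \<curlywedge>\<^bsub>A\<^esub> b) = \<phi> a \<curlywedge>\<^bsub>B\<^esub> \<phi> b"
    and "a \<in> carrier A \<Longrightarrow> b \<in> carrier A \<Longrightarrow> \<phi> (a \<curlyvee>\<^bsub>A\<^esub> b) = \<phi> a \<curlyvee>\<^bsub>B\<^esub> \<phi> b"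
    and "\<phi> \<zero>\<^bsub>A\<^esub> = \<zero>\<^bsub>B\<^esub>"
    and "commuting_subset A S \<Longrightarrow> \<phi> (\<Squnion>\<^bsub>natural_order A\<^esub> S) = \<Squnion>\<^bsub>natural_order B\<^esub> (\<phi> ` S)"
    and "a \<in> \<top>\<^bsub>shadow A\<^esub> \<Longrightarrow> \<phi> a \<in> \<top>\<^bsub>shadow B\<^esub>"
    and "\<phi> \<in> extensional (carrier A)"
  using assms by (auto simp: ncf_hom_def PiE_iff)

lemma commuting_subset_image:
  assumes "\<phi> \<in> ncf_hom A B" "commuting_subset A S"
  shows "commuting_subset B (\<phi> ` S)"
  unfolding commuting_subset_def
proof (intro conjI ballI)
  have S: "S \<noteq> {}" "\<And>a. a \<in> S \<Longrightarrow> a \<in> carrier A"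
    using assms(2) by (auto simp: commuting_subset_def)
  show "\<phi> ` S \<subseteq> carrier B" "\<phi> ` S \<noteq> {}"
    using S ncf_homD(1)[OF assms(1)] by auto
  fix x y assume "x \<in> \<phi> ` S" "y \<in> \<phi> ` S"
  then obtain a b where ab: "a \<in> S" "b \<in> S" "x = \<phi> a" "y = \<phi> b"
    by blast
  then have "a \<curlywedge>\<^bsub>A\<^esub> b = b \<curlywedge>\<^bsub>A\<^esub> a" "a \<curlyvee>\<^bsub>A\<^esub> b = b \<curlyvee>\<^bsub>A\<^esub> a"
    using assms(2) unfolding commuting_subset_def by blast+
  then show "x \<curlywedge>\<^bsub>B\<^esub> y = y \<curlywedge>\<^bsub>B\<^esub> x" "x \<curlyvee>\<^bsub>B\<^esub> y = y \<curlyvee>\<^bsub>B\<^esub> x"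
    using ab S(2) by (simp_all flip: ncf_homD(2,3)[OF assms(1)])
qed

lemma ncf_comp_hom:
  assumes A: "section_algebra A Y v" and \<phi>: "\<phi> \<in> ncf_hom A B" and \<psi>: "\<psi> \<in> ncf_hom B C"
  shows "ncf_comp A \<psi> \<phi> \<in> ncf_hom A C"
proof -
  interpret A: section_algebra A Y v by (rule A)
  have top: "a \<in> carrier A" if "a \<in> \<top>\<^bsub>shadow A\<^esub>" for a
    using that by (simp add: A.mem_shadow_top)
  have img: "ncf_comp A \<psi> \<phi> ` S = \<psi> ` \<phi> ` S" if "commuting_subset A S" for S
    using that by (force simp: commuting_subset_def compose_def image_iff)
  show ?thesis
    unfolding ncf_hom_def mem_Collect_eq
    using ncf_homD[OF \<phi>] ncf_homD[OF \<psi>] A.Sup_commuting(1) commuting_subset_image[OF \<phi>] top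
    by (simp add: img compose_eq PiE_iff)
qed


section \<open>The functor G on morphisms\<close>

lemma (in section_algebra) germ_basic_section_eq:
  assumes p: "p \<in> points A" and ab: "(a, b) \<in> germ_rel A p"
  shows "germ (front (point_space A)) (snd (G_obj A)) (basic_open A a) (basic_section A a) p =
    germ (front (point_space A)) (snd (G_obj A)) (basic_open A b) (basic_section A b) p"
proof -
  interpret G: sheaf_on "front (point_space A)" "snd (G_obj A)"
    using G_is_sheaf by (rule sheaf_on.intro)
  have *: "a \<in> carrier A" "b \<in> carrier A" "p \<in> basic_open A a" "p \<in> basic_open A b"
    using p ab by (simp_all add: germ_rel_iff basic_open_def)
  obtain Z where Z: "openin (front (point_space A)) Z" "p \<in> Z" "Z \<subseteq> basic_open A a \<inter> basic_open A b"
      "\<And>q. q \<in> Z \<Longrightarrow> (a, b) \<in> germ_rel A q"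
    using germ_rel_open[OF p ab] by metis
  have "basic_section A a q = basic_section A b q" if "q \<in> Z" for q
    using Z(3) Z(4)[OF that] that * by (subst basic_section_eq_iff) auto
  then have "restrict (basic_section A a) Z = restrict (basic_section A b) Z"
    by (intro restrict_ext)
  then have "restr (snd (G_obj A)) (basic_open A a) Z (basic_section A a) =
      restr (snd (G_obj A)) (basic_open A b) Z (basic_section A b)"
    by simp
  with Z * show ?thesis
    by (subst G.germ_eq_iff) (auto intro: openin_front_basic_open basic_section_in_G)
qed

locale ncf_morphism = section_algebra_pair +
  fixes \<phi> assumes hom: "\<phi> \<in> ncf_hom A B"
begin

lemma phi_in [simp]: "a \<in> carrier A \<Longrightarrow> \<phi> a \<in> carrier B"
  using hom by (rule ncf_homD)

lemma dom_phi_eq: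
  assumes "a \<in> carrier A" "b \<in> carrier A" "dom (v a) = dom (v b)"
  shows "dom (w (\<phi> a)) = dom (w (\<phi> b))"
proof -
  have "(a, b) \<in> green_D A"
    using assms by (simp add: A.green_D_iff)
  then have "a \<curlywedge>\<^bsub>A\<^esub> b \<curlywedge>\<^bsub>A\<^esub> a = a" "b \<curlywedge>\<^bsub>A\<^esub> a \<curlywedge>\<^bsub>A\<^esub> b = b"
    by (auto simp: green_D_def)
  then have "\<phi> a \<curlywedge>\<^bsub>B\<^esub> \<phi> b \<curlywedge>\<^bsub>B\<^esub> \<phi> a = \<phi> a" "\<phi> b \<curlywedge>\<^bsub>B\<^esub> \<phi> a \<curlywedge>\<^bsub>B\<^esub> \<phi> b = \<phi> b"
    using assms by (simp_all flip: ncf_homD(2)[OF hom])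
  then have "(\<phi> a, \<phi> b) \<in> green_D B"
    using assms by (simp add: green_D_def)
  then show ?thesis
    by (simp add: B.green_D_iff)
qed

lemma image_cls:
  assumes a: "a \<in> carrier A"
  shows "green_D B `` (\<phi> ` cls A a) = cls B (\<phi> a)"
proof -
  have "(\<phi> b, c) \<in> green_D B \<longleftrightarrow> (\<phi> a, c) \<in> green_D B" if "b \<in> cls A a" for b c
  proof -
    have b: "b \<in> carrier A" "dom (v b) = dom (v a)"
      using that by (simp_all only: A.mem_cls_iff[OF a])
    then have "dom (w (\<phi> b)) = dom (w (\<phi> a))"
      using a by (intro dom_phi_eq)
    with a b(1) show ?thesis
      by (simp add: B.green_D_iff)
  qed
  moreover have "a \<in> cls A a"
    using a by (simp add: A.mem_cls_iff)
  ultimately show ?thesis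
    by (auto simp: Image_singleton_iff)
qed

abbreviation "pullback \<equiv> G_map A B \<phi>"

lemma G_map_cls: "p \<in> points B \<Longrightarrow> a \<in> carrier A \<Longrightarrow> pullback p (cls A a) \<longleftrightarrow> p (cls B (\<phi> a))"
  by (simp add: G_map_def image_cls)

text \<open>
  By \<open>points_iff\<close> a point is a map on \<open>A\<close> that respects exactly what morphisms preserve.
\<close>

lemma G_map_in_points:
  assumes p: "p \<in> points B"
  shows "pullback p \<in> points A"
  unfolding A.points_iff
proof (intro conjI ballI allI impI)
  show "pullback p \<in> carrier (shadow A) \<rightarrow>\<^sub>E UNIV"
    using p by (simp add: G_map_def)
  obtain g where g: "g \<in> carrier A" "dom (v g) = topspace Y"
    using A.global by (elim bexE)
  then have "\<phi> g \<in> \<top>\<^bsub>shadow B\<^esub>"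
    by (intro ncf_homD(6)[OF hom]) (simp add: A.mem_shadow_top)
  then have "p (cls B (\<phi> g))"
    unfolding B.mem_shadow_top by (elim conjE) (rule B.point_top[OF p])
  then show "\<exists>a\<in>carrier A. pullback p (cls A a)"
    using g p by (auto simp: G_map_cls)
  show "\<not> pullback p (cls A \<zero>\<^bsub>A\<^esub>)"
    using p by (simp add: G_map_cls ncf_homD(4)[OF hom] B.point_zero)
next
  fix a b assume "a \<in> carrier A" "b \<in> carrier A"
  then show "pullback p (cls A (a \<curlywedge>\<^bsub>A\<^esub> b)) \<longleftrightarrow> pullback p (cls A a) \<and> pullback p (cls A b)"
    using p by (simp add: G_map_cls ncf_homD(2)[OF hom] B.point_meet)
next
  fix S assume S: "commuting_subset A S"
  then have SA: "S \<subseteq> carrier A"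
    by (simp add: commuting_subset_def)
  have "pullback p (cls A (\<Squnion>\<^bsub>natural_order A\<^esub> S)) \<longleftrightarrow> p (cls B (\<Squnion>\<^bsub>natural_order B\<^esub> (\<phi> ` S)))"
    using p S A.Sup_commuting(1)[OF S] by (simp add: G_map_cls ncf_homD(5)[OF hom])
  also have "\<dots> \<longleftrightarrow> (\<exists>b\<in>\<phi> ` S. p (cls B b))"
    using p commuting_subset_image[OF hom S] unfolding B.points_iff by metis
  also have "\<dots> \<longleftrightarrow> (\<exists>a\<in>S. pullback p (cls A a))"
    using p SA by (auto simp: G_map_cls subset_iff)
  finally show "pullback p (cls A (\<Squnion>\<^bsub>natural_order A\<^esub> S)) \<longleftrightarrow> (\<exists>a\<in>S. pullback p (cls A a))" .
qed

lemma preimage_G_map: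
  "a \<in> carrier A \<Longrightarrow> preimage (point_space B) pullback (basic_open A a) = basic_open B (\<phi> a)"
  by (auto simp: basic_open_def G_map_cls G_map_in_points)

lemma continuous_G_map: "continuous_map (point_space B) (point_space A) pullback"
  unfolding continuous_map_def
proof (intro conjI allI impI)
  show "pullback \<in> topspace (point_space B) \<rightarrow> topspace (point_space A)"
    using G_map_in_points by simp
  fix U assume "openin (point_space A) U"
  then obtain a where "a \<in> carrier A" "U = basic_open A a"
    unfolding A.openin_point_space by (elim bexE)
  then show "openin (point_space B) (preimage (point_space B) pullback U)"
    by (simp only: preimage_G_map B.openin_basic_open phi_in)
qed

lemma germ_rel_phi:
  assumes p: "p \<in> points B" and ab: "(a, b) \<in> germ_rel A (pullback p)"
  shows "(\<phi> a, \<phi> b) \<in> germ_rel B p"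
proof -
  obtain c d where *: "a \<in> carrier A" "b \<in> carrier A" "c \<in> carrier A" "d \<in> carrier A"
      "pullback p (cls A a)" "pullback p (cls A b)" "\<not> pullback p (cls A c)" "pullback p (cls A d)"
      "(a \<curlywedge>\<^bsub>A\<^esub> d) \<curlyvee>\<^bsub>A\<^esub> c = (b \<curlywedge>\<^bsub>A\<^esub> d) \<curlyvee>\<^bsub>A\<^esub> c"
    using ab unfolding germ_rel_def by blast
  have "(\<phi> a \<curlywedge>\<^bsub>B\<^esub> \<phi> d) \<curlyvee>\<^bsub>B\<^esub> \<phi> c = (\<phi> b \<curlywedge>\<^bsub>B\<^esub> \<phi> d) \<curlyvee>\<^bsub>B\<^esub> \<phi> c"
    using * by (simp flip: ncf_homD(2,3)[OF hom])
  moreover have "p (cls B (\<phi> a))" "p (cls B (\<phi> b))" "\<not> p (cls B (\<phi> c))" "p (cls B (\<phi> d))"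
    using * p by (simp_all flip: G_map_cls)
  ultimately show ?thesis
    unfolding germ_rel_def using *(1-4) phi_in by blast
qed

lemma G_mor_spec:
  shows "snd (G_mor A B \<phi>) \<in> sheaf_hom (front (point_space A)) (snd (G_obj A))
      (direct_image (point_space B) pullback (snd (G_obj B)))"
    and "a \<in> carrier A \<Longrightarrow> snd (G_mor A B \<phi>) (basic_open A a) (basic_section A a) = basic_section B (\<phi> a)"
proof -
  have sec: "basic_section B (\<phi> a) \<in> sections (snd (G_obj B)) (preimage (point_space B) pullback (basic_open A a))"
    if "a \<in> carrier A" for a
    using that B.basic_section_in_G[of "\<phi> a"] by (simp only: preimage_G_map phi_in)
  have germs: "germ (front (point_space B)) (snd (G_obj B)) (preimage (point_space B) pullback (basic_open A a))
        (basic_section B (\<phi> a)) p =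
      germ (front (point_space B)) (snd (G_obj B)) (preimage (point_space B) pullback (basic_open A b))
        (basic_section B (\<phi> b)) p"
    if "a \<in> carrier A" "b \<in> carrier A" "p \<in> topspace (point_space B)" "(a, b) \<in> germ_rel A (pullback p)" for a b p
    unfolding preimage_G_map[OF that(1)] preimage_G_map[OF that(2)]
    using that(3,4) by (intro B.germ_basic_section_eq germ_rel_phi) simp_all
  note the = A.sheaf_hom_from_G_the[of "point_space B" "snd (G_obj B)" pullback "\<lambda>a. basic_section B (\<phi> a)",
      OF B.G_is_sheaf continuous_G_map sec germs]
  have eq: "snd (G_mor A B \<phi>) = (THE l. l \<in> sheaf_hom (front (point_space A)) (snd (G_obj A))
        (direct_image (point_space B) pullback (snd (G_obj B))) \<and>
      (\<forall>a\<in>carrier A. l (basic_open A a) (basic_section A a) = basic_section B (\<phi> a)))"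
    by (simp add: G_mor_def)
  show "snd (G_mor A B \<phi>) \<in> sheaf_hom (front (point_space A)) (snd (G_obj A))
      (direct_image (point_space B) pullback (snd (G_obj B)))"
    unfolding eq by (rule the(1))
  show "snd (G_mor A B \<phi>) (basic_open A a) (basic_section A a) = basic_section B (\<phi> a)"
    if "a \<in> carrier A"
    unfolding eq by (rule the(2)) (simp_all add: that)
qed

lemma fst_G_mor [simp]: "fst (G_mor A B \<phi>) = pullback"
  by (simp add: G_mor_def)

lemma G_mor_in_Sh_hom: "G_mor A B \<phi> \<in> Sh_hom (G_obj B) (G_obj A)"
proof -
  have "pullback \<in> extensional (points B)"
    by (simp add: G_map_def)
  then show ?thesis
    using continuous_G_map G_mor_spec(1) unfolding Sh_hom_def
    by (simp add: case_prod_beta)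
qed

end

section \<open>The natural morphism from a sheaf to its sheaf of germs\<close>

context sheafed_space
begin

lemma hat_eq: "hat X = restrict (eval_point (H_obj X) (stalk_map X)) (topspace Y)"
  by (simp add: hat_def eval_point_def case_prod_beta restrict_def fun_eq_iff)

lemma hat_cls:
  "y \<in> topspace Y \<Longrightarrow> a \<in> carrier (H_obj X) \<Longrightarrow> hat X y (cls (H_obj X) a) \<longleftrightarrow> y \<in> fst a"
  by (simp add: hat_eq H.eval_point_cls)

lemma continuous_hat: "continuous_map Y (point_space (H_obj X)) (hat X)"
  by (rule continuous_map_eq[OF H.continuous_eval_point]) (simp add: hat_eq)

lemma preimage_hat: "a \<in> carrier (H_obj X) \<Longrightarrow> preimage Y (hat X) (basic_open (H_obj X) a) = fst a"
  using H.preimage_eval_point[of a] by (simp add: hat_eq cong: conj_cong)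

text \<open>
  The universal property applies to \<open>\<mu> (U, s) = s\<close>, since germs related at the point of \<open>y\<close> have the same
  value at \<open>y\<close>, that is, the same germ in the given sheaf.
\<close>

lemma to_GH_spec:
  shows "snd (to_GH X) \<in> sheaf_hom (front (point_space (H_obj X))) (snd (G_obj (H_obj X)))
      (direct_image Y (hat X) E)"
    and "a \<in> carrier (H_obj X) \<Longrightarrow>
      snd (to_GH X) (basic_open (H_obj X) a) (basic_section (H_obj X) a) = snd a"
proof -
  have sec: "snd a \<in> sections E (preimage Y (hat X) (basic_open (H_obj X) a))"
    if "a \<in> carrier (H_obj X)" for a
    unfolding preimage_hat[OF that] using that by (auto simp: carrier_H)
  have germs: "germ (front Y) E (preimage Y (hat X) (basic_open (H_obj X) a)) (snd a) y =
      germ (front Y) E (preimage Y (hat X) (basic_open (H_obj X) b)) (snd b) y"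
    if "a \<in> carrier (H_obj X)" "b \<in> carrier (H_obj X)" "y \<in> topspace Y"
      "(a, b) \<in> germ_rel (H_obj X) (hat X y)" for a b y
  proof -
    have ab: "(a, b) \<in> germ_rel (H_obj X) (eval_point (H_obj X) (stalk_map X) y)"
      using that by (simp add: hat_eq)
    then have "y \<in> fst a" "y \<in> fst b"
      using that by (simp_all add: H.germ_rel_iff H.eval_point_cls)
    moreover have "stalk_map X a y = stalk_map X b y"
      using that(3) ab by (rule H.germ_rel_eval_point)
    ultimately show ?thesis
      unfolding preimage_hat[OF that(1)] preimage_hat[OF that(2)]
      by (simp add: stalk_map_def case_prod_beta)
  qed
  note the = H.sheaf_hom_from_G_the[of Y E "hat X" snd, OF sheaf continuous_hat sec germs]
  have eq: "snd (to_GH X) = (THE l. l \<in> sheaf_hom (front (point_space (H_obj X)))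
        (snd (G_obj (H_obj X))) (direct_image Y (hat X) E) \<and>
      (\<forall>a\<in>carrier (H_obj X). l (basic_open (H_obj X) a) (basic_section (H_obj X) a) = snd a))"
    by (simp add: to_GH_def case_prod_beta)
  show "snd (to_GH X) \<in> sheaf_hom (front (point_space (H_obj X))) (snd (G_obj (H_obj X)))
      (direct_image Y (hat X) E)"
    unfolding eq by (rule the(1))
  show "snd (to_GH X) (basic_open (H_obj X) a) (basic_section (H_obj X) a) = snd a"
    if "a \<in> carrier (H_obj X)"
    unfolding eq by (rule the(2)) (simp_all add: that)
qed

lemma fst_to_GH [simp]: "fst (to_GH X) = hat X"
  by (simp add: to_GH_def)

lemma to_GH_in_Sh_hom: "to_GH X \<in> Sh_hom X (G_obj (H_obj X))"
proof -
  have "hat X \<in> extensional (topspace Y)"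
    by (simp add: hat_eq)
  then show ?thesis
    using continuous_hat to_GH_spec(1) unfolding Sh_hom_def
    by (simp add: case_prod_beta)
qed

end


section \<open>Morphisms of sheaves over spaces\<close>

lemma Sh_homD:
  assumes "m \<in> Sh_hom X X'"
  shows "fst m \<in> extensional (topspace (fst X))"
    and "continuous_map (fst X) (fst X') (fst m)"
    and "snd m \<in> sheaf_hom (front (fst X')) (snd X') (direct_image (fst X) (fst m) (snd X))"
    and "openin (front (fst X')) V \<Longrightarrow> s \<in> sections (snd X') V \<Longrightarrow>
      snd m V s \<in> sections (snd X) (preimage (fst X) (fst m) V)"
    and "openin (front (fst X')) U \<Longrightarrow> openin (front (fst X')) V \<Longrightarrow> V \<subseteq> U \<Longrightarrow> s \<in> sections (snd X') U \<Longrightarrow>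
      restr (snd X) (preimage (fst X) (fst m) U) (preimage (fst X) (fst m) V) (snd m U s) =
      snd m V (restr (snd X') U V s)"
  using assms by (auto simp: Sh_hom_def sheaf_hom_def direct_image_def PiE_iff Pi_iff)

lemma preimage_compose:
  assumes "continuous_map X1 X2 f"
  shows "preimage X1 (compose (topspace X1) g f) V = preimage X1 f (preimage X2 g V)"
  using continuous_map_image_subset_topspace[OF assms] by (auto simp: compose_def)

lemma Sh_comp_fst: "y \<in> topspace (fst X1) \<Longrightarrow> fst (Sh_comp X1 X2 X3 n m) y = fst n (fst m y)"
  by (simp add: Sh_comp_def compose_def)

lemma Sh_comp_snd:
  "openin (front (fst X3)) V \<Longrightarrow> s \<in> sections (snd X3) V \<Longrightarrow>
   snd (Sh_comp X1 X2 X3 n m) V s = snd m (preimage (fst X2) (fst n) V) (snd n V s)"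
  by (simp add: Sh_comp_def compose_def)

lemma Sh_comp_in_Sh_hom:
  assumes X3: "Sh_obj X3" and m: "m \<in> Sh_hom X1 X2" and n: "n \<in> Sh_hom X2 X3"
  shows "Sh_comp X1 X2 X3 n m \<in> Sh_hom X1 X3"
proof -
  interpret X3: sheafed_space X3
    using X3 by unfold_locales
  let ?f = "compose (topspace (fst X1)) (fst n) (fst m)"
  let ?l = "snd (Sh_comp X1 X2 X3 n m)"
  have fst: "fst (Sh_comp X1 X2 X3 n m) = ?f"
    by (simp add: Sh_comp_def)
  have pre: "preimage (fst X1) ?f V = preimage (fst X1) (fst m) (preimage (fst X2) (fst n) V)" for V
    using Sh_homD(2)[OF m] by (rule preimage_compose)
  have pre_open: "openin (front (fst X2)) (preimage (fst X2) (fst n) V)"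
    if "openin (front (fst X3)) V" for V
    using Sh_homD(2)[OF n] that by (rule openin_front_preimage)
  have "continuous_map (fst X1) (fst X3) (fst n \<circ> fst m)"
    using Sh_homD(2)[OF m] Sh_homD(2)[OF n] by (rule continuous_map_compose)
  then have "continuous_map (fst X1) (fst X3) ?f"
    by (rule continuous_map_eq) (simp add: compose_def)
  moreover have "?l \<in> sheaf_hom (front (fst X3)) (snd X3) (direct_image (fst X1) ?f (snd X1))"
    unfolding sheaf_hom_def mem_Collect_eq
  proof (intro conjI allI impI ballI)
    show "?l \<in> (\<Pi>\<^sub>E V\<in>{V. openin (front (fst X3)) V}. sections (snd X3) V \<rightarrow>\<^sub>E
        sections (direct_image (fst X1) ?f (snd X1)) V)"
    proof (rule PiE_I)
      fix V assume V: "V \<in> {V. openin (front (fst X3)) V}"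
      show "?l V \<in> sections (snd X3) V \<rightarrow>\<^sub>E sections (direct_image (fst X1) ?f (snd X1)) V"
      proof (rule PiE_I)
        fix s assume s: "s \<in> sections (snd X3) V"
        have "snd m (preimage (fst X2) (fst n) V) (snd n V s)
            \<in> sections (snd X1) (preimage (fst X1) (fst m) (preimage (fst X2) (fst n) V))"
          using V s by (intro Sh_homD(4)[OF m] Sh_homD(4)[OF n] pre_open) simp_all
        then show "?l V s \<in> sections (direct_image (fst X1) ?f (snd X1)) V"
          using V s by (simp only: Sh_comp_snd mem_Collect_eq direct_image_def presheaf.simps pre)
      qed (use V in \<open>simp add: Sh_comp_def compose_def\<close>)
    qed (simp add: Sh_comp_def)
    fix U V s assume UV: "openin (front (fst X3)) U \<and> openin (front (fst X3)) V \<and> V \<subseteq> U"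
      and s: "s \<in> sections (snd X3) U"
    let ?U = "preimage (fst X2) (fst n) U" and ?V = "preimage (fst X2) (fst n) V"
    have "restr (snd X1) (preimage (fst X1) (fst m) ?U) (preimage (fst X1) (fst m) ?V)
        (snd m ?U (snd n U s)) = snd m ?V (restr (snd X2) ?U ?V (snd n U s))"
      using UV s by (intro Sh_homD(5)[OF m] Sh_homD(4)[OF n] pre_open) auto
    also have "restr (snd X2) ?U ?V (snd n U s) = snd n V (restr (snd X3) U V s)"
      using UV s by (intro Sh_homD(5)[OF n]) auto
    finally have "restr (snd X1) (preimage (fst X1) ?f U) (preimage (fst X1) ?f V) (?l U s) =
        ?l V (restr (snd X3) U V s)"
      unfolding pre using UV s X3.restr_closed by (simp add: Sh_comp_snd)
    then show "restr (direct_image (fst X1) ?f (snd X1)) U V (?l U s) = ?l V (restr (snd X3) U V s)"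
      by (simp only: direct_image_def presheaf.simps)
  qed
  moreover have "?f \<in> extensional (topspace (fst X1))"
    by simp
  ultimately show ?thesis
    unfolding Sh_hom_def by (simp add: case_prod_beta fst)
qed

lemma (in sheafed_space) Sh_id_in_Sh_hom: "Sh_id X \<in> Sh_hom X X"
proof -
  have pre: "preimage Y (\<lambda>y\<in>topspace Y. y) V = V" if "openin (front Y) V" for V
    using openin_subset[OF that] by auto
  have "continuous_map Y Y (\<lambda>y\<in>topspace Y. y)"
    by (rule continuous_map_eq[OF continuous_map_id]) simp
  moreover have "snd (Sh_id X) \<in> sheaf_hom (front Y) E (direct_image Y (\<lambda>y\<in>topspace Y. y) E)"
  proof -
    have id: "snd (Sh_id X) V s = s" if "openin (front Y) V" "s \<in> sections E V" for V s
      using that by (simp add: Sh_id_def)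
    have "snd (Sh_id X) \<in> (\<Pi>\<^sub>E V\<in>{V. openin (front Y) V}. sections E V \<rightarrow>\<^sub>E sections E V)"
      by (auto simp: Sh_id_def)
    then have "snd (Sh_id X) \<in> (\<Pi>\<^sub>E V\<in>{V. openin (front Y) V}. sections E V \<rightarrow>\<^sub>E
        sections (direct_image Y (\<lambda>y\<in>topspace Y. y) E) V)"
      by (rule back_subst[of "\<lambda>S. snd (Sh_id X) \<in> S"])
        (intro PiE_cong, simp only: direct_image_def presheaf.simps pre mem_Collect_eq)
    moreover have "restr (direct_image Y (\<lambda>y\<in>topspace Y. y) E) U V = restr E U V"
      if "openin (front Y) U" "openin (front Y) V" for U V
      unfolding direct_image_def presheaf.simps pre[OF that(1)] pre[OF that(2)] ..
    ultimately show ?thesis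
      unfolding sheaf_hom_def mem_Collect_eq using id restr_closed by simp
  qed
  ultimately show ?thesis
    unfolding Sh_hom_def by (simp add: case_prod_beta Sh_id_def)
qed

text \<open>
  This reduces functoriality of \<open>G\<close>, naturality and the triangle identities to generators: a morphism to \<open>G(A)\<close> is
  known once its points are known on the classes \<open>[a]\<close> and its sheaf part on the sections \<open>s\<^sub>a\<close>.
\<close>

lemma (in section_algebra) Sh_hom_into_G_eqI:
  assumes X: "Sh_obj X" and m: "m \<in> Sh_hom X (G_obj A)" and n: "n \<in> Sh_hom X (G_obj A)"
    and fst: "\<And>y a. y \<in> topspace (fst X) \<Longrightarrow> a \<in> carrier A \<Longrightarrow> fst m y (cls A a) = fst n y (cls A a)"
    and snd: "\<And>a. a \<in> carrier A \<Longrightarrow>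
      snd m (basic_open A a) (basic_section A a) = snd n (basic_open A a) (basic_section A a)"
  shows "m = n"
proof -
  have cont: "continuous_map (fst X) (point_space A) (fst m)" "continuous_map (fst X) (point_space A) (fst n)"
    using Sh_homD(2)[OF m] Sh_homD(2)[OF n] by simp_all
  have eq: "fst m = fst n"
  proof (rule extensionalityI[OF Sh_homD(1)[OF m] Sh_homD(1)[OF n]])
    fix y assume y: "y \<in> topspace (fst X)"
    show "fst m y = fst n y"
    proof (rule point_eqI)
      show "fst m y \<in> points A" "fst n y \<in> points A"
        using cont y by (auto simp: continuous_map_def)
    qed (use fst y in simp)
  qed
  moreover have "snd m = snd n"
  proof (rule sheaf_hom_from_G_eqI)
    show "is_sheaf (front (fst X)) (snd X)"
      using X by (simp add: Sh_obj_def)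
    show "snd m \<in> sheaf_hom (front (point_space A)) (snd (G_obj A)) (direct_image (fst X) (fst m) (snd X))"
      "snd n \<in> sheaf_hom (front (point_space A)) (snd (G_obj A)) (direct_image (fst X) (fst m) (snd X))"
      using Sh_homD(3)[OF m] Sh_homD(3)[OF n] eq by simp_all
  qed (use cont snd in simp_all)
  ultimately show ?thesis
    by (simp add: prod_eq_iff)
qed

section \<open>The functor H\<close>

lemma H_mor_apply:
  "(U, s) \<in> carrier (H_obj X') \<Longrightarrow> H_mor X X' m (U, s) = (preimage (fst X) (fst m) U, snd m U s)"
  by (simp add: H_mor_def)

text \<open>
  The germ of \<open>\<lambda> s\<close> at \<open>y\<close> depends only on the germ of \<open>s\<close> at \<open>f y\<close>, by naturality of \<open>\<lambda>\<close>, so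
  \<open>pointwise_ncf_hom\<close> applies.
\<close>

lemma H_mor_hom:
  assumes X: "Sh_obj X" and X': "Sh_obj X'" and m: "m \<in> Sh_hom X X'"
  shows "H_mor X X' m \<in> ncf_hom (H_obj X') (H_obj X)"
proof -
  interpret X: sheafed_space X
    using X by unfold_locales
  interpret X': sheafed_space X'
    using X' by unfold_locales
  interpret pair: section_algebra_pair "H_obj X'" "fst X'" "stalk_map X'" "H_obj X" "fst X" "stalk_map X" ..
  let ?pre = "preimage (fst X) (fst m)"
  note cont = Sh_homD(2)[OF m]
  have app: "H_mor X X' m a = (?pre (fst a), snd m (fst a) (snd a))" if "a \<in> carrier (H_obj X')" for a
    using that H_mor_apply[of "fst a" "snd a"] by simp
  have a: "openin (fst X') (fst a)" "snd a \<in> sections (snd X') (fst a)"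
      "openin (front (fst X')) (fst a)" "openin (front (fst X)) (?pre (fst a))"
      "snd m (fst a) (snd a) \<in> sections (snd X) (?pre (fst a))" if "a \<in> carrier (H_obj X')" for a
  proof -
    show *: "openin (fst X') (fst a)" "snd a \<in> sections (snd X') (fst a)"
      using that by (auto simp: X'.carrier_H)
    show **: "openin (front (fst X')) (fst a)"
      using *(1) by (rule openin_imp_openin_front)
    show "openin (front (fst X)) (?pre (fst a))"
      using cont ** by (rule openin_front_preimage)
    show "snd m (fst a) (snd a) \<in> sections (snd X) (?pre (fst a))"
      using m ** *(2) by (rule Sh_homD(4))
  qed
  show ?thesis
  proof (rule pair.pointwise_ncf_hom[of _ "fst m"])
    show "H_mor X X' m \<in> extensional (carrier (H_obj X'))"
      by (simp add: H_mor_def)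
    show "H_mor X X' m a \<in> carrier (H_obj X)" if "a \<in> carrier (H_obj X')" for a
      using a[OF that] cont by (simp add: app[OF that] X.carrier_H continuous_map_def)
    show "fst m \<in> topspace (fst X) \<rightarrow> topspace (fst X')"
      using cont by (simp add: continuous_map_def)
    show "dom (stalk_map X (H_mor X X' m a)) = ?pre (dom (stalk_map X' a))"
      if "a \<in> carrier (H_obj X')" for a
      by (simp add: app[OF that])
    fix a b y
    assume ab: "a \<in> carrier (H_obj X')" "b \<in> carrier (H_obj X')" and y: "y \<in> topspace (fst X)"
      and fy: "fst m y \<in> dom (stalk_map X' a)" and eq: "stalk_map X' a (fst m y) = stalk_map X' b (fst m y)"
    have "fst m y \<in> dom (stalk_map X' b)"
      using fy eq by (metis domIff)
    with fy have in_ab: "fst m y \<in> fst a" "fst m y \<in> fst b"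
      by (simp_all only: dom_stalk_map)
    then have "germ (front (fst X')) (snd X') (fst a) (snd a) (fst m y) =
        germ (front (fst X')) (snd X') (fst b) (snd b) (fst m y)"
      using eq by (simp add: stalk_map_def case_prod_beta)
    then obtain Z where Z: "openin (front (fst X')) Z" "fst m y \<in> Z" "Z \<subseteq> fst a" "Z \<subseteq> fst b"
        "restr (snd X') (fst a) Z (snd a) = restr (snd X') (fst b) Z (snd b)"
      using in_ab a[OF ab(1)] a[OF ab(2)]
        X'.germ_eq_iff[of "fst a" "fst b" "snd a" "snd b" "fst m y"] by auto
    have "restr (snd X) (?pre (fst a)) (?pre Z) (snd m (fst a) (snd a)) =
        restr (snd X) (?pre (fst b)) (?pre Z) (snd m (fst b) (snd b))"
      using Sh_homD(5)[OF m a(3)[OF ab(1)] Z(1,3) a(2)[OF ab(1)]]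
        Sh_homD(5)[OF m a(3)[OF ab(2)] Z(1,4) a(2)[OF ab(2)]] Z(5) by simp
    moreover have "openin (front (fst X)) (?pre Z)"
      using cont Z(1) by (rule openin_front_preimage)
    moreover have "y \<in> ?pre Z" "?pre Z \<subseteq> ?pre (fst a) \<inter> ?pre (fst b)"
      using y Z by auto
    ultimately have "germ (front (fst X)) (snd X) (?pre (fst a)) (snd m (fst a) (snd a)) y =
        germ (front (fst X)) (snd X) (?pre (fst b)) (snd m (fst b) (snd b)) y"
      using y in_ab a[OF ab(1)] a[OF ab(2)] by (subst X.germ_eq_iff) auto
    then show "stalk_map X (H_mor X X' m a) y = stalk_map X (H_mor X X' m b) y"
      using y in_ab by (simp add: app[OF ab(1)] app[OF ab(2)] stalk_map_def)
  qed
qed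

lemma H_mor_id:
  assumes "Sh_obj X"
  shows "H_mor X X (Sh_id X) = ncf_id (H_obj X)"
proof (rule extensionalityI)
  interpret sheafed_space X
    using assms by unfold_locales
  fix a assume a: "a \<in> carrier (H_obj X)"
  then obtain U s where Us: "a = (U, s)" "openin Y U" "s \<in> sections E U"
    by (auto simp: carrier_H)
  have "preimage Y (fst (Sh_id X)) U = U"
    using openin_subset[OF Us(2)] by (auto simp: Sh_id_def)
  then show "H_mor X X (Sh_id X) a = ncf_id (H_obj X) a"
    using a Us openin_imp_openin_front[of Y U] by (simp add: H_mor_apply ncf_id_def Sh_id_def)
qed (simp_all add: H_mor_def ncf_id_def)

lemma H_mor_comp:
  assumes X2: "Sh_obj X2" and X3: "Sh_obj X3" and m: "m \<in> Sh_hom X1 X2" and n: "n \<in> Sh_hom X2 X3"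
  shows "H_mor X1 X3 (Sh_comp X1 X2 X3 n m) = ncf_comp (H_obj X3) (H_mor X1 X2 m) (H_mor X2 X3 n)"
proof (rule extensionalityI)
  interpret X2: sheafed_space X2
    using X2 by unfold_locales
  interpret X3: sheafed_space X3
    using X3 by unfold_locales
  fix a assume a: "a \<in> carrier (H_obj X3)"
  then obtain U s where Us: "a = (U, s)" "openin (fst X3) U" "s \<in> sections (snd X3) U"
    by (auto simp: X3.carrier_H)
  have Uf: "openin (front (fst X3)) U"
    using Us(2) by (rule openin_imp_openin_front)
  have "H_mor X2 X3 n a \<in> carrier (H_obj X2)"
    using ncf_homD(1)[OF H_mor_hom[OF X2 X3 n] a] .
  then have "(preimage (fst X2) (fst n) U, snd n U s) \<in> carrier (H_obj X2)"
    using a by (simp add: Us H_mor_apply)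
  moreover have "fst (Sh_comp X1 X2 X3 n m) = compose (topspace (fst X1)) (fst n) (fst m)"
    by (simp add: Sh_comp_def)
  ultimately show "H_mor X1 X3 (Sh_comp X1 X2 X3 n m) a =
      ncf_comp (H_obj X3) (H_mor X1 X2 m) (H_mor X2 X3 n) a"
    using a preimage_compose[OF Sh_homD(2)[OF m], of "fst n" U]
    by (simp only: Us(1) compose_eq H_mor_apply Sh_comp_snd[OF Uf Us(3)])
qed (simp_all add: H_mor_def)


section \<open>Spatial frames and the equivalence\<close>

text \<open>
  The germs of a sheaf that witnesses spatiality serve as values on \<open>A\<close>, transported along the isomorphism.
\<close>

lemma spatial_section_algebra:
  assumes "spatial_frame TYPE('y) TYPE('s) A"
  shows "\<exists>(Y :: 'y topology) (v :: 'a \<Rightarrow> 'y \<rightharpoonup> ('y set \<times> 's) set). section_algebra A Y v"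
proof -
  obtain X :: "('y, 's) sheaf_space" and \<phi> where A: "left_handed_nc_frame A"
    and X: "Sh_obj X" and iso: "ncf_iso A (H_obj X) \<phi>"
    using assms unfolding spatial_frame_def by blast
  interpret A: left_handed_nc_frame A by (rule A)
  interpret X: sheafed_space X
    using X by unfold_locales
  obtain \<psi> where \<phi>: "\<phi> \<in> ncf_hom A (H_obj X)" and \<psi>: "\<psi> \<in> ncf_hom (H_obj X) A"
    and comp: "ncf_comp A \<psi> \<phi> = ncf_id A" "ncf_comp (H_obj X) \<phi> \<psi> = ncf_id (H_obj X)"
    using iso unfolding ncf_iso_def by blast
  have \<psi>\<phi>: "\<psi> (\<phi> a) = a" if "a \<in> carrier A" for a
    using fun_cong[OF comp(1), of a] that by (simp add: compose_eq ncf_id_def)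
  have \<phi>\<psi>: "\<phi> (\<psi> b) = b" if "b \<in> carrier (H_obj X)" for b
    using fun_cong[OF comp(2), of b] that by (simp add: compose_eq ncf_id_def)
  note \<phi>_hom = ncf_homD[OF \<phi>] and \<psi>_in = ncf_homD(1)[OF \<psi>]
  let ?v = "\<lambda>a. stalk_map X (\<phi> a)"
  have "section_algebra A (fst X) ?v"
  proof
    show "inj_on ?v (carrier A)"
    proof (rule inj_onI)
      fix a b assume ab: "a \<in> carrier A" "b \<in> carrier A" and "?v a = ?v b"
      then have eq: "\<phi> a = \<phi> b"
        by (intro X.H.val_eqI \<phi>_hom(1))
      have "a = \<psi> (\<phi> a)"
        by (rule \<psi>\<phi>[OF ab(1), symmetric])
      also have "\<dots> = b"
        unfolding eq by (rule \<psi>\<phi>[OF ab(2)])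
      finally show "a = b" .
    qed
    show "\<exists>a\<in>carrier A. dom (?v a) = topspace (fst X)"
      using X.H.global \<phi>\<psi> \<psi>_in by metis
    fix f :: "'y \<rightharpoonup> ('y set \<times> 's) set"
    assume op: "openin (fst X) (dom f)"
      and loc: "\<And>y. y \<in> dom f \<Longrightarrow> \<exists>a\<in>carrier A. \<exists>Z. openin (front (fst X)) Z \<and> y \<in> Z \<and>
        Z \<subseteq> dom f \<and> (\<forall>z\<in>Z. ?v a z = f z)"
    have "\<exists>b\<in>carrier (H_obj X). stalk_map X b = f"
      using op
    proof (rule X.H.glue)
      show "\<exists>b\<in>carrier (H_obj X). \<exists>Z. openin (front (fst X)) Z \<and> y \<in> Z \<and>
          Z \<subseteq> dom f \<and> (\<forall>z\<in>Z. stalk_map X b z = f z)" if "y \<in> dom f" for y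
        using loc[OF that] \<phi>_hom(1) by metis
    qed
    then show "\<exists>a\<in>carrier A. ?v a = f"
      using \<phi>\<psi> \<psi>_in by metis
  qed (simp_all add: A.meet_closed A.join_closed A.zero_closed \<phi>_hom X.H.openin_dom del: dom_stalk_map)
  then show ?thesis
    by metis
qed

lemma H_obj_spatial:
  fixes X :: "('y, 's) sheaf_space"
  assumes "Sh_obj X"
  shows "spatial_frame TYPE('y) TYPE('s) (H_obj X)"
proof -
  interpret sheafed_space X
    using assms by unfold_locales
  show ?thesis
    unfolding spatial_frame_def using assms H.left_handed_nc_frame ncf_id_hom[OF H.section_algebra_axioms]
    by blast
qed

lemma G_mor_id:
  assumes "section_algebra A Y v"
  shows "G_mor A A (ncf_id A) = Sh_id (G_obj A)"
proof -
  interpret A: section_algebra A Y v by (rule assms)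
  have "ncf_id A \<in> ncf_hom A A"
    using ncf_id_hom[OF assms] by (simp add: ncf_iso_def)
  then interpret ncf_morphism A Y v A Y v "ncf_id A"
    by unfold_locales
  show ?thesis
  proof (rule A.Sh_hom_into_G_eqI[OF A.Sh_obj_G G_mor_in_Sh_hom])
    show "Sh_id (G_obj A) \<in> Sh_hom (G_obj A) (G_obj A)"
      by (rule sheafed_space.Sh_id_in_Sh_hom[OF A.sheafed_space_G])
    fix p a assume "p \<in> topspace (fst (G_obj A))" "a \<in> carrier A"
    then show "fst (G_mor A A (ncf_id A)) p (cls A a) = fst (Sh_id (G_obj A)) p (cls A a)"
      by (simp add: G_map_cls Sh_id_def) (simp add: ncf_id_def)
  next
    fix a assume "a \<in> carrier A"
    then show "snd (G_mor A A (ncf_id A)) (basic_open A a) (basic_section A a) =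
        snd (Sh_id (G_obj A)) (basic_open A a) (basic_section A a)"
      using A.openin_front_basic_open A.basic_section_in_G
      by (simp add: G_mor_spec(2) Sh_id_def) (simp add: ncf_id_def)
  qed
qed

lemma G_mor_comp:
  assumes A1: "section_algebra A1 Y1 v1" and A2: "section_algebra A2 Y2 v2"
    and A3: "section_algebra A3 Y3 v3" and \<phi>: "\<phi> \<in> ncf_hom A1 A2" and \<psi>: "\<psi> \<in> ncf_hom A2 A3"
  shows "G_mor A1 A3 (ncf_comp A1 \<psi> \<phi>) =
    Sh_comp (G_obj A3) (G_obj A2) (G_obj A1) (G_mor A1 A2 \<phi>) (G_mor A2 A3 \<psi>)"
proof -
  let ?C = "Sh_comp (G_obj A3) (G_obj A2) (G_obj A1) (G_mor A1 A2 \<phi>) (G_mor A2 A3 \<psi>)"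
  interpret A1: section_algebra A1 Y1 v1 by (rule A1)
  interpret A2: section_algebra A2 Y2 v2 by (rule A2)
  interpret A3: section_algebra A3 Y3 v3 by (rule A3)
  interpret phi: ncf_morphism A1 Y1 v1 A2 Y2 v2 \<phi>
    using \<phi> by unfold_locales
  interpret psi: ncf_morphism A2 Y2 v2 A3 Y3 v3 \<psi>
    using \<psi> by unfold_locales
  interpret comp: ncf_morphism A1 Y1 v1 A3 Y3 v3 "ncf_comp A1 \<psi> \<phi>"
    using ncf_comp_hom[OF A1 \<phi> \<psi>] by unfold_locales
  show ?thesis
  proof (rule A1.Sh_hom_into_G_eqI[OF A3.Sh_obj_G comp.G_mor_in_Sh_hom])
    show "?C
        \<in> Sh_hom (G_obj A3) (G_obj A1)"
      by (rule Sh_comp_in_Sh_hom[OF A1.Sh_obj_G psi.G_mor_in_Sh_hom phi.G_mor_in_Sh_hom])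
    fix p a assume p: "p \<in> topspace (fst (G_obj A3))" and a: "a \<in> carrier A1"
    then show "fst (G_mor A1 A3 (ncf_comp A1 \<psi> \<phi>)) p (cls A1 a) =
        fst (?C) p (cls A1 a)"
      by (simp add: Sh_comp_fst comp.G_map_cls phi.G_map_cls psi.G_map_cls psi.G_map_in_points compose_eq)
  next
    fix a assume a: "a \<in> carrier A1"
    have "snd (?C)
          (basic_open A1 a) (basic_section A1 a) =
        snd (G_mor A2 A3 \<psi>) (preimage (point_space A2) phi.pullback (basic_open A1 a))
          (basic_section A2 (\<phi> a))"
      using a A1.openin_front_basic_open A1.basic_section_in_G
      by (subst Sh_comp_snd) (simp_all add: phi.G_mor_spec(2))
    also have "\<dots> = basic_section A3 (\<psi> (\<phi> a))"
      unfolding phi.preimage_G_map[OF a] using a by (simp add: psi.G_mor_spec(2))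
    finally show "snd (G_mor A1 A3 (ncf_comp A1 \<psi> \<phi>)) (basic_open A1 a) (basic_section A1 a) =
        snd (?C)
          (basic_open A1 a) (basic_section A1 a)"
      using a by (simp add: comp.G_mor_spec(2) compose_eq)
  qed
qed

text \<open>
  On \<open>s\<^bsub>(U, s)\<^esub>\<close> both composites are \<open>\<lambda> s\<close>, where \<open>m = (f, \<lambda>)\<close>.
\<close>

lemma to_GH_natural:
  assumes X1: "Sh_obj X1" and X2: "Sh_obj X2" and m: "m \<in> Sh_hom X1 X2"
  shows "Sh_comp X1 X2 (G_obj (H_obj X2)) (to_GH X2) m =
    Sh_comp X1 (G_obj (H_obj X1)) (G_obj (H_obj X2))
      (G_mor (H_obj X2) (H_obj X1) (H_mor X1 X2 m)) (to_GH X1)"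
proof -
  let ?L = "Sh_comp X1 X2 (G_obj (H_obj X2)) (to_GH X2) m"
  let ?R = "Sh_comp X1 (G_obj (H_obj X1)) (G_obj (H_obj X2)) (G_mor (H_obj X2) (H_obj X1) (H_mor X1 X2 m)) (to_GH X1)"
  interpret X1: sheafed_space X1
    using X1 by unfold_locales
  interpret X2: sheafed_space X2
    using X2 by unfold_locales
  interpret Hm: ncf_morphism "H_obj X2" "fst X2" "stalk_map X2" "H_obj X1" "fst X1" "stalk_map X1" "H_mor X1 X2 m"
    using H_mor_hom[OF X1 X2 m] by unfold_locales
  have app: "H_mor X1 X2 m a = (preimage (fst X1) (fst m) (fst a), snd m (fst a) (snd a))"
    if "a \<in> carrier (H_obj X2)" for a
    using that H_mor_apply[of "fst a" "snd a"] by simp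
  have m_in: "fst m y \<in> topspace (fst X2)" if "y \<in> topspace (fst X1)" for y
    using Sh_homD(2)[OF m] that by (auto simp: continuous_map_def)
  have hat_in: "hat X1 y \<in> points (H_obj X1)" if "y \<in> topspace (fst X1)" for y
    using X1.continuous_hat that by (auto simp: continuous_map_def)
  show ?thesis
  proof (rule X2.H.Sh_hom_into_G_eqI[OF X1])
    show "?L \<in> Sh_hom X1 (G_obj (H_obj X2))"
      by (rule Sh_comp_in_Sh_hom[OF X2.H.Sh_obj_G m X2.to_GH_in_Sh_hom])
    show "?R \<in> Sh_hom X1 (G_obj (H_obj X2))"
      by (rule Sh_comp_in_Sh_hom[OF X2.H.Sh_obj_G X1.to_GH_in_Sh_hom Hm.G_mor_in_Sh_hom])
    fix y a assume y: "y \<in> topspace (fst X1)" and a: "a \<in> carrier (H_obj X2)"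
    have "hat X2 (fst m y) (cls (H_obj X2) a) \<longleftrightarrow> hat X1 y (cls (H_obj X1) (H_mor X1 X2 m a))"
      unfolding X2.hat_cls[OF m_in[OF y] a] X1.hat_cls[OF y Hm.phi_in[OF a]]
      using y by (simp add: app[OF a])
    then show "fst (?L) y (cls (H_obj X2) a) =
        fst (?R) y (cls (H_obj X2) a)"
      using y a hat_in by (simp add: Sh_comp_fst Hm.G_map_cls)
  next
    fix a assume a: "a \<in> carrier (H_obj X2)"
    let ?U = "basic_open (H_obj X2) a" and ?s = "basic_section (H_obj X2) a"
    have *: "openin (front (fst (G_obj (H_obj X2)))) ?U" "?s \<in> sections (snd (G_obj (H_obj X2))) ?U"
      using a X2.H.openin_front_basic_open X2.H.basic_section_in_G by simp_all
    have "snd (?L) ?U ?s =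
        snd m (preimage (fst X2) (hat X2) ?U) (snd a)"
      using a by (simp add: Sh_comp_snd[OF *] X2.to_GH_spec(2))
    also have "\<dots> = snd m (fst a) (snd a)"
      unfolding X2.preimage_hat[OF a] ..
    also have "\<dots> = snd (to_GH X1) (basic_open (H_obj X1) (H_mor X1 X2 m a))
        (basic_section (H_obj X1) (H_mor X1 X2 m a))"
      using a by (simp add: X1.to_GH_spec(2)) (simp add: app)
    also have "\<dots> = snd (to_GH X1) (preimage (point_space (H_obj X1)) Hm.pullback ?U)
        (basic_section (H_obj X1) (H_mor X1 X2 m a))"
      unfolding Hm.preimage_G_map[OF a] ..
    also have "\<dots> = snd (?R) ?U ?s"
      using a by (simp add: Sh_comp_snd[OF *] Hm.G_mor_spec(2))
    finally show "snd (?L) ?U ?s =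
        snd (?R) ?U ?s" .
  qed
qed

lemma to_HG_iso:
  assumes A: "section_algebra A Y v"
  shows "ncf_iso A (H_obj (G_obj A)) (to_HG A)"
proof -
  interpret A: section_algebra A Y v by (rule A)
  interpret GA: sheafed_space "G_obj A" by (rule A.sheafed_space_G)
  show ?thesis
    by (rule bijective_ncf_iso[OF A GA.H.section_algebra_axioms _ A.bij_to_HG A.to_HG_meet A.to_HG_join])
      (simp_all only: to_HG_def restrict_extensional)
qed

lemma to_HG_natural:
  assumes A1: "section_algebra A1 Y1 v1" and A2: "section_algebra A2 Y2 v2"
    and \<phi>: "\<phi> \<in> ncf_hom A1 A2"
  shows "ncf_comp A1 (to_HG A2) \<phi> =
    ncf_comp A1 (H_mor (G_obj A2) (G_obj A1) (G_mor A1 A2 \<phi>)) (to_HG A1)"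
proof (rule extensionalityI)
  interpret A1: section_algebra A1 Y1 v1 by (rule A1)
  interpret A2: section_algebra A2 Y2 v2 by (rule A2)
  interpret phi: ncf_morphism A1 Y1 v1 A2 Y2 v2 \<phi>
    using \<phi> by unfold_locales
  fix a assume a: "a \<in> carrier A1"
  have "H_mor (G_obj A2) (G_obj A1) (G_mor A1 A2 \<phi>) (to_HG A1 a) =
      (preimage (point_space A2) phi.pullback (basic_open A1 a), basic_section A2 (\<phi> a))"
    using a A1.to_HG_in[OF a] by (simp add: A1.to_HG_apply H_mor_apply phi.G_mor_spec(2))
  also have "\<dots> = to_HG A2 (\<phi> a)"
    unfolding phi.preimage_G_map[OF a] using a by (simp add: A2.to_HG_apply)
  finally show "ncf_comp A1 (to_HG A2) \<phi> a =
      ncf_comp A1 (H_mor (G_obj A2) (G_obj A1) (G_mor A1 A2 \<phi>)) (to_HG A1) a"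
    using a by (simp add: compose_eq)
qed simp_all

text \<open>
  The inverse of the natural morphism \<open>\<epsilon> : G(A) \<rightarrow> G(H(G(A)))\<close> is \<open>n = G(\<eta>)\<close> for the isomorphism
  \<open>\<eta> : A \<rightarrow> H(G(A))\<close>. That \<open>n \<circ> \<epsilon>\<close> is the identity is a triangle identity, checked on the \<open>s\<^sub>a\<close>. The other
  composite is checked on the generators of \<open>H(G(A))\<close>, all of which are of the form \<open>\<eta> a\<close>.
\<close>

theorem G_obj_sober:
  assumes A: "section_algebra A Y v"
  shows "sober_sheaf (G_obj A)"
proof -
  interpret A: section_algebra A Y v by (rule A)
  interpret GA: sheafed_space "G_obj A" by (rule A.sheafed_space_G)
  let ?HG = "H_obj (G_obj A)" and ?\<eta> = "to_HG A"
  let ?\<epsilon> = "to_GH (G_obj A)" and ?n = "G_mor A ?HG ?\<eta>"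
  let ?n\<epsilon> = "Sh_comp (G_obj A) (G_obj ?HG) (G_obj A) ?n ?\<epsilon>"
  let ?\<epsilon>n = "Sh_comp (G_obj ?HG) (G_obj A) (G_obj ?HG) ?\<epsilon> ?n"
  interpret eta: ncf_morphism A Y v ?HG "fst (G_obj A)" "stalk_map (G_obj A)" ?\<eta>
    using to_HG_iso[OF A] by unfold_locales (simp add: ncf_iso_def)
  have \<epsilon>: "?\<epsilon> \<in> Sh_hom (G_obj A) (G_obj ?HG)"
    by (rule GA.to_GH_in_Sh_hom)
  have n: "?n \<in> Sh_hom (G_obj ?HG) (G_obj A)"
    by (rule eta.G_mor_in_Sh_hom)
  have \<eta>: "?\<eta> a \<in> carrier ?HG" "fst (?\<eta> a) = basic_open A a" "snd (?\<eta> a) = basic_section A a"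
    if "a \<in> carrier A" for a
    using that A.to_HG_in by (simp_all add: A.to_HG_apply)
  have hat_in: "hat (G_obj A) p \<in> points ?HG" if "p \<in> points A" for p
    using GA.continuous_hat that by (auto simp: continuous_map_def)
  have "?n\<epsilon> = Sh_id (G_obj A)"
  proof (rule A.Sh_hom_into_G_eqI[OF A.Sh_obj_G Sh_comp_in_Sh_hom[OF A.Sh_obj_G \<epsilon> n] GA.Sh_id_in_Sh_hom])
    fix p a assume "p \<in> topspace (fst (G_obj A))" and a: "a \<in> carrier A"
    then have p: "p \<in> points A"
      by simp
    have "hat (G_obj A) p (cls ?HG (?\<eta> a)) \<longleftrightarrow> p (cls A a)"
      using p a \<eta>[OF a] by (simp add: GA.hat_cls) (simp add: basic_open_def)
    then show "fst (?n\<epsilon>) p (cls A a) =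
        fst (Sh_id (G_obj A)) p (cls A a)"
      using p a hat_in by (simp add: Sh_comp_fst eta.G_map_cls Sh_id_def)
  next
    fix a assume a: "a \<in> carrier A"
    have *: "openin (front (fst (G_obj A))) (basic_open A a)"
      "basic_section A a \<in> sections (snd (G_obj A)) (basic_open A a)"
      using a A.openin_front_basic_open A.basic_section_in_G by simp_all
    have "snd (?n\<epsilon>) (basic_open A a) (basic_section A a) =
        snd ?\<epsilon> (preimage (point_space ?HG) eta.pullback (basic_open A a)) (basic_section ?HG (?\<eta> a))"
      using a by (simp add: Sh_comp_snd[OF *] eta.G_mor_spec(2))
    also have "\<dots> = basic_section A a"
      unfolding eta.preimage_G_map[OF a] using \<eta>[OF a] by (simp add: GA.to_GH_spec(2))
    finally show "snd (?n\<epsilon>) (basic_open A a) (basic_section A a) =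
        snd (Sh_id (G_obj A)) (basic_open A a) (basic_section A a)"
      using * by (simp add: Sh_id_def)
  qed
  moreover have "?\<epsilon>n = Sh_id (G_obj ?HG)"
  proof (rule GA.H.Sh_hom_into_G_eqI[OF GA.H.Sh_obj_G Sh_comp_in_Sh_hom[OF GA.H.Sh_obj_G n \<epsilon>]
        sheafed_space.Sh_id_in_Sh_hom[OF GA.H.sheafed_space_G]])
    fix q b assume "q \<in> topspace (fst (G_obj ?HG))" and b: "b \<in> carrier ?HG"
    then have q: "q \<in> points ?HG"
      by simp
    obtain a where a: "a \<in> carrier A" "b = ?\<eta> a"
      using A.bij_to_HG b by (metis bij_betw_imp_surj_on imageE)
    have nq: "eta.pullback q \<in> points A"
      using q by (rule eta.G_map_in_points)
    have "hat (G_obj A) (eta.pullback q) (cls ?HG b) \<longleftrightarrow> eta.pullback q \<in> basic_open A a"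
      using nq a \<eta>[OF a(1)] by (simp add: GA.hat_cls)
    also have "\<dots> \<longleftrightarrow> q (cls ?HG b)"
      using nq a q by (simp add: basic_open_def eta.G_map_cls)
    finally show "fst (?\<epsilon>n) q (cls ?HG b) =
        fst (Sh_id (G_obj ?HG)) q (cls ?HG b)"
      using q by (simp add: Sh_comp_fst Sh_id_def)
  next
    fix b assume b: "b \<in> carrier ?HG"
    obtain a where a: "a \<in> carrier A" "b = ?\<eta> a"
      using A.bij_to_HG b by (metis bij_betw_imp_surj_on imageE)
    have *: "openin (front (fst (G_obj ?HG))) (basic_open ?HG b)"
      "basic_section ?HG b \<in> sections (snd (G_obj ?HG)) (basic_open ?HG b)"
      using b GA.H.openin_front_basic_open GA.H.basic_section_in_G by simp_all
    have "snd (?\<epsilon>n) (basic_open ?HG b) (basic_section ?HG b) =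
        snd ?n (preimage (fst (G_obj A)) (hat (G_obj A)) (basic_open ?HG b)) (snd b)"
      using b by (simp add: Sh_comp_snd[OF *] GA.to_GH_spec(2))
    also have "\<dots> = basic_section ?HG b"
      unfolding GA.preimage_hat[OF b] using a \<eta>[OF a(1)] by (simp add: eta.G_mor_spec(2))
    finally show "snd (?\<epsilon>n) (basic_open ?HG b) (basic_section ?HG b) =
        snd (Sh_id (G_obj ?HG)) (basic_open ?HG b) (basic_section ?HG b)"
      using * by (simp add: Sh_id_def)
  qed
  ultimately show ?thesis
    unfolding sober_sheaf_def Sh_iso_def using A.Sh_obj_G \<epsilon> n by blast
qed

theorem theorem3p9:
  shows
   "\<comment> \<open>\<open>H\<close> is a functor from the opposite of the sober sheaves to the spatial frames\<close>
    (\<forall>X :: ('y1, 's1) sheaf_space. sober_sheaf X \<longrightarrow>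
       spatial_frame TYPE('y1) TYPE('s1) (H_obj X) \<and>
       H_mor X X (Sh_id X) = ncf_id (H_obj X)) \<and>
    (\<forall>(X1 :: ('y1, 's1) sheaf_space) (X2 :: ('y2, 's2) sheaf_space).
       sober_sheaf X1 \<and> sober_sheaf X2 \<longrightarrow>
       (\<forall>m\<in>Sh_hom X1 X2. H_mor X1 X2 m \<in> ncf_hom (H_obj X2) (H_obj X1))) \<and>
    (\<forall>(X1 :: ('y1, 's1) sheaf_space) (X2 :: ('y2, 's2) sheaf_space)
       (X3 :: ('y3, 's3) sheaf_space).
       sober_sheaf X1 \<and> sober_sheaf X2 \<and> sober_sheaf X3 \<longrightarrow>
       (\<forall>m\<in>Sh_hom X1 X2. \<forall>n\<in>Sh_hom X2 X3.
          H_mor X1 X3 (Sh_comp X1 X2 X3 n m) =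
          ncf_comp (H_obj X3) (H_mor X1 X2 m) (H_mor X2 X3 n))) \<and>
    \<comment> \<open>\<open>G\<close> is a functor from the spatial frames to the opposite of the sober sheaves\<close>
    (\<forall>A :: 'a1 skew_algebra. spatial_frame TYPE('v1) TYPE('t1) A \<longrightarrow>
       sober_sheaf (G_obj A) \<and>
       G_mor A A (ncf_id A) = Sh_id (G_obj A)) \<and>
    (\<forall>(A1 :: 'a1 skew_algebra) (A2 :: 'a2 skew_algebra).
       spatial_frame TYPE('v1) TYPE('t1) A1 \<and> spatial_frame TYPE('v2) TYPE('t2) A2 \<longrightarrow>
       (\<forall>\<phi>\<in>ncf_hom A1 A2. G_mor A1 A2 \<phi> \<in> Sh_hom (G_obj A2) (G_obj A1))) \<and>
    (\<forall>(A1 :: 'a1 skew_algebra) (A2 :: 'a2 skew_algebra) (A3 :: 'a3 skew_algebra).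
       spatial_frame TYPE('v1) TYPE('t1) A1 \<and> spatial_frame TYPE('v2) TYPE('t2) A2 \<and>
       spatial_frame TYPE('v3) TYPE('t3) A3 \<longrightarrow>
       (\<forall>\<phi>\<in>ncf_hom A1 A2. \<forall>\<psi>\<in>ncf_hom A2 A3.
          G_mor A1 A3 (ncf_comp A1 \<psi> \<phi>) =
          Sh_comp (G_obj A3) (G_obj A2) (G_obj A1) (G_mor A1 A2 \<phi>) (G_mor A2 A3 \<psi>))) \<and>
    \<comment> \<open>\<open>to_GH\<close> is a natural isomorphism from the identity to \<open>G H\<close>\<close>
    (\<forall>X :: ('y1, 's1) sheaf_space. sober_sheaf X \<longrightarrow>
       Sh_iso X (G_obj (H_obj X)) (to_GH X)) \<and>
    (\<forall>(X1 :: ('y1, 's1) sheaf_space) (X2 :: ('y2, 's2) sheaf_space).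
       sober_sheaf X1 \<and> sober_sheaf X2 \<longrightarrow>
       (\<forall>m\<in>Sh_hom X1 X2.
          Sh_comp X1 X2 (G_obj (H_obj X2)) (to_GH X2) m =
          Sh_comp X1 (G_obj (H_obj X1)) (G_obj (H_obj X2))
            (G_mor (H_obj X2) (H_obj X1) (H_mor X1 X2 m)) (to_GH X1))) \<and>
    \<comment> \<open>\<open>to_HG\<close> is a natural isomorphism from the identity to \<open>H G\<close>\<close>
    (\<forall>A :: 'a1 skew_algebra. spatial_frame TYPE('v1) TYPE('t1) A \<longrightarrow>
       ncf_iso A (H_obj (G_obj A)) (to_HG A)) \<and>
    (\<forall>(A1 :: 'a1 skew_algebra) (A2 :: 'a2 skew_algebra).
       spatial_frame TYPE('v1) TYPE('t1) A1 \<and> spatial_frame TYPE('v2) TYPE('t2) A2 \<longrightarrow>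
       (\<forall>\<phi>\<in>ncf_hom A1 A2.
          ncf_comp A1 (to_HG A2) \<phi> =
          ncf_comp A1 (H_mor (G_obj A2) (G_obj A1) (G_mor A1 A2 \<phi>)) (to_HG A1)))"
proof (intro conjI allI impI ballI; (elim conjE)?)
  note sober = sober_sheaf_def[THEN iffD1, THEN conjunct1]
  {
    fix X :: "('y1, 's1) sheaf_space" assume X: "sober_sheaf X"
    show "spatial_frame TYPE('y1) TYPE('s1) (H_obj X)"
      using sober[OF X] by (rule H_obj_spatial)
    show "H_mor X X (Sh_id X) = ncf_id (H_obj X)"
      using sober[OF X] by (rule H_mor_id)
    show "Sh_iso X (G_obj (H_obj X)) (to_GH X)"
      using X by (simp add: sober_sheaf_def)
  next
    fix X1 :: "('y1, 's1) sheaf_space" and X2 :: "('y2, 's2) sheaf_space" and m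
    assume X: "sober_sheaf X1" "sober_sheaf X2" and m: "m \<in> Sh_hom X1 X2"
    show "H_mor X1 X2 m \<in> ncf_hom (H_obj X2) (H_obj X1)"
      using sober[OF X(1)] sober[OF X(2)] m by (rule H_mor_hom)
    show "Sh_comp X1 X2 (G_obj (H_obj X2)) (to_GH X2) m =
        Sh_comp X1 (G_obj (H_obj X1)) (G_obj (H_obj X2))
          (G_mor (H_obj X2) (H_obj X1) (H_mor X1 X2 m)) (to_GH X1)"
      using sober[OF X(1)] sober[OF X(2)] m by (rule to_GH_natural)
    fix X3 :: "('y3, 's3) sheaf_space" and n
    assume X3: "sober_sheaf X3" and n: "n \<in> Sh_hom X2 X3"
    show "H_mor X1 X3 (Sh_comp X1 X2 X3 n m) = ncf_comp (H_obj X3) (H_mor X1 X2 m) (H_mor X2 X3 n)"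
      using sober[OF X(2)] sober[OF X3] m n by (rule H_mor_comp)
  next
    fix A :: "'a1 skew_algebra" assume "spatial_frame TYPE('v1) TYPE('t1) A"
    then obtain Y :: "'v1 topology" and v :: "'a1 \<Rightarrow> 'v1 \<rightharpoonup> ('v1 set \<times> 't1) set"
      where A: "section_algebra A Y v"
      using spatial_section_algebra by metis
    show "sober_sheaf (G_obj A)"
      using A by (rule G_obj_sober)
    show "G_mor A A (ncf_id A) = Sh_id (G_obj A)"
      using A by (rule G_mor_id)
    show "ncf_iso A (H_obj (G_obj A)) (to_HG A)"
      using A by (rule to_HG_iso)
  next
    fix A1 :: "'a1 skew_algebra" and A2 :: "'a2 skew_algebra" and \<phi>
    assume "spatial_frame TYPE('v1) TYPE('t1) A1" "spatial_frame TYPE('v2) TYPE('t2) A2"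
      and \<phi>: "\<phi> \<in> ncf_hom A1 A2"
    then obtain Y1 :: "'v1 topology" and v1 :: "'a1 \<Rightarrow> 'v1 \<rightharpoonup> ('v1 set \<times> 't1) set"
      and Y2 :: "'v2 topology" and v2 :: "'a2 \<Rightarrow> 'v2 \<rightharpoonup> ('v2 set \<times> 't2) set"
      where A1: "section_algebra A1 Y1 v1" and A2: "section_algebra A2 Y2 v2"
      using spatial_section_algebra by metis
    interpret ncf_morphism A1 Y1 v1 A2 Y2 v2 \<phi>
      using A1 A2 \<phi> by (simp add: ncf_morphism_def ncf_morphism_axioms_def section_algebra_pair_def)
    show "G_mor A1 A2 \<phi> \<in> Sh_hom (G_obj A2) (G_obj A1)"
      by (rule G_mor_in_Sh_hom)
    show "ncf_comp A1 (to_HG A2) \<phi> =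
        ncf_comp A1 (H_mor (G_obj A2) (G_obj A1) (G_mor A1 A2 \<phi>)) (to_HG A1)"
      using A1 A2 \<phi> by (rule to_HG_natural)
    fix A3 :: "'a3 skew_algebra" and \<psi>
    assume "spatial_frame TYPE('v3) TYPE('t3) A3" and \<psi>: "\<psi> \<in> ncf_hom A2 A3"
    then obtain Y3 :: "'v3 topology" and v3 :: "'a3 \<Rightarrow> 'v3 \<rightharpoonup> ('v3 set \<times> 't3) set"
      where A3: "section_algebra A3 Y3 v3"
      using spatial_section_algebra by metis
    show "G_mor A1 A3 (ncf_comp A1 \<psi> \<phi>) =
        Sh_comp (G_obj A3) (G_obj A2) (G_obj A1) (G_mor A1 A2 \<phi>) (G_mor A2 A3 \<psi>)"
      using A1 A2 A3 \<phi> \<psi> by (rule G_mor_comp)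
  }
qed

end
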